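(* Let $a>0$ and let $(X,\Phi)$ be a topological flow on a compact metrizable space that is an extension of the solenoid $(Y,\Psi)$. Suppose that $\mathrm{mdim}(X,\Phi)<a/2$. Then $(X,\Phi)$ can be embedded in $\mathcal{B}(a)$; that is, there is a continuous injective map $h:X\to\mathcal{B}(a)$ with $h(\Phi_r(x))=\tau_r(h(x))$ for all $x\in X$ and $r\in\mathbb{R}$.
   Context: A topological flow $(X,\Phi)$ is a compact space $X$ with a continuous action $\Phi=(\Phi_t)_{t\in\mathbb{R}}$ of $\mathbb{R}$. $(X,\Phi)$ is an extension of $(Y,\Psi)$ if there is a continuous surjection $\pi:X\to Y$ with $\pi\circ\Phi_t=\Psi_t\circ\pi$ for all $t$. Solenoid: for $n\ge 1$ let $Y_n=[0,n!]$ with $0$ identified with $n!$. Let $Y=\{(x_n)_{n\ge1}\in\prod_{n\ge1}Y_n : x_n = x_{n+1} \bmod n!\ \text{for all } n\}$, with flow $\Psi_r((x_n)_n)=(x_n+r \bmod n!)_n$, $r\in\mathbb{R}$. Mean dimension of a flow: for a compact metric space $(X,d)$ and $\epsilon>0$, $\mathrm{Widim}_\epsilon(X,d)$ is the minimum of the Lebesgue covering dimension $\dim K$ over all compact metrizable spaces $K$ admitting a continuous map $f:X\to K$ with $\mathrm{diam}(f^{-1}(y))<\epsilon$ for all $y\in K$. With $d_R(x,y)=\sup_{0\le r\le R}d(\Phi_r x,\Phi_r y)$, $\mathrm{mdim}(X,\Phi)=\lim_{\epsilon\to0}\lim_{R\to\infty}\frac{\mathrm{Widim}_\epsilon(X,d_R)}{R}$.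 Band-limited functions: $\mathcal{B}(a)$ is the space of all continuous $f:\mathbb{R}\to\mathbb{R}$ with $\|f\|_\infty\le1$ whose Fourier transform $\mathcal{F}(f)$ (as a tempered distribution, normalized by $\mathcal{F}(f)(\xi)=\int_{\mathbb{R}} f(x)e^{-2\pi i\xi x}\,dx$) has support contained in $[-\frac a2,\frac a2]$. It is compact under the metric $d(f,g)=\sum_{n\ge1}2^{-n}\sup_{|x|\le n}|f(x)-g(x)|$. $\mathbb{R}$ acts on it by $\tau_r(f)(x)=f(x+r)$. *)

theory Defs
  imports "HOL-Analysis.Analysis" "HOL-Library.Real_Mod"
begin

section \<open>Topological flows and extensions\<close>

definition topological_flow :: "'a topology \<Rightarrow> (real \<Rightarrow> 'a \<Rightarrow> 'a) \<Rightarrow> bool" where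
  "topological_flow X \<Phi> \<longleftrightarrow>
     compact_space X \<and>
     continuous_map (prod_topology euclideanreal X) X (\<lambda>(t, x). \<Phi> t x) \<and>
     (\<forall>x\<in>topspace X. \<Phi> 0 x = x) \<and>
     (\<forall>s t. \<forall>x\<in>topspace X. \<Phi> (s + t) x = \<Phi> s (\<Phi> t x))"

definition flow_extension ::
  "'a topology \<Rightarrow> (real \<Rightarrow> 'a \<Rightarrow> 'a) \<Rightarrow> 'b topology \<Rightarrow> (real \<Rightarrow> 'b \<Rightarrow> 'b) \<Rightarrow> bool" where
  "flow_extension X \<Phi> Y \<Psi> \<longleftrightarrow>
     (\<exists>\<pi>. continuous_map X Y \<pi> \<and> \<pi> ` topspace X = topspace Y \<and>
          (\<forall>t. \<forall>x\<in>topspace X. \<pi> (\<Phi> t x) = \<Psi> t (\<pi> x)))"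


section \<open>The solenoid\<close>

definition quotient_topology :: "'a topology \<Rightarrow> ('a \<Rightarrow> 'b) \<Rightarrow> 'b topology" where
  "quotient_topology X q =
     topology (\<lambda>U. U \<subseteq> q ` topspace X \<and> openin X {x \<in> topspace X. q x \<in> U})"

lemma openin_quotient_topology:
  "openin (quotient_topology X q) U \<longleftrightarrow>
     U \<subseteq> q ` topspace X \<and> openin X {x \<in> topspace X. q x \<in> U}"
proof -
  have 1: "{x \<in> topspace X. q x \<in> S \<inter> T} =
      {x \<in> topspace X. q x \<in> S} \<inter> {x \<in> topspace X. q x \<in> T}" for S T
    by auto
  have 2: "{x \<in> topspace X. q x \<in> \<Union>K} = (\<Union>S\<in>K. {x \<in> topspace X. q x \<in> S})" for K
    by auto
  have "istopology (\<lambda>U. U \<subseteq> q ` topspace X \<and> openin X {x \<in> topspace X. q x \<in> U})"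
    unfolding istopology_def 1 2 by (auto intro!: openin_Int openin_Union)
  then show ?thesis
    by (simp add: quotient_topology_def)
qed

lemma topspace_quotient_topology: "topspace (quotient_topology X q) = q ` topspace X"
proof
  show "topspace (quotient_topology X q) \<subseteq> q ` topspace X"
    by (metis openin_quotient_topology openin_topspace)
  have "{x \<in> topspace X. q x \<in> q ` topspace X} = topspace X"
    by auto
  then have "openin (quotient_topology X q) (q ` topspace X)"
    by (simp add: openin_quotient_topology)
  then show "q ` topspace X \<subseteq> topspace (quotient_topology X q)"
    by (rule openin_subset)
qed

lemma quotient_map_quotient_topology: "quotient_map X (quotient_topology X q) q"
  by (simp add: quotient_map_def openin_quotient_topology topspace_quotient_topology)

text \<open>
  The circle obtained from \<open>[0, c]\<close> by identifying \<open>0\<close> with \<open>c\<close>.  Its points are the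
  representatives in \<open>[0, c)\<close>, the class \<open>{0, c}\<close> being represented by \<open>0\<close>; its topology
  is the quotient topology and not the one \<open>[0, c)\<close> has as a subset of the line.
\<close>

definition circle_topology :: "real \<Rightarrow> real topology" where
  "circle_topology c = quotient_topology (top_of_set {0..c}) (\<lambda>x. if x = c then 0 else x)"

definition solenoid :: "(nat \<Rightarrow> real) topology" where
  "solenoid = subtopology (product_topology (\<lambda>n. circle_topology (fact n)) {1..})
                {x. \<forall>n\<ge>1. x n = x (Suc n) rmod fact n}"

definition solenoid_flow :: "real \<Rightarrow> (nat \<Rightarrow> real) \<Rightarrow> (nat \<Rightarrow> real)" where
  "solenoid_flow r x = (\<lambda>n\<in>{1..}. (x n + r) rmod fact n)"


section \<open>Mean dimension\<close>

definition covering_dim_le :: "'a topology \<Rightarrow> int \<Rightarrow> bool" where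
  "covering_dim_le X n \<longleftrightarrow>
     (\<forall>\<U>. (\<forall>U\<in>\<U>. openin X U) \<and> \<Union>\<U> = topspace X \<longrightarrow>
       (\<exists>\<V>. (\<forall>V\<in>\<V>. openin X V) \<and> \<Union>\<V> = topspace X \<and> (\<forall>V\<in>\<V>. \<exists>U\<in>\<U>. V \<subseteq> U) \<and>
            (\<forall>x\<in>topspace X. finite {V \<in> \<V>. x \<in> V} \<and> int (card {V \<in> \<V>. x \<in> V}) \<le> n + 1)))"

text \<open>The value is \<open>-1\<close> for the empty space and \<open>\<infinity>\<close> if there is no bound.\<close>

definition covering_dim :: "'a topology \<Rightarrow> ereal" where
  "covering_dim X = (INF n\<in>{n. n \<ge> -1 \<and> covering_dim_le X n}. ereal (real_of_int n))"

definition diam_wrt :: "('a \<Rightarrow> 'a \<Rightarrow> real) \<Rightarrow> 'a set \<Rightarrow> real" where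
  "diam_wrt d S = (if S = {} then 0 else SUP (x, y)\<in>S \<times> S. d x y)"

text \<open>
  Here \<open>d\<close> is meant to be a metric on \<open>topspace X\<close> that induces the topology \<open>X\<close>.
  Every compact metrizable space is homeomorphic to a subspace of the Hilbert cube, so
  letting \<open>K\<close> range over the compact metrizable topologies on sets of real sequences
  covers all compact metrizable spaces.  As the values of \<^const>\<open>covering_dim\<close> are
  \<open>\<infinity>\<close> or integers \<open>\<ge> -1\<close>, the infimum is a minimum.
\<close>

definition Widim :: "real \<Rightarrow> 'a topology \<Rightarrow> ('a \<Rightarrow> 'a \<Rightarrow> real) \<Rightarrow> ereal" where
  "Widim \<epsilon> X d =
     (INF K\<in>{K :: (nat \<Rightarrow> real) topology. compact_space K \<and> metrizable_space K \<and>
              (\<exists>f. continuous_map X K f \<and>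
                   (\<forall>y\<in>topspace K. diam_wrt d {x \<in> topspace X. f x = y} < \<epsilon>))}.
        covering_dim K)"

definition orbit_metric ::
  "(real \<Rightarrow> 'a \<Rightarrow> 'a) \<Rightarrow> ('a \<Rightarrow> 'a \<Rightarrow> real) \<Rightarrow> real \<Rightarrow> 'a \<Rightarrow> 'a \<Rightarrow> real" where
  "orbit_metric \<Phi> d R x y = (SUP r\<in>{0..R}. d (\<Phi> r x) (\<Phi> r y))"

text \<open>
  If \<open>X\<close> is compact, then \<^term>\<open>orbit_metric \<Phi> d R\<close> also induces the topology \<open>X\<close>, which
  is why \<open>X\<close> remains the topology in \<^const>\<open>Widim\<close>.
\<close>

definition mdim :: "'a topology \<Rightarrow> ('a \<Rightarrow> 'a \<Rightarrow> real) \<Rightarrow> (real \<Rightarrow> 'a \<Rightarrow> 'a) \<Rightarrow> ereal" where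
  "mdim X d \<Phi> =
     Lim (at_right 0) (\<lambda>\<epsilon>. Lim at_top (\<lambda>R. Widim \<epsilon> X (orbit_metric \<Phi> d R) / ereal R))"


section \<open>Tempered distributions and band-limited functions\<close>

definition nth_deriv :: "nat \<Rightarrow> (real \<Rightarrow> complex) \<Rightarrow> (real \<Rightarrow> complex)" where
  "nth_deriv n \<phi> = ((\<lambda>g x. vector_derivative g (at x)) ^^ n) \<phi>"

definition smooth :: "(real \<Rightarrow> complex) \<Rightarrow> bool" where
  "smooth \<phi> \<longleftrightarrow> (\<forall>n x. nth_deriv n \<phi> differentiable (at x))"

definition schwartz :: "(real \<Rightarrow> complex) set" where
  "schwartz = {\<phi>. smooth \<phi> \<and> (\<forall>m n. bounded (range (\<lambda>x. x ^ m *\<^sub>R nth_deriv n \<phi> x)))}"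

definition test_functions_on :: "real set \<Rightarrow> (real \<Rightarrow> complex) set" where
  "test_functions_on U =
     {\<phi>. smooth \<phi> \<and> compact (closure {x. \<phi> x \<noteq> 0}) \<and> closure {x. \<phi> x \<noteq> 0} \<subseteq> U}"

definition fourier :: "(real \<Rightarrow> complex) \<Rightarrow> (real \<Rightarrow> complex)" where
  "fourier \<phi> \<xi> = (LINT x|lborel. \<phi> x * exp (- (2 * pi * \<i> * \<xi> * x)))"

text \<open>
  A tempered distribution is represented by its action on \<^const>\<open>schwartz\<close>; values at
  other functions play no role.
\<close>

definition distribution_of :: "(real \<Rightarrow> real) \<Rightarrow> ((real \<Rightarrow> complex) \<Rightarrow> complex)" where
  "distribution_of f \<phi> = (LINT x|lborel. complex_of_real (f x) * \<phi> x)"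

definition fourier_distribution ::
  "((real \<Rightarrow> complex) \<Rightarrow> complex) \<Rightarrow> ((real \<Rightarrow> complex) \<Rightarrow> complex)" where
  "fourier_distribution T \<phi> = T (fourier \<phi>)"

definition distribution_support :: "((real \<Rightarrow> complex) \<Rightarrow> complex) \<Rightarrow> real set" where
  "distribution_support T = - \<Union>{U. open U \<and> (\<forall>\<phi>\<in>test_functions_on U. T \<phi> = 0)}"

definition band_limited :: "real \<Rightarrow> (real \<Rightarrow> real) set" where
  "band_limited a =
     {f. continuous_on UNIV f \<and> (\<forall>x. \<bar>f x\<bar> \<le> 1) \<and>
         distribution_support (fourier_distribution (distribution_of f)) \<subseteq> {- (a / 2)..a / 2}}"

text \<open>
  The default value \<open>0\<close> off \<^term>\<open>band_limited a\<close> is there because \<^const>\<open>Metric_space\<close>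
  demands nonnegativity and symmetry on the whole type.
\<close>

definition band_limited_dist :: "real \<Rightarrow> (real \<Rightarrow> real) \<Rightarrow> (real \<Rightarrow> real) \<Rightarrow> real" where
  "band_limited_dist a f g =
     (if f \<in> band_limited a \<and> g \<in> band_limited a
      then \<Sum>n. (1 / 2) ^ Suc n * (SUP x\<in>{- real (Suc n)..real (Suc n)}. \<bar>f x - g x\<bar>)
      else 0)"

definition band_limited_topology :: "real \<Rightarrow> (real \<Rightarrow> real) topology" where
  "band_limited_topology a = Metric_space.mtopology (band_limited a) (band_limited_dist a)"

definition shift :: "real \<Rightarrow> (real \<Rightarrow> real) \<Rightarrow> (real \<Rightarrow> real)" where
  "shift r f = (\<lambda>x. f (x + r))"

lemma Metric_space_band_limited: "Metric_space (band_limited a) (band_limited_dist a)"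
proof -
  let ?I = "\<lambda>n. {- real (Suc n)..real (Suc n)}"
  define s where "s f g n = (SUP x\<in>?I n. \<bar>f x - g x\<bar>)" for f g :: "real \<Rightarrow> real" and n
  have bd: "\<bar>f x - g x\<bar> \<le> 2" if "f \<in> band_limited a" "g \<in> band_limited a" for f g x
  proof -
    have "\<bar>f x\<bar> \<le> 1" "\<bar>g x\<bar> \<le> 1"
      using that by (auto simp: band_limited_def)
    then show ?thesis by linarith
  qed
  have bdd: "bdd_above ((\<lambda>x. \<bar>f x - g x\<bar>) ` ?I n)"
    if "f \<in> band_limited a" "g \<in> band_limited a" for f g n
    using bd[OF that] by (auto intro!: bdd_aboveI2)
  have up: "\<bar>f x - g x\<bar> \<le> s f g n"
    if "f \<in> band_limited a" "g \<in> band_limited a" "x \<in> ?I n" for f g n x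
    unfolding s_def by (rule cSUP_upper[OF that(3) bdd[OF that(1,2)]])
  have le2: "s f g n \<le> 2" if "f \<in> band_limited a" "g \<in> band_limited a" for f g n
    unfolding s_def by (rule cSUP_least) (auto intro: bd[OF that])
  have ge0: "0 \<le> s f g n" if "f \<in> band_limited a" "g \<in> band_limited a" for f g n
    using up[OF that, of 0 n] by (simp add: order_trans[OF abs_ge_zero])
  have tri: "s f h n \<le> s f g n + s g h n"
    if "f \<in> band_limited a" "g \<in> band_limited a" "h \<in> band_limited a" for f g h n
    unfolding s_def[of f h]
  proof (rule cSUP_least)
    fix x assume x: "x \<in> ?I n"
    show "\<bar>f x - h x\<bar> \<le> s f g n + s g h n"
      using up[OF that(1,2) x] up[OF that(2,3) x] by linarith
  qed simp
  have summ: "summable (\<lambda>n. (1 / 2) ^ Suc n * s f g n)"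
    if "f \<in> band_limited a" "g \<in> band_limited a" for f g
  proof (rule summable_comparison_test')
    show "summable (\<lambda>n. (1 / 2 :: real) ^ n)"
      by (simp add: summable_geometric)
    fix n :: nat
    show "norm ((1 / 2) ^ Suc n * s f g n) \<le> (1 / 2) ^ n"
      using le2[OF that, of n] ge0[OF that, of n] by (simp add: field_simps)
  qed
  have d: "band_limited_dist a f g = (\<Sum>n. (1 / 2) ^ Suc n * s f g n)"
    if "f \<in> band_limited a" "g \<in> band_limited a" for f g
    using that by (simp add: band_limited_dist_def s_def)
  show ?thesis
  proof
    fix f g
    show "0 \<le> band_limited_dist a f g"
    proof (cases "f \<in> band_limited a \<and> g \<in> band_limited a")
      case True
      then show ?thesis
        using d[of f g] suminf_nonneg[OF summ[of f g]] ge0[of f g] by simp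
    qed (auto simp: band_limited_dist_def)
    show "band_limited_dist a f g = band_limited_dist a g f"
      by (auto simp: band_limited_dist_def abs_minus_commute)
  next
    fix f g assume fg: "f \<in> band_limited a" "g \<in> band_limited a"
    show "band_limited_dist a f g = 0 \<longleftrightarrow> f = g"
    proof
      assume "f = g"
      then show "band_limited_dist a f g = 0"
        by (simp add: band_limited_dist_def)
    next
      assume "band_limited_dist a f g = 0"
      then have "\<forall>n. (1 / 2) ^ Suc n * s f g n = 0"
        using suminf_eq_zero_iff[OF summ[OF fg]] ge0[OF fg] d[OF fg] by simp
      then have z: "s f g n = 0" for n
        by simp
      show "f = g"
      proof
        fix x
        obtain n where "\<bar>x\<bar> \<le> real n"
          using real_arch_simple by blast
        then have "x \<in> ?I n" by auto
        from up[OF fg this] z show "f x = g x" by simp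
      qed
    qed
  next
    fix f g h
    assume fgh: "f \<in> band_limited a" "g \<in> band_limited a" "h \<in> band_limited a"
    have "(\<Sum>n. (1 / 2) ^ Suc n * s f h n)
        \<le> (\<Sum>n. (1 / 2) ^ Suc n * s f g n + (1 / 2) ^ Suc n * s g h n)"
    proof (rule suminf_le)
      fix n
      show "(1 / 2) ^ Suc n * s f h n \<le> (1 / 2) ^ Suc n * s f g n + (1 / 2) ^ Suc n * s g h n"
        using mult_left_mono[OF tri[OF fgh, of n], of "(1 / 2) ^ Suc n"]
        by (simp add: distrib_left)
    qed (intro summ summable_add fgh)+
    also have "\<dots> = (\<Sum>n. (1 / 2) ^ Suc n * s f g n) + (\<Sum>n. (1 / 2) ^ Suc n * s g h n)"
      by (rule suminf_add[symmetric]) (intro summ fgh)+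
    finally show "band_limited_dist a f h \<le> band_limited_dist a f g + band_limited_dist a g h"
      using fgh by (simp add: d)
  qed
qed

end

theory Submission
  imports Defs
begin

text \<open>
  A continuous equivariant map from \<open>X\<close> to the band-limited functions has the form
  \<open>x \<mapsto> (\<lambda>t. H (\<Phi> t x))\<close> for a continuous function \<open>H\<close> on \<open>X\<close>.  Here \<open>H\<close> is the sum of two
  functions \<open>F\<close> and \<open>G\<close> whose signals along orbits occupy disjoint frequency bands, both
  within \<open>[- \<pi> a, \<pi> a]\<close> when frequencies are measured in radians.

  The high band is reserved for the solenoid.  Its coordinates give characters \<open>\<kappa> n\<close> of \<open>X\<close>,
  unimodular functions that rotate with period \<open>n!\<close> along orbits, and \<open>G\<close> is a series of
  products of such characters with frequencies between the low band and \<open>\<pi> a\<close>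
  (\<open>separating_characters\<close>).  Pairing a signal with a suitably modulated squared sinc kills
  the low band and isolates a single term of \<open>G\<close>.  So the signal of \<open>x\<close> determines all
  \<open>\<kappa> n x\<close>, hence the signal of \<open>G\<close>, hence that of \<open>F\<close>.

  It remains to find \<open>F\<close> that separates points with the same \<open>\<kappa> n\<close> for all \<open>n\<close>, and this is
  where mean dimension enters.  If it is less than \<open>c < a / 2\<close>, then for every \<open>\<epsilon>\<close> and all
  large \<open>L\<close> the orbit segments of length \<open>L\<close> are described up to \<open>\<epsilon>\<close> by a space of dimension
  \<open>n < c L\<close> (\<open>mdim_less_imp_linear_Widim\<close>).  Fix a rational \<open>r\<close> with \<open>2 c < r < a\<close>.  A signal
  with frequencies up to slightly above \<open>\<pi> r\<close> can be prescribed freely at the times \<open>j / r\<close>,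
  by means of the decaying kernel \<open>sinc (\<pi> r t) (sinc (\<delta> t))\<^sup>2\<close>.  For \<open>L = N!\<close> the
  character \<open>\<kappa> N\<close> places such a lattice of times on every orbit, in a way that depends
  continuously on the point, with \<open>m = L r > 2 n\<close> times in each period.

  That \<open>m > 2 n\<close> numbers are enough to separate points at scale \<open>\<epsilon>\<close> follows from coloured
  covers.  A space of dimension \<open>n\<close> has arbitrarily fine covers in \<open>m\<close> colours such that sets
  of one colour are disjoint and every point sees at least \<open>m - n\<close> colours
  (\<open>covering_dim_le_imp_coloured_cover\<close>).  If the \<open>i\<close>-th number takes different values on
  different sets of the \<open>i\<close>-th colour, then two points with the same numbers, having a colour
  in common because \<open>2 (m - n) > m\<close>, lie in the same small set.  Such a change of \<open>F\<close> can be
  made arbitrarily small (\<open>separating_perturbation\<close>), and \<open>F\<close> is obtained as the limit of a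
  sequence of these changes (\<open>separating_limit\<close>).

  Coloured covers also give the product theorem for covering dimension, which makes
  \<^const>\<open>Widim\<close> subadditive in the length of time and so guarantees that the limits in the
  definition of mean dimension exist.
\<close>

section \<open>Coloured covers\<close>

lemma openin_multiplicity_ge:
  assumes "finite I" "\<And>i. i \<in> I \<Longrightarrow> openin X (G i)"
  shows "openin X {x \<in> topspace X. q \<le> card {i \<in> I. x \<in> G i}}"
proof -
  have "{x \<in> topspace X. q \<le> card {i \<in> I. x \<in> G i}} =
        (\<Union>S\<in>{S. S \<subseteq> I \<and> card S = q}. topspace X \<inter> \<Inter>(G ` S))"
  proof (intro equalityI subsetI)
    fix x assume "x \<in> {x \<in> topspace X. q \<le> card {i \<in> I. x \<in> G i}}"
    then have x: "x \<in> topspace X" "q \<le> card {i \<in> I. x \<in> G i}" by auto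
    obtain S where "S \<subseteq> {i \<in> I. x \<in> G i}" "card S = q"
      using obtain_subset_with_card_n[OF x(2)] by metis
    with x(1) show "x \<in> (\<Union>S\<in>{S. S \<subseteq> I \<and> card S = q}. topspace X \<inter> \<Inter>(G ` S))"
      by blast
  next
    fix x assume "x \<in> (\<Union>S\<in>{S. S \<subseteq> I \<and> card S = q}. topspace X \<inter> \<Inter>(G ` S))"
    then obtain S where S: "S \<subseteq> I" "card S = q" "x \<in> topspace X" "\<forall>i\<in>S. x \<in> G i"
      by blast
    then have "card S \<le> card {i \<in> I. x \<in> G i}"
      using assms(1) by (intro card_mono) auto
    with S show "x \<in> {x \<in> topspace X. q \<le> card {i \<in> I. x \<in> G i}}"
      by auto
  qed
  moreover have "openin X (topspace X \<inter> \<Inter>(G ` S))" if "S \<subseteq> I" for S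
  proof (cases "S = {}")
    case False
    then have "openin X (\<Inter>(G ` S))"
      using that assms by (intro openin_Inter) (auto intro: finite_subset)
    then show ?thesis by blast
  qed auto
  moreover have "openin X (\<Union>S\<in>{S. S \<subseteq> I \<and> card S = q}. topspace X \<inter> \<Inter>(G ` S))"
    by (rule openin_Union) (use calculation(2) in blast)
  ultimately show ?thesis
    by (simp only:)
qed

text \<open>
  The points that the other members cover fewer than \<open>q\<close> times form a closed subset of
  \<open>G j\<close>, and normality leaves room between this subset and the complement of \<open>G j\<close>.
\<close>

lemma shrink_one:
  assumes X: "normal_space X" and I: "finite I" "j \<in> I" and G: "\<And>i. i \<in> I \<Longrightarrow> openin X (G i)"
    and q: "\<And>x. x \<in> topspace X \<Longrightarrow> q \<le> card {i \<in> I. x \<in> G i}"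
  shows "\<exists>W. openin X W \<and> X closure_of W \<subseteq> G j \<and>
             (\<forall>x\<in>topspace X. q \<le> card {i \<in> I. x \<in> (G(j := W)) i})"
proof -
  define D where "D = topspace X - {x \<in> topspace X. q \<le> card {i \<in> I - {j}. x \<in> G i}}"
  have "closedin X D"
    unfolding D_def using I G by (intro closedin_diff openin_multiplicity_ge) auto
  moreover have "D \<subseteq> G j"
  proof
    fix x assume x: "x \<in> D"
    show "x \<in> G j"
    proof (rule ccontr)
      assume "x \<notin> G j"
      then have "{i \<in> I - {j}. x \<in> G i} = {i \<in> I. x \<in> G i}" by blast
      with x q show False by (auto simp: D_def)
    qed
  qed
  ultimately obtain W where W: "openin X W" "D \<subseteq> W" "X closure_of W \<subseteq> G j"
    using X G[OF I(2)] unfolding normal_space_alt by meson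
  have "q \<le> card {i \<in> I. x \<in> (G(j := W)) i}" if x: "x \<in> topspace X" for x
  proof (cases "x \<in> D")
    case True
    then have "x \<in> W" "x \<in> G j" using W \<open>D \<subseteq> G j\<close> by auto
    then have "{i \<in> I. x \<in> (G(j := W)) i} = {i \<in> I. x \<in> G i}" by auto
    with q[OF x] show ?thesis by simp
  next
    case False
    then have "q \<le> card {i \<in> I - {j}. x \<in> G i}" using x by (auto simp: D_def)
    also have "\<dots> \<le> card {i \<in> I. x \<in> (G(j := W)) i}"
      using I by (intro card_mono) auto
    finally show ?thesis .
  qed
  with W show ?thesis by blast
qed

text \<open>
  The number of members that contain a point survives when the members are shrunk one
  after the other.  For \<open>q = 1\<close> this is the usual shrinking lemma for covers.
\<close>

lemma shrink_keeping_multiplicity: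
  assumes X: "normal_space X" and I: "finite I" and G: "\<And>i. i \<in> I \<Longrightarrow> openin X (G i)"
    and q: "\<And>x. x \<in> topspace X \<Longrightarrow> q \<le> card {i \<in> I. x \<in> G i}"
  obtains W where "\<And>i. i \<in> I \<Longrightarrow> openin X (W i)" "\<And>i. i \<in> I \<Longrightarrow> X closure_of (W i) \<subseteq> G i"
    "\<And>x. x \<in> topspace X \<Longrightarrow> q \<le> card {i \<in> I. x \<in> W i}"
proof -
  have "\<exists>W. (\<forall>i\<in>J. openin X (W i) \<and> X closure_of (W i) \<subseteq> G i) \<and> (\<forall>i. i \<notin> J \<longrightarrow> W i = G i) \<and>
            (\<forall>x\<in>topspace X. q \<le> card {i \<in> I. x \<in> W i})" if "finite J" "J \<subseteq> I" for J
    using that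
  proof (induction J)
    case empty
    then show ?case using q by auto
  next
    case (insert j J)
    then obtain W where W: "\<forall>i\<in>J. openin X (W i) \<and> X closure_of (W i) \<subseteq> G i"
      "\<forall>i. i \<notin> J \<longrightarrow> W i = G i" "\<forall>x\<in>topspace X. q \<le> card {i \<in> I. x \<in> W i}"
      by auto
    have "\<exists>V. openin X V \<and> X closure_of V \<subseteq> W j \<and>
             (\<forall>x\<in>topspace X. q \<le> card {i \<in> I. x \<in> (W(j := V)) i})"
    proof (rule shrink_one[OF X I])
      show "j \<in> I" using insert.prems by auto
      show "openin X (W i)" if "i \<in> I" for i
        using W G that by (cases "i \<in> J") auto
      show "q \<le> card {i \<in> I. x \<in> W i}" if "x \<in> topspace X" for x
        using W that by auto
    qed
    then obtain V where V: "openin X V" "X closure_of V \<subseteq> W j"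
       "\<forall>x\<in>topspace X. q \<le> card {i \<in> I. x \<in> (W(j := V)) i}"
      by blast
    have "W j = G j" using W insert.hyps by auto
    then have "\<forall>i\<in>insert j J. openin X ((W(j := V)) i) \<and> X closure_of ((W(j := V)) i) \<subseteq> G i"
      using V W by auto
    moreover have "\<forall>i. i \<notin> insert j J \<longrightarrow> (W(j := V)) i = G i" using W by auto
    ultimately show ?case using V by blast
  qed
  from this[of I] I obtain W where
    "\<forall>i\<in>I. openin X (W i) \<and> X closure_of (W i) \<subseteq> G i"
    "\<forall>x\<in>topspace X. q \<le> card {i \<in> I. x \<in> W i}" by auto
  then show thesis using that[of W] by blast
qed

text \<open>
  The index \<open>i < k\<close> is a colour.  Since sets of one colour are disjoint, a point lies in
  as many sets as it sees colours.  In dimension \<open>n\<close> one can reach \<open>q = k - n\<close> for every \<open>k > n\<close>.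
\<close>

definition coloured_cover ::
  "'a topology \<Rightarrow> 'a set set \<Rightarrow> nat \<Rightarrow> nat \<Rightarrow> (nat \<Rightarrow> 'a set set) \<Rightarrow> bool" where
  "coloured_cover X \<R> k q F \<longleftrightarrow>
     (\<forall>i<k. pairwise disjnt (F i) \<and> (\<forall>U\<in>F i. openin X U \<and> (\<exists>R\<in>\<R>. U \<subseteq> R))) \<and>
     (\<forall>x\<in>topspace X. q \<le> card {i \<in> {..<k}. x \<in> \<Union>(F i)})"

lemma openin_finite_Ball:
  assumes "finite S" "\<And>i. i \<in> S \<Longrightarrow> openin X {x \<in> topspace X. P i x}"
  shows "openin X {x \<in> topspace X. \<forall>i\<in>S. P i x}"
  using assms
proof (induction S)
  case (insert i S)
  have "{x \<in> topspace X. \<forall>i\<in>insert i S. P i x} =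
        {x \<in> topspace X. P i x} \<inter> {x \<in> topspace X. \<forall>i\<in>S. P i x}" by auto
  with insert show ?case by (metis (no_types, lifting) insertCI openin_Int)
qed auto

lemma openin_less_of_continuous:
  fixes f g :: "'a \<Rightarrow> real"
  assumes "continuous_map X euclideanreal f" "continuous_map X euclideanreal g"
  shows "openin X {x \<in> topspace X. f x < g x}"
proof -
  have "continuous_map X euclideanreal (\<lambda>x. g x - f x)"
    by (intro continuous_map_diff assms)
  then have "openin X {x \<in> topspace X. g x - f x \<in> {0<..}}"
    by (rule openin_continuous_map_preimage) simp
  then show ?thesis by simp
qed

text \<open>
  Take bump functions subordinate to the cover, and for a set \<open>S\<close> of members the points at
  which the bumps of \<open>S\<close> are larger than all others.  Two different sets \<open>S\<close> of the same
  size give disjoint regions, because each would contain a bump that beats one of the other;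
  so the size of \<open>S\<close> can serve as the colour.  A point lies in the region of the set of all
  bumps that are positive there, and this set has at most \<open>Suc n\<close> elements.
\<close>

lemma coloured_cover_of_order:
  assumes X: "normal_space X" and fin: "finite \<V>" and op: "\<And>V. V \<in> \<V> \<Longrightarrow> openin X V"
    and cov: "topspace X \<subseteq> \<Union>\<V>"
    and ord: "\<And>x. x \<in> topspace X \<Longrightarrow> card {V \<in> \<V>. x \<in> V} \<le> Suc n"
  shows "\<exists>F. coloured_cover X \<V> (Suc n) 1 F"
proof -
  have "1 \<le> card {V \<in> \<V>. x \<in> V}" if "x \<in> topspace X" for x
    using that cov fin by (auto simp: Suc_le_eq card_gt_0_iff)
  then obtain W where W: "\<And>V. V \<in> \<V> \<Longrightarrow> openin X (W V)" "\<And>V. V \<in> \<V> \<Longrightarrow> X closure_of (W V) \<subseteq> V"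
    "\<And>x. x \<in> topspace X \<Longrightarrow> 1 \<le> card {V \<in> \<V>. x \<in> W V}"
    using shrink_keeping_multiplicity[OF X fin, of "\<lambda>V. V" 1] op by blast
  have "\<exists>f. continuous_map X (top_of_set {0..1::real}) f \<and> f ` (topspace X - V) \<subseteq> {0} \<and>
            f ` (X closure_of (W V)) \<subseteq> {1}" if V: "V \<in> \<V>" for V
  proof -
    have "closedin X (topspace X - V)" "disjnt (topspace X - V) (X closure_of (W V))"
      using op[OF V] W(2)[OF V] by (auto simp: disjnt_def)
    then show ?thesis
      using Urysohn_lemma[OF X, of "topspace X - V" "X closure_of W V" 0 1]
      by (metis closedin_closure_of zero_le_one)
  qed
  then have "\<forall>V\<in>\<V>. \<exists>f. continuous_map X (top_of_set {0..1::real}) f \<and> f ` (topspace X - V) \<subseteq> {0} \<and>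
            f ` (X closure_of (W V)) \<subseteq> {1}" by blast
  from bchoice[OF this] obtain \<phi> where \<phi>0: "\<forall>V\<in>\<V>. continuous_map X (top_of_set {0..1::real}) (\<phi> V) \<and>
      \<phi> V ` (topspace X - V) \<subseteq> {0} \<and> \<phi> V ` (X closure_of (W V)) \<subseteq> {1}" ..
  then have \<phi>: "\<And>V. V \<in> \<V> \<Longrightarrow> continuous_map X (top_of_set {0..1::real}) (\<phi> V)"
    "\<And>V. V \<in> \<V> \<Longrightarrow> \<phi> V ` (topspace X - V) \<subseteq> {0}" "\<And>V. V \<in> \<V> \<Longrightarrow> \<phi> V ` (X closure_of (W V)) \<subseteq> {1}"
    by simp_all
  have cont: "continuous_map X euclideanreal (\<phi> V)" if "V \<in> \<V>" for V
    using \<phi>(1)[OF that] by (simp add: continuous_map_in_subtopology)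
  define P where "P S = {x \<in> topspace X. (\<forall>V\<in>S. 0 < \<phi> V x) \<and>
                           (\<forall>V\<in>S. \<forall>V'\<in>\<V> - S. \<phi> V' x < \<phi> V x)}" for S
  \<comment> \<open>Colours start at \<open>0\<close>, sizes of nonempty sets at \<open>1\<close>.\<close>
  define F where "F c = P ` {S. S \<subseteq> \<V> \<and> card S = Suc c}" for c
  have opP: "openin X (P S)" if S: "S \<subseteq> \<V>" for S
  proof -
    have *: "openin X {x \<in> topspace X. \<phi> V' x < \<phi> V x}" if "V \<in> \<V>" "V' \<in> \<V>" for V V'
      using that by (intro openin_less_of_continuous cont) auto
    have **: "openin X {x \<in> topspace X. 0 < \<phi> V x}" if "V \<in> \<V>" for V
      using that by (intro openin_less_of_continuous cont) auto
    have 1: "openin X {x \<in> topspace X. \<forall>V\<in>S. 0 < \<phi> V x}"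
      using S fin ** by (intro openin_finite_Ball) (auto intro: finite_subset)
    have 2: "openin X {x \<in> topspace X. \<forall>V\<in>S. \<forall>V'\<in>\<V> - S. \<phi> V' x < \<phi> V x}"
      using S fin * by (intro openin_finite_Ball) (auto intro: finite_subset)
    have "P S = {x \<in> topspace X. \<forall>V\<in>S. 0 < \<phi> V x} \<inter>
                {x \<in> topspace X. \<forall>V\<in>S. \<forall>V'\<in>\<V> - S. \<phi> V' x < \<phi> V x}"
      by (auto simp: P_def)
    with 1 2 show ?thesis by auto
  qed
  have "pairwise disjnt (F c)" for c
    unfolding pairwise_def
  proof (intro ballI impI)
    fix A B assume AB: "A \<in> F c" "B \<in> F c" "A \<noteq> B"
    then obtain S T where ST: "S \<subseteq> \<V>" "T \<subseteq> \<V>" "card S = Suc c" "card T = Suc c" "A = P S" "B = P T"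
      by (auto simp: F_def)
    with AB have "S \<noteq> T" by auto
    moreover have "finite S" "finite T" using ST fin by (auto intro: finite_subset)
    ultimately have "\<not> S \<subseteq> T" "\<not> T \<subseteq> S" using ST card_subset_eq by metis+
    then obtain V V' where "V \<in> S - T" "V' \<in> T - S" by auto
    then show "disjnt A B"
      using ST unfolding P_def disjnt_def by (auto, meson DiffI less_asym subsetD)
  qed
  moreover have "openin X U \<and> (\<exists>R\<in>\<V>. U \<subseteq> R)" if "U \<in> F c" for U c
  proof -
    from that obtain S where S: "S \<subseteq> \<V>" "card S = Suc c" "U = P S" by (auto simp: F_def)
    then obtain V where V: "V \<in> S" by fastforce
    have "P S \<subseteq> V"
    proof
      fix x assume "x \<in> P S"
      then have "x \<in> topspace X" "\<phi> V x > 0" using V by (auto simp: P_def)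
      moreover have "V \<in> \<V>" using V S by auto
      ultimately show "x \<in> V" using \<phi>(2)[of V] by force
    qed
    with S V opP show ?thesis by blast
  qed
  moreover have "1 \<le> card {i \<in> {..<Suc n}. x \<in> \<Union>(F i)}" if x: "x \<in> topspace X" for x
  proof -
    define S where "S = {V \<in> \<V>. \<phi> V x > 0}"
    have "{V \<in> \<V>. x \<in> W V} \<noteq> {}"
      using W(3)[OF x] by (metis card.empty not_one_le_zero)
    then obtain V where V: "V \<in> \<V>" "x \<in> W V"
      by blast
    then have "x \<in> X closure_of (W V)"
      using closure_of_subset[OF openin_subset[OF W(1)[OF V(1)]]] by blast
    then have "\<phi> V x = 1"
      using \<phi>(3)[OF V(1)] by auto
    with V have "V \<in> S" by (auto simp: S_def)
    have fS: "finite S" using fin by (auto simp: S_def)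
    have "S \<subseteq> {V \<in> \<V>. x \<in> V}"
      using \<phi>(2) x by (force simp: S_def)
    then have "card S \<le> Suc n"
      using ord[OF x] card_mono[of "{V \<in> \<V>. x \<in> V}" S] fin by auto
    moreover have "card S \<noteq> 0" using \<open>V \<in> S\<close> fS by auto
    ultimately obtain c where c: "card S = Suc c" "c < Suc n"
      by (cases "card S") auto
    have nn: "0 \<le> \<phi> V x" if "V \<in> \<V>" for V
      using \<phi>(1)[OF that] x by (auto simp: continuous_map_in_subtopology Pi_iff)
    have "x \<in> P S"
      using x nn by (fastforce simp: P_def S_def)
    moreover have "S \<subseteq> \<V>" by (auto simp: S_def)
    ultimately have "x \<in> \<Union>(F c)" using c by (auto simp: F_def)
    then have "c \<in> {i \<in> {..<Suc n}. x \<in> \<Union>(F i)}" using c by auto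
    then have "card {c} \<le> card {i \<in> {..<Suc n}. x \<in> \<Union>(F i)}"
      by (intro card_mono) auto
    then show ?thesis by simp
  qed
  ultimately have "coloured_cover X \<V> (Suc n) 1 F"
    unfolding coloured_cover_def by simp
  then show ?thesis by (rule exI[of _ F])
qed

text \<open>
  This is Ostrand's trick.  Shrink the unions of the colours to closed sets \<open>A i\<close>.  Near a
  point that lies in exactly \<open>q\<close> of them no further \<open>A i\<close> is met, so the \<open>q\<close> colours are
  locally determined; a new colour that repeats there the sets of the first of the \<open>q\<close>
  colours raises the count to \<open>Suc q\<close>.  All other points see \<open>Suc q\<close> colours already.
\<close>

lemma coloured_cover_extend:
  assumes X: "normal_space X" and F: "coloured_cover X \<R> k q F" and q: "0 < q"
  shows "\<exists>F'. coloured_cover X \<R> (Suc k) (Suc q) F'"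
proof -
  define G where "G i = \<Union>(F i)" for i
  have "\<And>i. i \<in> {..<k} \<Longrightarrow> openin X (G i)"
    using F by (auto simp: coloured_cover_def G_def)
  moreover have "\<And>x. x \<in> topspace X \<Longrightarrow> q \<le> card {i \<in> {..<k}. x \<in> G i}"
    using F by (auto simp: coloured_cover_def G_def)
  ultimately obtain W where W: "\<And>i. i \<in> {..<k} \<Longrightarrow> openin X (W i)"
    "\<And>i. i \<in> {..<k} \<Longrightarrow> X closure_of (W i) \<subseteq> G i"
    "\<And>x. x \<in> topspace X \<Longrightarrow> q \<le> card {i \<in> {..<k}. x \<in> W i}"
    using shrink_keeping_multiplicity[OF X, of "{..<k}" G q] by blast
  define A where "A i = X closure_of (W i)" for i
  have AG: "A i \<subseteq> G i" if "i < k" for i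
    using W(2)[of i] that by (auto simp: A_def)
  have A: "q \<le> card {i \<in> {..<k}. x \<in> A i}" if "x \<in> topspace X" for x
  proof -
    have "W i \<subseteq> A i" if "i < k" for i
      using closure_of_subset[of "W i" X] W(1)[of i] that openin_subset by (auto simp: A_def)
    then have "card {i \<in> {..<k}. x \<in> W i} \<le> card {i \<in> {..<k}. x \<in> A i}"
      by (intro card_mono) auto
    with W(3)[OF that] show ?thesis by linarith
  qed
  define B where "B S = topspace X - (\<Union>j\<in>{..<k} - S. A j)" for S
  define E where "E = {B S \<inter> U | S U. S \<subseteq> {..<k} \<and> card S = q \<and> U \<in> F (Min S)}"
  have opB: "openin X (B S)" for S
    unfolding B_def A_def by (intro openin_diff closedin_Union) auto
  have MinS: "Min S \<in> S \<and> Min S < k" if "S \<subseteq> {..<k}" "card S = q" for S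
  proof -
    have "finite S" "S \<noteq> {}" using that q by (auto intro: finite_subset)
    then have "Min S \<in> S" by simp
    with that show ?thesis by auto
  qed
  have "pairwise disjnt E"
    unfolding pairwise_def
  proof (intro ballI impI)
    fix C D assume CD: "C \<in> E" "D \<in> E" "C \<noteq> D"
    then obtain S T U V where ST: "S \<subseteq> {..<k}" "T \<subseteq> {..<k}" "card S = q" "card T = q"
      "U \<in> F (Min S)" "V \<in> F (Min T)" "C = B S \<inter> U" "D = B T \<inter> V"
      unfolding E_def by blast
    show "disjnt C D"
    proof (cases "S = T")
      case True
      with CD ST have "U \<noteq> V" by auto
      moreover have "pairwise disjnt (F (Min S))"
        using F MinS ST by (auto simp: coloured_cover_def)
      ultimately have "disjnt U V" using ST True by (auto simp: pairwise_def)
      then show ?thesis using ST by (auto simp: disjnt_def)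
    next
      case False
      have "B S \<inter> B T = {}"
      proof (rule ccontr)
        assume "B S \<inter> B T \<noteq> {}"
        then obtain x where x: "x \<in> B S" "x \<in> B T" by auto
        then have "{i \<in> {..<k}. x \<in> A i} \<subseteq> S \<inter> T" "x \<in> topspace X"
          by (auto simp: B_def)
        moreover have "finite S" "finite T" using ST by (auto intro: finite_subset)
        ultimately have "q \<le> card (S \<inter> T)"
          using A[of x] by (meson card_mono finite_Int order_trans)
        then have "S \<inter> T = S" "S \<inter> T = T"
          using ST \<open>finite S\<close> \<open>finite T\<close> by (metis Int_lower1 Int_lower2 card_seteq)+
        with False show False by simp
      qed
      with ST show ?thesis by (auto simp: disjnt_def)
    qed
  qed
  moreover have "openin X C \<and> (\<exists>R\<in>\<R>. C \<subseteq> R)" if "C \<in> E" for C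
  proof -
    from that obtain S U where S: "S \<subseteq> {..<k}" "card S = q" "U \<in> F (Min S)" "C = B S \<inter> U"
      unfolding E_def by blast
    then have "openin X U" "\<exists>R\<in>\<R>. U \<subseteq> R"
      using F MinS[of S] by (auto simp: coloured_cover_def)
    with S opB show ?thesis by blast
  qed
  moreover have "Suc q \<le> card {i \<in> {..<Suc k}. x \<in> \<Union>((F(k := E)) i)}" if x: "x \<in> topspace X" for x
  proof -
    define I where "I = {i \<in> {..<k}. x \<in> A i}"
    have I: "q \<le> card I" "finite I" "I \<subseteq> {..<k}" using A[OF x] by (auto simp: I_def)
    have sub: "I \<subseteq> {i \<in> {..<Suc k}. x \<in> \<Union>((F(k := E)) i)}"
      using AG by (auto simp: I_def G_def)
    show ?thesis
    proof (cases "card I = q")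
      case True
      have "x \<in> B I" using x by (auto simp: B_def I_def)
      moreover have "Min I \<in> I" using MinS[OF I(3) True] by auto
      then have "x \<in> G (Min I)" using AG by (auto simp: I_def)
      then obtain U where "U \<in> F (Min I)" "x \<in> U" by (auto simp: G_def)
      ultimately have "x \<in> \<Union>E" using True I unfolding E_def by blast
      then have "insert k I \<subseteq> {i \<in> {..<Suc k}. x \<in> \<Union>((F(k := E)) i)}" using sub by auto
      then have "card (insert k I) \<le> card {i \<in> {..<Suc k}. x \<in> \<Union>((F(k := E)) i)}"
        by (intro card_mono) auto
      moreover have "k \<notin> I" by (auto simp: I_def)
      ultimately show ?thesis using True I by simp
    next
      case False
      with I have "Suc q \<le> card I" by simp
      also have "\<dots> \<le> card {i \<in> {..<Suc k}. x \<in> \<Union>((F(k := E)) i)}"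
        using sub by (intro card_mono) auto
      finally show ?thesis .
    qed
  qed
  ultimately have "coloured_cover X \<R> (Suc k) (Suc q) (F(k := E))"
    using F unfolding coloured_cover_def by (auto simp: less_Suc_eq)
  then show ?thesis by blast
qed

lemma coloured_cover_extend_many:
  assumes X: "normal_space X" and F: "coloured_cover X \<R> (Suc n) 1 F"
  shows "\<exists>F'. coloured_cover X \<R> (Suc n + p) (Suc p) F'"
proof (induction p)
  case 0
  then show ?case using F by auto
next
  case (Suc p)
  then show ?case using coloured_cover_extend[OF X, of \<R> "Suc n + p" "Suc p"] by auto
qed

lemma covering_dim_le_imp_coloured_cover:
  assumes X: "compact_space X" "normal_space X" and n: "covering_dim_le X (int n)"
    and \<U>: "\<And>U. U \<in> \<U> \<Longrightarrow> openin X U" "\<Union>\<U> = topspace X"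
  shows "\<exists>F. coloured_cover X \<U> (Suc n + p) (Suc p) F"
proof -
  have "(\<forall>U\<in>\<U>. openin X U) \<and> \<Union>\<U> = topspace X" using \<U> by blast
  from n[unfolded covering_dim_le_def, THEN spec, THEN mp, OF this]
  obtain \<V> where \<V>0: "(\<forall>V\<in>\<V>. openin X V) \<and> \<Union>\<V> = topspace X \<and> (\<forall>V\<in>\<V>. \<exists>U\<in>\<U>. V \<subseteq> U) \<and>
    (\<forall>x\<in>topspace X. finite {V \<in> \<V>. x \<in> V} \<and> int (card {V \<in> \<V>. x \<in> V}) \<le> int n + 1)" ..
  note \<V> = \<V>0[THEN conjunct1] \<V>0[THEN conjunct2, THEN conjunct1]
    \<V>0[THEN conjunct2, THEN conjunct2, THEN conjunct1] \<V>0[THEN conjunct2, THEN conjunct2, THEN conjunct2]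
  obtain \<W> where \<W>: "finite \<W>" "\<W> \<subseteq> \<V>" "topspace X \<subseteq> \<Union>\<W>"
    using X(1)[unfolded compact_space_alt, rule_format, of \<V>] \<V>(1,2) by auto
  have "\<exists>F. coloured_cover X \<W> (Suc n) 1 F"
  proof (rule coloured_cover_of_order[OF X(2) \<W>(1) _ \<W>(3)])
    fix x assume x: "x \<in> topspace X"
    have "card {V \<in> \<W>. x \<in> V} \<le> card {V \<in> \<V>. x \<in> V}"
      using \<W> \<V>(4) x by (intro card_mono) auto
    then show "card {V \<in> \<W>. x \<in> V} \<le> Suc n"
      using \<V>(4) x by force
  qed (use \<V> \<W> in auto)
  then obtain F where "coloured_cover X \<W> (Suc n) 1 F" ..
  then have "coloured_cover X \<U> (Suc n) 1 F"
    using \<W>(2) \<V>(3) unfolding coloured_cover_def by (meson order_trans subsetD)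
  then show ?thesis by (rule coloured_cover_extend_many[OF X(2)])
qed

section \<open>Covering dimension of products\<close>

lemma openin_finite_Int_Collect:
  assumes "finite S" "\<And>i. i \<in> S \<Longrightarrow> openin X (G i)"
  shows "openin X {x \<in> topspace X. \<forall>i\<in>S. x \<in> G i}"
proof (rule openin_finite_Ball[OF assms(1)])
  fix i assume "i \<in> S"
  then have "{x \<in> topspace X. x \<in> G i} = G i" using assms(2) openin_subset by blast
  then show "openin X {x \<in> topspace X. x \<in> G i}" using assms(2) \<open>i \<in> S\<close> by simp
qed

text \<open>
  For fixed \<open>y\<close>, finitely many boxes cover the slice at height \<open>y\<close> and share a tube around
  it; finitely many tubes suffice, and intersecting the bases over these tubes gives sets
  that are small enough for all of them.
\<close>

lemma box_refinement:
  assumes X: "compact_space X" and Y: "compact_space Y"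
    and \<U>: "\<And>U. U \<in> \<U> \<Longrightarrow> openin (prod_topology X Y) U" "\<Union>\<U> = topspace X \<times> topspace Y"
  obtains \<A> \<B> where "\<And>A. A \<in> \<A> \<Longrightarrow> openin X A" "\<Union>\<A> = topspace X"
    "\<And>B. B \<in> \<B> \<Longrightarrow> openin Y B" "\<Union>\<B> = topspace Y"
    "\<And>A B. A \<in> \<A> \<Longrightarrow> B \<in> \<B> \<Longrightarrow> \<exists>U\<in>\<U>. A \<times> B \<subseteq> U"
proof -
  have slice: "\<exists>\<F> P. (\<forall>A\<in>\<F>. openin X A) \<and> topspace X \<subseteq> \<Union>\<F> \<and> openin Y P \<and> y \<in> P \<and>
      (\<forall>A\<in>\<F>. \<exists>U\<in>\<U>. A \<times> P \<subseteq> U)" if y: "y \<in> topspace Y" for y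
  proof -
    have "\<exists>A P. openin X A \<and> openin Y P \<and> x \<in> A \<and> y \<in> P \<and> (\<exists>U\<in>\<U>. A \<times> P \<subseteq> U)"
      if "x \<in> topspace X" for x
    proof -
      have "(x, y) \<in> \<Union>\<U>" using that y \<U>(2) by simp
      then obtain U where U: "U \<in> \<U>" "(x, y) \<in> U" by blast
      then show ?thesis
        using \<U>(1)[OF U(1), unfolded openin_prod_topology_alt, rule_format, OF U(2)] by blast
    qed
    then have "\<forall>x\<in>topspace X. \<exists>AP. openin X (fst AP) \<and> openin Y (snd AP) \<and> x \<in> fst AP \<and> y \<in> snd AP \<and>
        (\<exists>U\<in>\<U>. fst AP \<times> snd AP \<subseteq> U)" by simp
    from bchoice[OF this] obtain f where f: "\<forall>x\<in>topspace X. openin X (fst (f x)) \<and> openin Y (snd (f x)) \<and>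
        x \<in> fst (f x) \<and> y \<in> snd (f x) \<and> (\<exists>U\<in>\<U>. fst (f x) \<times> snd (f x) \<subseteq> U)" ..
    have "\<forall>C\<in>(\<lambda>x. fst (f x)) ` topspace X. openin X C" "topspace X \<subseteq> \<Union>((\<lambda>x. fst (f x)) ` topspace X)"
      using f by auto
    then obtain \<F> where \<F>: "finite \<F>" "\<F> \<subseteq> (\<lambda>x. fst (f x)) ` topspace X" "topspace X \<subseteq> \<Union>\<F>"
      using X[unfolded compact_space_alt, rule_format, of "(\<lambda>x. fst (f x)) ` topspace X"] by auto
    then obtain T where T: "T \<subseteq> topspace X" "finite T" "\<F> = (\<lambda>x. fst (f x)) ` T"
      using finite_subset_image by metis
    define P where "P = topspace Y \<inter> (\<Inter>x\<in>T. snd (f x))"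
    have "P = {z \<in> topspace Y. \<forall>x\<in>T. z \<in> snd (f x)}" by (auto simp: P_def)
    moreover have "openin Y {z \<in> topspace Y. \<forall>x\<in>T. z \<in> snd (f x)}"
      by (rule openin_finite_Int_Collect[OF T(2)]) (use f T in auto)
    ultimately have "openin Y P" by simp
    moreover have "y \<in> P" using y f T by (auto simp: P_def)
    moreover have "\<forall>A\<in>\<F>. \<exists>U\<in>\<U>. A \<times> P \<subseteq> U"
    proof
      fix A assume "A \<in> \<F>"
      then obtain x where x: "x \<in> T" "A = fst (f x)" using T by auto
      then obtain U where "U \<in> \<U>" "fst (f x) \<times> snd (f x) \<subseteq> U" using f T by blast
      then show "\<exists>U\<in>\<U>. A \<times> P \<subseteq> U" using x by (intro bexI[of _ U]) (auto simp: P_def)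
    qed
    moreover have "\<forall>A\<in>\<F>. openin X A" using \<F> f by auto
    ultimately show ?thesis using \<F> by blast
  qed
  then have "\<forall>y\<in>topspace Y. \<exists>FP. (\<forall>A\<in>fst FP. openin X A) \<and> topspace X \<subseteq> \<Union>(fst FP) \<and>
      openin Y (snd FP) \<and> y \<in> snd FP \<and> (\<forall>A\<in>fst FP. \<exists>U\<in>\<U>. A \<times> snd FP \<subseteq> U)" by simp
  from bchoice[OF this] obtain g where g: "\<forall>y\<in>topspace Y. (\<forall>A\<in>fst (g y). openin X A) \<and>
      topspace X \<subseteq> \<Union>(fst (g y)) \<and> openin Y (snd (g y)) \<and> y \<in> snd (g y) \<and>
      (\<forall>A\<in>fst (g y). \<exists>U\<in>\<U>. A \<times> snd (g y) \<subseteq> U)" ..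
  have "\<forall>C\<in>(\<lambda>y. snd (g y)) ` topspace Y. openin Y C" "topspace Y \<subseteq> \<Union>((\<lambda>y. snd (g y)) ` topspace Y)"
    using g by auto
  then obtain \<B> where \<B>: "finite \<B>" "\<B> \<subseteq> (\<lambda>y. snd (g y)) ` topspace Y" "topspace Y \<subseteq> \<Union>\<B>"
    using Y[unfolded compact_space_alt, rule_format, of "(\<lambda>y. snd (g y)) ` topspace Y"] by auto
  then obtain T where T: "T \<subseteq> topspace Y" "finite T" "\<B> = (\<lambda>y. snd (g y)) ` T"
    using finite_subset_image by metis
  have "\<forall>xy\<in>topspace X \<times> T. \<exists>A. A \<in> fst (g (snd xy)) \<and> fst xy \<in> A"
    using g T by (auto simp: subset_iff) blast
  from bchoice[OF this] obtain a0 where "\<forall>xy\<in>topspace X \<times> T. a0 xy \<in> fst (g (snd xy)) \<and> fst xy \<in> a0 xy" ..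
  then have a: "\<And>x y. x \<in> topspace X \<Longrightarrow> y \<in> T \<Longrightarrow> a0 (x, y) \<in> fst (g y) \<and> x \<in> a0 (x, y)"
    by auto
  define R where "R x = {z \<in> topspace X. \<forall>y\<in>T. z \<in> a0 (x, y)}" for x
  have R: "openin X (R x)" if "x \<in> topspace X" for x
    unfolding R_def
  proof (rule openin_finite_Int_Collect[OF T(2)])
    fix y assume "y \<in> T"
    then show "openin X (a0 (x, y))" using a[OF that] g T by blast
  qed
  show thesis
  proof (rule that[of "R ` topspace X" \<B>])
    show "openin X A" if "A \<in> R ` topspace X" for A using R that by auto
    show "\<Union>(R ` topspace X) = topspace X"
      using a by (auto simp: R_def)
    show "openin Y B" if "B \<in> \<B>" for B using g T that by auto
    then show "\<Union>\<B> = topspace Y" using \<B> openin_subset by blast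
    show "\<exists>U\<in>\<U>. A \<times> B \<subseteq> U" if AB: "A \<in> R ` topspace X" "B \<in> \<B>" for A B
    proof -
      obtain x where x: "x \<in> topspace X" "A = R x" using AB by auto
      obtain y where y: "y \<in> T" "B = snd (g y)" using AB T by auto
      then obtain U where "U \<in> \<U>" "a0 (x, y) \<times> snd (g y) \<subseteq> U" using a[OF x(1) y(1)] g T by blast
      then show ?thesis using x y by (intro bexI[of _ U]) (auto simp: R_def)
    qed
  qed
qed

text \<open>
  Use \<open>m + n + 1\<close> colours on both factors.  The first coordinate of a point sees at least
  \<open>n + 1\<close> of them and the second at least \<open>m + 1\<close>, so they have a colour in common.  Hence
  the products of sets of equal colour cover the product space, and at a given point each
  colour contributes at most one of them.
\<close>

lemma covering_dim_le_prod_topology: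
  assumes X: "compact_space X" "normal_space X" "covering_dim_le X (int m)"
    and Y: "compact_space Y" "normal_space Y" "covering_dim_le Y (int n)"
  shows "covering_dim_le (prod_topology X Y) (int (m + n))"
  unfolding covering_dim_le_def
proof (intro allI impI)
  fix \<U> assume U0: "(\<forall>U\<in>\<U>. openin (prod_topology X Y) U) \<and> \<Union>\<U> = topspace (prod_topology X Y)"
  obtain \<A> \<B> where AB: "\<And>A. A \<in> \<A> \<Longrightarrow> openin X A" "\<Union>\<A> = topspace X"
    "\<And>B. B \<in> \<B> \<Longrightarrow> openin Y B" "\<Union>\<B> = topspace Y"
    "\<And>A B. A \<in> \<A> \<Longrightarrow> B \<in> \<B> \<Longrightarrow> \<exists>U\<in>\<U>. A \<times> B \<subseteq> U"
    using box_refinement[OF X(1) Y(1), of \<U>] U0 by auto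
  define k where "k = Suc (m + n)"
  obtain F where F: "coloured_cover X \<A> k (Suc n) F"
    using covering_dim_le_imp_coloured_cover[OF X AB(1,2), of n] by (auto simp: k_def)
  obtain G where G: "coloured_cover Y \<B> k (Suc m) G"
    using covering_dim_le_imp_coloured_cover[OF Y AB(3,4), of m] by (auto simp: k_def add.commute)
  define H where "H i = {U \<times> V | U V. U \<in> F i \<and> V \<in> G i}" for i
  define \<V> where "\<V> = (\<Union>i<k. H i)"
  have disj: "C = D" if "i < k" "C \<in> H i" "D \<in> H i" "p \<in> C" "p \<in> D" for i C D p
  proof -
    obtain U V U' V' where *: "C = U \<times> V" "D = U' \<times> V'" "U \<in> F i" "U' \<in> F i" "V \<in> G i" "V' \<in> G i"
      using \<open>C \<in> H i\<close> \<open>D \<in> H i\<close> unfolding H_def by blast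
    have "pairwise disjnt (F i)" "pairwise disjnt (G i)"
      using F G \<open>i < k\<close> by (auto simp: coloured_cover_def)
    moreover have "\<not> disjnt U U'" "\<not> disjnt V V'"
      using * \<open>p \<in> C\<close> \<open>p \<in> D\<close> by (auto simp: disjnt_def)
    ultimately show ?thesis using * by (metis pairwiseD)
  qed
  show "\<exists>\<V>. (\<forall>V\<in>\<V>. openin (prod_topology X Y) V) \<and> \<Union>\<V> = topspace (prod_topology X Y) \<and>
      (\<forall>V\<in>\<V>. \<exists>U\<in>\<U>. V \<subseteq> U) \<and>
      (\<forall>x\<in>topspace (prod_topology X Y). finite {V \<in> \<V>. x \<in> V} \<and>
         int (card {V \<in> \<V>. x \<in> V}) \<le> int (m + n) + 1)"
  proof (intro exI[of _ \<V>] conjI ballI)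
    fix V assume "V \<in> \<V>"
    then obtain i A B where i: "i < k" "A \<in> F i" "B \<in> G i" "V = A \<times> B"
      by (auto simp: \<V>_def H_def)
    then have "openin X A" "openin Y B" "\<exists>R\<in>\<A>. A \<subseteq> R" "\<exists>R\<in>\<B>. B \<subseteq> R"
      using F G by (auto simp: coloured_cover_def)
    then show "openin (prod_topology X Y) V" "\<exists>U\<in>\<U>. V \<subseteq> U"
      using i AB(5) by (auto simp: openin_prod_Times_iff) (meson Sigma_mono order_trans)
  next
    have "p \<in> \<Union>\<V>" if p: "p \<in> topspace (prod_topology X Y)" for p
    proof -
      obtain x y where xy: "p = (x, y)" "x \<in> topspace X" "y \<in> topspace Y" using p by auto
      define I where "I = {i \<in> {..<k}. x \<in> \<Union>(F i)}"
      define J where "J = {i \<in> {..<k}. y \<in> \<Union>(G i)}"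
      have "Suc n \<le> card I" "Suc m \<le> card J"
        using F G xy by (auto simp: coloured_cover_def I_def J_def)
      moreover have "card (I \<union> J) \<le> k"
        using card_mono[of "{..<k}" "I \<union> J"] by (auto simp: I_def J_def)
      moreover have "card I + card J = card (I \<union> J) + card (I \<inter> J)"
        by (rule card_Un_Int) (auto simp: I_def J_def)
      ultimately have "I \<inter> J \<noteq> {}" by (auto simp: k_def)
      then obtain i where "i \<in> I" "i \<in> J" by blast
      then obtain A B where "i < k" "A \<in> F i" "x \<in> A" "B \<in> G i" "y \<in> B"
        by (auto simp: I_def J_def)
      then show ?thesis using xy by (auto simp: \<V>_def H_def)
    qed
    moreover have "C \<subseteq> topspace (prod_topology X Y)" if C: "C \<in> \<V>" for C
    proof -
      obtain i A B where i: "i < k" "A \<in> F i" "B \<in> G i" "C = A \<times> B"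
        using C unfolding \<V>_def H_def by blast
      then have "openin X A" "openin Y B"
        using F G by (auto simp: coloured_cover_def)
      then have "A \<subseteq> topspace X" "B \<subseteq> topspace Y" by (auto dest: openin_subset)
      then show ?thesis using i by auto
    qed
    ultimately show "\<Union>\<V> = topspace (prod_topology X Y)" by blast
  next
    fix p
    have "\<forall>i\<in>{..<k}. \<exists>C. {V \<in> H i. p \<in> V} \<subseteq> {C}"
    proof
      fix i assume "i \<in> {..<k}"
      then have i: "i < k" by simp
      show "\<exists>C. {V \<in> H i. p \<in> V} \<subseteq> {C}"
      proof (cases "{V \<in> H i. p \<in> V} = {}")
        case False
        then obtain C where C: "C \<in> H i" "p \<in> C" by blast
        have "{V \<in> H i. p \<in> V} \<subseteq> {C}"
        proof
          fix V assume "V \<in> {V \<in> H i. p \<in> V}"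
          then show "V \<in> {C}" using disj[OF i _ C(1) _ C(2), of V] by simp
        qed
        then show ?thesis by (rule exI[of _ C])
      next
        case True
        then show ?thesis by (intro exI[of _ "{}"]) (simp only: empty_subsetI)
      qed
    qed
    from bchoice[OF this] obtain c where c: "\<forall>i\<in>{..<k}. {V \<in> H i. p \<in> V} \<subseteq> {c i}" ..
    then have sub: "{V \<in> \<V>. p \<in> V} \<subseteq> c ` {..<k}" by (auto simp: \<V>_def)
    then show "finite {V \<in> \<V>. p \<in> V}" by (rule finite_subset) auto
    have "card {V \<in> \<V>. p \<in> V} \<le> card {..<k}"
      using card_mono[OF _ sub] card_image_le[of "{..<k}" c] by simp
    then show "int (card {V \<in> \<V>. p \<in> V}) \<le> int (m + n) + 1" by (simp add: k_def)
  qed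
qed

lemma covering_dim_le_homeomorphic:
  assumes f: "homeomorphic_map X Y f" and n: "covering_dim_le X n"
  shows "covering_dim_le Y n"
  unfolding covering_dim_le_def
proof (intro allI impI)
  fix \<U> assume \<U>: "(\<forall>U\<in>\<U>. openin Y U) \<and> \<Union>\<U> = topspace Y"
  obtain g where "homeomorphic_maps X Y f g" using f homeomorphic_map_maps by blast
  then have hm: "homeomorphic_maps X Y f g" .
  then have g: "homeomorphic_map Y X g" using homeomorphic_maps_map by blast
  have gf: "\<And>x. x \<in> topspace X \<Longrightarrow> g (f x) = x" and fg: "\<And>y. y \<in> topspace Y \<Longrightarrow> f (g y) = y"
    using hm by (auto simp: homeomorphic_maps_def)
  have fX: "f ` topspace X = topspace Y" and gY: "g ` topspace Y = topspace X"
    using f g homeomorphic_imp_surjective_map by blast+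
  define \<U>' where "\<U>' = (\<lambda>U. g ` U) ` \<U>"
  have "(\<forall>U\<in>\<U>'. openin X U) \<and> \<Union>\<U>' = topspace X"
  proof
    show "\<forall>U\<in>\<U>'. openin X U"
      using \<U> homeomorphic_map_openness[OF g] openin_subset[of Y] by (auto simp: \<U>'_def)
    have "\<Union>\<U>' = g ` \<Union>\<U>" by (auto simp: \<U>'_def)
    then show "\<Union>\<U>' = topspace X" using \<U> gY by simp
  qed
  from n[unfolded covering_dim_le_def, THEN spec, THEN mp, OF this]
  obtain \<V> where \<V>: "(\<forall>V\<in>\<V>. openin X V) \<and> \<Union>\<V> = topspace X \<and> (\<forall>V\<in>\<V>. \<exists>U\<in>\<U>'. V \<subseteq> U) \<and>
    (\<forall>x\<in>topspace X. finite {V \<in> \<V>. x \<in> V} \<and> int (card {V \<in> \<V>. x \<in> V}) \<le> n + 1)" ..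
  note \<V>1 = \<V>[THEN conjunct1] and \<V>2 = \<V>[THEN conjunct2, THEN conjunct1]
    and \<V>3 = \<V>[THEN conjunct2, THEN conjunct2, THEN conjunct1]
    and \<V>4 = \<V>[THEN conjunct2, THEN conjunct2, THEN conjunct2]
  define \<W> where "\<W> = (\<lambda>V. f ` V) ` \<V>"
  have sub: "V \<subseteq> topspace X" if "V \<in> \<V>" for V using \<V>2 that by blast
  show "\<exists>\<W>. (\<forall>V\<in>\<W>. openin Y V) \<and> \<Union>\<W> = topspace Y \<and> (\<forall>V\<in>\<W>. \<exists>U\<in>\<U>. V \<subseteq> U) \<and>
    (\<forall>x\<in>topspace Y. finite {V \<in> \<W>. x \<in> V} \<and> int (card {V \<in> \<W>. x \<in> V}) \<le> n + 1)"
  proof (intro exI[of _ \<W>] conjI ballI)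
    fix W assume "W \<in> \<W>"
    then obtain V where V: "V \<in> \<V>" "W = f ` V" by (auto simp: \<W>_def)
    then show "openin Y W" using \<V>1 homeomorphic_map_openness[OF f sub[OF V(1)]] by simp
    obtain U where U: "U \<in> \<U>" "V \<subseteq> g ` U" using \<V>3 V by (auto simp: \<U>'_def)
    have "f ` V \<subseteq> U"
    proof
      fix y assume "y \<in> f ` V"
      then obtain u where "u \<in> U" "y = f (g u)" using U by auto
      moreover have "u \<in> topspace Y" using \<U> U \<open>u \<in> U\<close> by blast
      ultimately show "y \<in> U" using fg by simp
    qed
    with U V show "\<exists>U\<in>\<U>. W \<subseteq> U" by blast
  next
    have "\<Union>\<W> = f ` \<Union>\<V>" by (auto simp: \<W>_def)
    then show "\<Union>\<W> = topspace Y" using \<V>2 fX by simp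
  next
    fix y assume y: "y \<in> topspace Y"
    then have gy: "g y \<in> topspace X" using gY by auto
    have sub': "{W \<in> \<W>. y \<in> W} \<subseteq> (\<lambda>V. f ` V) ` {V \<in> \<V>. g y \<in> V}"
    proof
      fix W assume "W \<in> {W \<in> \<W>. y \<in> W}"
      then obtain V where V: "V \<in> \<V>" "W = f ` V" "y \<in> f ` V" by (auto simp: \<W>_def)
      then obtain v where "v \<in> V" "y = f v" by auto
      then have "g y \<in> V" using gf sub[OF V(1)] by auto
      with V show "W \<in> (\<lambda>V. f ` V) ` {V \<in> \<V>. g y \<in> V}" by auto
    qed
    have fin: "finite {V \<in> \<V>. g y \<in> V}" "int (card {V \<in> \<V>. g y \<in> V}) \<le> n + 1" using \<V>4 gy by auto
    show "finite {W \<in> \<W>. y \<in> W}" by (rule finite_subset[OF sub' finite_imageI[OF fin(1)]])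
    have "card {W \<in> \<W>. y \<in> W} \<le> card {V \<in> \<V>. g y \<in> V}"
      using card_mono[OF _ sub'] card_image_le[OF fin(1), of "\<lambda>V. f ` V"] fin by simp
    with fin show "int (card {W \<in> \<W>. y \<in> W}) \<le> n + 1" by linarith
  qed
qed

section \<open>Mean dimension of a flow\<close>

locale metric_flow =
  fixes X :: "'a topology" and d :: "'a \<Rightarrow> 'a \<Rightarrow> real" and \<Phi> :: "real \<Rightarrow> 'a \<Rightarrow> 'a"
  assumes metric: "Metric_space (topspace X) d"
    and mtopology_eq: "Metric_space.mtopology (topspace X) d = X"
    and flow: "topological_flow X \<Phi>"
begin

lemma compact: "compact_space X"
  using flow by (simp add: topological_flow_def)

lemma Hausdorff: "Hausdorff_space X"
  using Metric_space.Hausdorff_space_mtopology[OF metric] mtopology_eq by simp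

lemma normal: "normal_space X"
  using compact Hausdorff compact_Hausdorff_or_regular_imp_normal_space by blast

lemma flow_zero: "x \<in> topspace X \<Longrightarrow> \<Phi> 0 x = x"
  using flow by (simp add: topological_flow_def)

lemma flow_add: "x \<in> topspace X \<Longrightarrow> \<Phi> (s + t) x = \<Phi> s (\<Phi> t x)"
  using flow by (simp add: topological_flow_def)

lemma continuous_flow: "continuous_map (prod_topology euclideanreal X) X (\<lambda>(t, x). \<Phi> t x)"
  using flow by (simp add: topological_flow_def)

lemma flow_in: "x \<in> topspace X \<Longrightarrow> \<Phi> t x \<in> topspace X"
  using continuous_map_image_subset_topspace[OF continuous_flow] by (force simp: image_subset_iff)

lemma continuous_flow_compose:
  assumes "continuous_map Z euclideanreal \<sigma>" "continuous_map Z X f"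
  shows "continuous_map Z X (\<lambda>z. \<Phi> (\<sigma> z) (f z))"
proof -
  have "continuous_map Z (prod_topology euclideanreal X) (\<lambda>z. (\<sigma> z, f z))"
    using assms by (simp add: continuous_map_pairwise o_def)
  from continuous_map_compose[OF this continuous_flow] show ?thesis by (simp add: o_def)
qed

lemma continuous_flow_at: "continuous_map X X (\<Phi> t)"
  using continuous_flow_compose[of X "\<lambda>_. t" "\<lambda>x. x"] by (simp add: continuous_map_id[unfolded id_def])

lemma continuous_orbit:
  assumes "continuous_map X euclideanreal F" "x \<in> topspace X"
  shows "continuous_on UNIV (\<lambda>t. F (\<Phi> t x))"
proof -
  have "continuous_map euclideanreal X (\<lambda>t. \<Phi> t x)"
    by (rule continuous_flow_compose) (use assms(2) in auto)
  from continuous_map_compose[OF this assms(1)] show ?thesis by (simp add: o_def)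
qed

lemma continuous_dist_compose:
  assumes "continuous_map Z X f" "continuous_map Z X g"
  shows "continuous_map Z euclideanreal (\<lambda>z. d (f z) (g z))"
proof -
  interpret Metric_space "topspace X" d by (rule metric)
  have "continuous_map Z (mtopology_of (metric (topspace X, d))) f"
    "continuous_map Z (mtopology_of (metric (topspace X, d))) g"
    using assms mtopology_eq by simp_all
  from continuous_map_mdist[OF this] show ?thesis by simp
qed

lemma dist_bounded: "\<exists>B. \<forall>x\<in>topspace X. \<forall>y\<in>topspace X. d x y \<le> B"
proof -
  interpret Metric_space "topspace X" d by (rule metric)
  have "mbounded (topspace X)"
    using compact mtopology_eq compact_space_def by (intro compactin_imp_mbounded) auto
  then show ?thesis by (auto simp: mbounded_alt)
qed

lemma dist_nonneg: "0 \<le> d x y"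
  by (rule Metric_space.nonneg[OF metric])

lemma dist_le_orbit_metric:
  assumes "x \<in> topspace X" "y \<in> topspace X" "r \<in> {0..R}"
  shows "d (\<Phi> r x) (\<Phi> r y) \<le> orbit_metric \<Phi> d R x y"
proof -
  obtain B where "\<And>x y. x \<in> topspace X \<Longrightarrow> y \<in> topspace X \<Longrightarrow> d x y \<le> B" using dist_bounded by auto
  then have "bdd_above ((\<lambda>r. d (\<Phi> r x) (\<Phi> r y)) ` {0..R})"
    using assms flow_in by (intro bdd_aboveI2[of _ _ B]) auto
  then show ?thesis unfolding orbit_metric_def using assms(3) by (rule cSUP_upper2) auto
qed

lemma orbit_metric_leI:
  assumes "0 \<le> R" "\<And>r. r \<in> {0..R} \<Longrightarrow> d (\<Phi> r x) (\<Phi> r y) \<le> c"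
  shows "orbit_metric \<Phi> d R x y \<le> c"
  unfolding orbit_metric_def using assms by (intro cSUP_least) auto

lemma le_diam_orbit_metric:
  assumes "S \<subseteq> topspace X" "0 \<le> R" "x \<in> S" "y \<in> S"
  shows "orbit_metric \<Phi> d R x y \<le> diam_wrt (orbit_metric \<Phi> d R) S"
proof -
  obtain B where B: "\<And>x y. x \<in> topspace X \<Longrightarrow> y \<in> topspace X \<Longrightarrow> d x y \<le> B" using dist_bounded by auto
  have "orbit_metric \<Phi> d R x y \<le> B" if "x \<in> S" "y \<in> S" for x y
    using assms that B flow_in by (intro orbit_metric_leI) (auto simp: subset_iff)
  then have "bdd_above ((\<lambda>(x, y). orbit_metric \<Phi> d R x y) ` (S \<times> S))"
    by (intro bdd_aboveI2[of _ _ B]) auto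
  then have "(case (x, y) of (x, y) \<Rightarrow> orbit_metric \<Phi> d R x y) \<le> (SUP (x, y)\<in>S \<times> S. orbit_metric \<Phi> d R x y)"
    using assms by (intro cSUP_upper) auto
  then show ?thesis using assms(3) by (auto simp: diam_wrt_def)
qed

lemma diam_orbit_metric_le:
  assumes "0 \<le> c" "\<And>x y. x \<in> S \<Longrightarrow> y \<in> S \<Longrightarrow> orbit_metric \<Phi> d R x y \<le> c"
  shows "diam_wrt (orbit_metric \<Phi> d R) S \<le> c"
  unfolding diam_wrt_def using assms by (auto intro!: cSUP_least)

definition small_fibres :: "real \<Rightarrow> real \<Rightarrow> (nat \<Rightarrow> real) topology \<Rightarrow> ('a \<Rightarrow> (nat \<Rightarrow> real)) \<Rightarrow> bool" where
  "small_fibres \<epsilon> R K f \<longleftrightarrow> compact_space K \<and> metrizable_space K \<and> continuous_map X K f \<and>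
     (\<forall>y\<in>topspace K. diam_wrt (orbit_metric \<Phi> d R) {x \<in> topspace X. f x = y} < \<epsilon>)"

lemma Widim_alt:
  "Widim \<epsilon> X (orbit_metric \<Phi> d R) = (INF K\<in>{K. \<exists>f. small_fibres \<epsilon> R K f}. covering_dim K)"
  unfolding Widim_def small_fibres_def by (rule arg_cong[where f = "\<lambda>A. INF K\<in>A. covering_dim K"]) auto

lemma covering_dim_nonempty:
  assumes "topspace K \<noteq> {}" "n \<ge> -1" "covering_dim_le K n"
  shows "n \<ge> 0"
proof (rule ccontr)
  assume "\<not> n \<ge> 0"
  with assms have n: "n = -1" by simp
  have "(\<forall>U\<in>{topspace K}. openin K U) \<and> \<Union>{topspace K} = topspace K" by simp
  from assms(3)[unfolded covering_dim_le_def, THEN spec, THEN mp, OF this]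
  obtain \<V> where \<V>: "(\<forall>V\<in>\<V>. openin K V) \<and> \<Union>\<V> = topspace K \<and> (\<forall>V\<in>\<V>. \<exists>U\<in>{topspace K}. V \<subseteq> U) \<and>
    (\<forall>x\<in>topspace K. finite {V \<in> \<V>. x \<in> V} \<and> int (card {V \<in> \<V>. x \<in> V}) \<le> n + 1)" ..
  obtain x where x: "x \<in> topspace K" using assms(1) by blast
  then have "finite {V \<in> \<V>. x \<in> V}" "card {V \<in> \<V>. x \<in> V} = 0" using \<V> n by auto
  then have "{V \<in> \<V>. x \<in> V} = {}" by simp
  then show False using \<V> x by blast
qed

lemma Widim_lessE:
  assumes X: "topspace X \<noteq> {}" and W: "Widim \<epsilon> X (orbit_metric \<Phi> d R) < c"
  obtains K f n where "small_fibres \<epsilon> R K f" "covering_dim_le K (int n)" "ereal (real n) < c"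
proof -
  obtain K f where K: "small_fibres \<epsilon> R K f" "covering_dim K < c"
    using W unfolding Widim_alt INF_less_iff by auto
  then obtain n where n: "n \<ge> -1" "covering_dim_le K n" "ereal (real_of_int n) < c"
    unfolding covering_dim_def INF_less_iff by auto
  have "f ` topspace X \<subseteq> topspace K"
    using K(1) by (simp add: small_fibres_def continuous_map_image_subset_topspace)
  then have "topspace K \<noteq> {}" using X by auto
  from covering_dim_nonempty[OF this n(1,2)] have "n = int (nat n)" by simp
  with K(1) n show thesis using that[of K f "nat n"] by (metis of_int_of_nat_eq)
qed

lemma Widim_le:
  assumes "small_fibres \<epsilon> R K f" "covering_dim_le K (int n)"
  shows "Widim \<epsilon> X (orbit_metric \<Phi> d R) \<le> ereal (real n)"
proof -
  have "Widim \<epsilon> X (orbit_metric \<Phi> d R) \<le> covering_dim K"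
    unfolding Widim_alt using assms(1) by (intro INF_lower) auto
  also have "covering_dim K \<le> ereal (real_of_int (int n))"
    unfolding covering_dim_def using assms(2) by (intro INF_lower) auto
  finally show ?thesis by simp
qed

lemma Widim_nonneg:
  assumes X: "topspace X \<noteq> {}"
  shows "0 \<le> Widim \<epsilon> X (orbit_metric \<Phi> d R)"
proof (rule ccontr)
  assume "\<not> 0 \<le> Widim \<epsilon> X (orbit_metric \<Phi> d R)"
  then have "Widim \<epsilon> X (orbit_metric \<Phi> d R) < 0" by simp
  then show False by (rule Widim_lessE[OF X]) simp
qed

lemma small_fibres_mono:
  assumes "small_fibres \<epsilon> S K f" "0 \<le> R" "R \<le> S" "\<epsilon> \<le> \<epsilon>'"
  shows "small_fibres \<epsilon>' R K f"
proof -
  have "diam_wrt (orbit_metric \<Phi> d R) T \<le> diam_wrt (orbit_metric \<Phi> d S) T" if T: "T \<subseteq> topspace X" for T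
  proof (cases "T = {}")
    case False
    then obtain x where x: "x \<in> T" by auto
    have le: "orbit_metric \<Phi> d R x y \<le> diam_wrt (orbit_metric \<Phi> d S) T" if "x \<in> T" "y \<in> T" for x y
    proof (rule orbit_metric_leI[OF assms(2)])
      fix r assume "r \<in> {0..R}"
      then have "d (\<Phi> r x) (\<Phi> r y) \<le> orbit_metric \<Phi> d S x y"
        using that T assms by (intro dist_le_orbit_metric) auto
      also have "\<dots> \<le> diam_wrt (orbit_metric \<Phi> d S) T"
        using that T assms by (intro le_diam_orbit_metric) auto
      finally show "d (\<Phi> r x) (\<Phi> r y) \<le> diam_wrt (orbit_metric \<Phi> d S) T" .
    qed
    have "0 \<le> d (\<Phi> 0 x) (\<Phi> 0 x)" by (rule dist_nonneg)
    also have "\<dots> \<le> orbit_metric \<Phi> d R x x" using x T assms by (intro dist_le_orbit_metric) auto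
    also have "\<dots> \<le> diam_wrt (orbit_metric \<Phi> d S) T" using le x by auto
    finally show ?thesis using le by (intro diam_orbit_metric_le) auto
  qed (simp add: diam_wrt_def)
  then have le: "diam_wrt (orbit_metric \<Phi> d R) {x \<in> topspace X. f x = y} \<le>
      diam_wrt (orbit_metric \<Phi> d S) {x \<in> topspace X. f x = y}" for y
    by simp
  have "diam_wrt (orbit_metric \<Phi> d R) {x \<in> topspace X. f x = y} < \<epsilon>'" if "y \<in> topspace K" for y
  proof -
    have "diam_wrt (orbit_metric \<Phi> d S) {x \<in> topspace X. f x = y} < \<epsilon>"
      using assms(1) that by (simp add: small_fibres_def)
    with le[of y] assms(4) show ?thesis by linarith
  qed
  then show ?thesis
    using assms(1) unfolding small_fibres_def by simp
qed

lemma Widim_antimono: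
  assumes "0 \<le> R" "R \<le> S" "\<epsilon> \<le> \<epsilon>'"
  shows "Widim \<epsilon>' X (orbit_metric \<Phi> d R) \<le> Widim \<epsilon> X (orbit_metric \<Phi> d S)"
  unfolding Widim_alt using small_fibres_mono[OF _ assms] by (intro INF_superset_mono) auto

text \<open>
  \<^const>\<open>Widim\<close> quantifies over topologies on sets of real sequences, so a product of two
  such spaces has to be coded as a space of sequences again.
\<close>

definition interleave :: "(nat \<Rightarrow> real) \<times> (nat \<Rightarrow> real) \<Rightarrow> (nat \<Rightarrow> real)" where
  "interleave p = (\<lambda>n. if even n then fst p (n div 2) else snd p (n div 2))"

lemma inj_interleave: "inj interleave"
proof (rule injI)
  fix p q assume eq: "interleave p = interleave q"
  have "fst p n = fst q n" "snd p n = snd q n" for n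
    using fun_cong[OF eq, of "2 * n"] fun_cong[OF eq, of "Suc (2 * n)"] by (simp_all add: interleave_def)
  then show "p = q" by (simp add: prod_eq_iff fun_eq_iff)
qed

text \<open>
  The map \<open>x \<mapsto> (f x, g (\<Phi> R x))\<close> controls the orbit up to time \<open>R\<close> by \<open>f\<close> and from
  there on by \<open>g\<close>.
\<close>

lemma small_fibres_product:
  assumes K: "small_fibres \<epsilon> R K f" "covering_dim_le K (int m)"
    and L: "small_fibres \<epsilon> S L g" "covering_dim_le L (int n)" and RS: "0 \<le> R" "0 \<le> S" "0 < \<epsilon>"
  obtains M h where "small_fibres \<epsilon> (R + S) M h" "covering_dim_le M (int (m + n))"
proof -
  define P where "P = prod_topology K L"
  define M where "M = quotient_topology P interleave"
  define h where "h x = interleave (f x, g (\<Phi> R x))" for x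
  have cK: "compact_space K" "metrizable_space K" "continuous_map X K f"
    and cL: "compact_space L" "metrizable_space L" "continuous_map X L g"
    using K L by (auto simp: small_fibres_def)
  have q: "quotient_map P M interleave"
    unfolding M_def by (rule quotient_map_quotient_topology)
  have inj: "inj_on interleave (topspace P)" using inj_interleave inj_on_subset by blast
  then have hom: "homeomorphic_map P M interleave"
    using q by (simp add: homeomorphic_map_def)
  then have "P homeomorphic_space M" by (rule homeomorphic_map_imp_homeomorphic_space)
  moreover have "compact_space P" "metrizable_space P"
    using cK cL by (simp_all add: P_def compact_space_prod_topology metrizable_space_prod_topology)
  ultimately have M: "compact_space M" "metrizable_space M"
    using homeomorphic_compact_space homeomorphic_metrizable_space by blast+
  have cont: "continuous_map X M h"
  proof -
    have "continuous_map X L (\<lambda>x. g (\<Phi> R x))"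
      using continuous_map_compose[OF continuous_flow_at cL(3)] by (simp add: o_def)
    then have "continuous_map X P (\<lambda>x. (f x, g (\<Phi> R x)))"
      using cK by (simp add: P_def continuous_map_pairwise o_def)
    from continuous_map_compose[OF this quotient_imp_continuous_map[OF q]]
    show ?thesis by (simp add: h_def[abs_def] o_def)
  qed
  have "diam_wrt (orbit_metric \<Phi> d (R + S)) {x \<in> topspace X. h x = w} < \<epsilon>" if w: "w \<in> topspace M" for w
  proof -
    obtain y z where yz: "w = interleave (y, z)" "y \<in> topspace K" "z \<in> topspace L"
      using w by (auto simp: M_def topspace_quotient_topology P_def)
    define A where "A = {x \<in> topspace X. f x = y}"
    define B where "B = {x \<in> topspace X. g x = z}"
    define a where "a = diam_wrt (orbit_metric \<Phi> d R) A"
    define b where "b = diam_wrt (orbit_metric \<Phi> d S) B"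
    define c where "c = max 0 (max a b)"
    have "a < \<epsilon>" "b < \<epsilon>" using K L yz by (auto simp: small_fibres_def a_def b_def A_def B_def)
    then have "c < \<epsilon>" using RS by (simp add: c_def)
    moreover have "diam_wrt (orbit_metric \<Phi> d (R + S)) {x \<in> topspace X. h x = w} \<le> c"
    proof (rule diam_orbit_metric_le)
      fix x x' assume "x \<in> {x \<in> topspace X. h x = w}" "x' \<in> {x \<in> topspace X. h x = w}"
      then have x: "x \<in> A" "x' \<in> A" "\<Phi> R x \<in> B" "\<Phi> R x' \<in> B" "x \<in> topspace X" "x' \<in> topspace X"
        using injD[OF inj_interleave] flow_in by (auto simp: h_def yz A_def B_def)
      have AB: "A \<subseteq> topspace X" "B \<subseteq> topspace X" by (auto simp: A_def B_def)
      show "orbit_metric \<Phi> d (R + S) x x' \<le> c"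
      proof (rule orbit_metric_leI)
        fix r assume r: "r \<in> {0..R + S}"
        show "d (\<Phi> r x) (\<Phi> r x') \<le> c"
        proof (cases "r \<le> R")
          case True
          then have "d (\<Phi> r x) (\<Phi> r x') \<le> orbit_metric \<Phi> d R x x'"
            using r x by (intro dist_le_orbit_metric) auto
          also have "\<dots> \<le> a" unfolding a_def using x AB RS by (intro le_diam_orbit_metric) auto
          finally show ?thesis by (simp add: c_def)
        next
          case False
          then have "d (\<Phi> (r - R) (\<Phi> R x)) (\<Phi> (r - R) (\<Phi> R x')) \<le> orbit_metric \<Phi> d S (\<Phi> R x) (\<Phi> R x')"
            using r x AB by (intro dist_le_orbit_metric) auto
          also have "\<dots> \<le> b" unfolding b_def using x AB RS by (intro le_diam_orbit_metric) auto
          finally show ?thesis using x flow_add[of x "r - R" R] flow_add[of x' "r - R" R]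
            by (simp add: c_def)
        qed
      qed (use RS in auto)
    qed (simp add: c_def)
    ultimately show ?thesis by linarith
  qed
  then have "small_fibres \<epsilon> (R + S) M h"
    using M cont by (simp add: small_fibres_def)
  moreover have "covering_dim_le M (int (m + n))"
    using cK cL K L metrizable_imp_normal_space unfolding P_def
    by (intro covering_dim_le_homeomorphic[OF hom[unfolded P_def]] covering_dim_le_prod_topology) auto
  ultimately show thesis by (rule that)
qed

end

text \<open>
  Fekete's lemma for a monotone function of a real variable that may take the value \<open>\<infinity>\<close>.
  Subadditivity is stated with strict real bounds, so that infinite values satisfy it
  vacuously.
\<close>

lemma subadditive_limit_exists:
  fixes g :: "real \<Rightarrow> ereal"
  assumes nn: "\<And>R. 0 \<le> g R" and mono: "\<And>R S. 0 < R \<Longrightarrow> R \<le> S \<Longrightarrow> g R \<le> g S"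
    and sub: "\<And>R S r s. 0 < R \<Longrightarrow> 0 < S \<Longrightarrow> g R < ereal r \<Longrightarrow> g S < ereal s \<Longrightarrow> g (R + S) < ereal (r + s)"
  shows "((\<lambda>R. g R / ereal R) \<longlongrightarrow> (INF R\<in>{0<..}. g R / ereal R)) at_top"
proof (rule order_tendstoI)
  fix a assume a: "a < (INF R\<in>{0<..}. g R / ereal R)"
  have "eventually (\<lambda>R. R > (0::real)) at_top" by (rule eventually_gt_at_top)
  then show "eventually (\<lambda>R. a < g R / ereal R) at_top"
  proof eventually_elim
    case (elim R)
    then have "(INF R\<in>{0<..}. g R / ereal R) \<le> g R / ereal R" by (intro INF_lower) auto
    with a show ?case by simp
  qed
next
  fix a assume "(INF R\<in>{0<..}. g R / ereal R) < a"
  have div: "g R / ereal R < ereal c \<longleftrightarrow> g R < ereal (c * R)" if "R > 0" for R c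
    using that nn[of R] by (cases "g R") (auto simp: field_simps)
  obtain R0 where R0: "R0 > 0" "g R0 / ereal R0 < a"
    using \<open>(INF R\<in>{0<..}. g R / ereal R) < a\<close> by (auto simp: INF_less_iff)
  obtain b where b: "g R0 / ereal R0 < ereal b" "ereal b < a" using ereal_dense2[OF R0(2)] by blast
  obtain c where c: "b < c" "ereal c < a" using ereal_dense2[OF b(2)] by auto
  have g0: "g R0 < ereal (b * R0)" using b R0 div by simp
  have "0 < b * R0" using nn[of R0] g0 by (metis ereal_less(2) order_le_less_trans)
  then have b0: "b > 0" using R0 by (simp add: zero_less_mult_iff)
  have mult: "g (real (Suc k) * R0) < ereal (real (Suc k) * (b * R0))" for k
  proof (induction k)
    case (Suc k)
    have "g (real (Suc k) * R0 + R0) < ereal (real (Suc k) * (b * R0) + b * R0)"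
      using R0 g0 Suc by (intro sub) auto
    then show ?case by (simp add: algebra_simps)
  qed (use g0 in simp)
  have "eventually (\<lambda>R. R > max 1 (b * R0 / (c - b))) at_top" by (rule eventually_gt_at_top)
  then show "eventually (\<lambda>R. g R / ereal R < a) at_top"
  proof eventually_elim
    case (elim R)
    then have R: "R > 0" "b * R0 < R * (c - b)" using c(1) by (auto simp: field_simps)
    define k where "k = nat \<lfloor>R / R0\<rfloor>"
    have k: "real k \<le> R / R0" "R / R0 < real (Suc k)" using R R0 by (auto simp: k_def) linarith+
    have "R \<le> real (Suc k) * R0" using k R0 by (simp add: field_simps)
    then have "g R \<le> g (real (Suc k) * R0)" using R by (intro mono) auto
    also have "\<dots> < ereal (real (Suc k) * (b * R0))" by (rule mult)
    also have "real (Suc k) * (b * R0) \<le> (R / R0 + 1) * (b * R0)"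
      using k b0 R0 by (intro mult_right_mono) auto
    also have "\<dots> = b * R + b * R0" using R0 by (simp add: field_simps)
    also have "\<dots> \<le> c * R" using R by (simp add: algebra_simps)
    finally have "g R < ereal (c * R)" by simp
    then have "g R / ereal R < ereal c" using div R by simp
    with c show ?case by order
  qed
qed

context metric_flow
begin

text \<open>
  A bound on \<^const>\<open>mdim\<close> carries information only if the two limits in its definition
  exist.  The inner one does by subadditivity in \<open>R\<close>, the outer one because the inner limits
  increase as \<open>\<epsilon>\<close> decreases.  The outer limit is therefore a supremum, and one \<open>c\<close> works for
  all \<open>\<epsilon>\<close>.
\<close>

theorem mdim_less_imp_linear_Widim:
  assumes X: "topspace X \<noteq> {}" and mdim: "mdim X d \<Phi> < ereal b"
  obtains c where "c < b" "\<And>\<epsilon>. \<epsilon> > 0 \<Longrightarrow>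
    \<exists>R0>0. \<forall>R\<ge>R0. \<exists>K f n. small_fibres \<epsilon> R K f \<and> covering_dim_le K (int n) \<and> real n < c * R"
proof -
  define W where "W \<epsilon> R = Widim \<epsilon> X (orbit_metric \<Phi> d R)" for \<epsilon> R
  define w where "w \<epsilon> = (INF R\<in>{0<..}. W \<epsilon> R / ereal R)" for \<epsilon>
  have lim: "((\<lambda>R. W \<epsilon> R / ereal R) \<longlongrightarrow> w \<epsilon>) at_top" if \<epsilon>: "\<epsilon> > 0" for \<epsilon>
    unfolding w_def
  proof (rule subadditive_limit_exists)
    show "0 \<le> W \<epsilon> R" for R unfolding W_def by (rule Widim_nonneg[OF X])
    show "W \<epsilon> R \<le> W \<epsilon> S" if "0 < R" "R \<le> S" for R S
      unfolding W_def using that by (intro Widim_antimono) auto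
    show "W \<epsilon> (R + S) < ereal (r + s)"
      if RS: "0 < R" "0 < S" and Rr: "W \<epsilon> R < ereal r" and Ss: "W \<epsilon> S < ereal s" for R S r s
    proof -
      obtain K f m where K: "small_fibres \<epsilon> R K f" "covering_dim_le K (int m)" "ereal (real m) < ereal r"
        using Widim_lessE[OF X Rr[unfolded W_def]] .
      obtain L g n where L: "small_fibres \<epsilon> S L g" "covering_dim_le L (int n)" "ereal (real n) < ereal s"
        using Widim_lessE[OF X Ss[unfolded W_def]] .
      obtain M h where "small_fibres \<epsilon> (R + S) M h" "covering_dim_le M (int (m + n))"
        using small_fibres_product[OF K(1,2) L(1,2)] RS \<epsilon> by auto
      then have "W \<epsilon> (R + S) \<le> ereal (real (m + n))" unfolding W_def by (rule Widim_le)
      also have "\<dots> < ereal (r + s)" using K(3) L(3) by simp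
      finally show ?thesis .
    qed
  qed
  have anti: "w \<epsilon>' \<le> w \<epsilon>" if "0 < \<epsilon>" "\<epsilon> \<le> \<epsilon>'" for \<epsilon> \<epsilon>'
    unfolding w_def
  proof (rule INF_mono)
    fix R :: real assume "R \<in> {0<..}"
    moreover from this have "W \<epsilon>' R / ereal R \<le> W \<epsilon> R / ereal R"
      unfolding W_def using that by (intro ereal_divide_right_mono Widim_antimono) auto
    ultimately show "\<exists>S\<in>{0<..}. W \<epsilon>' S / ereal S \<le> W \<epsilon> R / ereal R" by blast
  qed
  define s where "s = (SUP \<epsilon>\<in>{0<..}. w \<epsilon>)"
  have "(w \<longlongrightarrow> s) (at_right 0)"
  proof (rule order_tendstoI)
    fix a assume "a < s"
    then obtain \<epsilon> where \<epsilon>: "\<epsilon> > 0" "a < w \<epsilon>" by (auto simp: s_def less_SUP_iff)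
    then have "\<forall>y>0. y < \<epsilon> \<longrightarrow> a < w y" using anti[of _ \<epsilon>] by (auto intro: order_less_le_trans)
    then show "eventually (\<lambda>\<epsilon>. a < w \<epsilon>) (at_right 0)"
      using \<epsilon>(1) unfolding eventually_at_right_field by blast
  next
    fix a assume "s < a"
    then have "w \<epsilon> < a" if "\<epsilon> > 0" for \<epsilon>
      using that by (auto simp: s_def intro: order_le_less_trans[OF SUP_upper])
    then show "eventually (\<lambda>\<epsilon>. w \<epsilon> < a) (at_right 0)"
      unfolding eventually_at_right_field by (intro exI[of _ 1]) auto
  qed
  moreover have ev: "eventually (\<lambda>\<epsilon>. w \<epsilon> = Lim at_top (\<lambda>R. Widim \<epsilon> X (orbit_metric \<Phi> d R) / ereal R)) (at_right 0)"
    unfolding eventually_at_right_field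
    using tendsto_Lim[OF _ lim] by (intro exI[of _ 1]) (auto simp: W_def)
  ultimately have "((\<lambda>\<epsilon>. Lim at_top (\<lambda>R. Widim \<epsilon> X (orbit_metric \<Phi> d R) / ereal R)) \<longlongrightarrow> s) (at_right 0)"
    by (rule Lim_transform_eventually)
  then have "mdim X d \<Phi> = s" unfolding mdim_def by (intro tendsto_Lim) auto
  with mdim have "s < ereal b" by simp
  then obtain c where c: "s < ereal c" "c < b" using ereal_dense2[of s "ereal b"] by auto
  show thesis
  proof (rule that[of c])
    show "c < b" using c by simp
    fix \<epsilon> :: real assume \<epsilon>: "\<epsilon> > 0"
    have "w \<epsilon> \<le> s" unfolding s_def using \<epsilon> by (intro SUP_upper) auto
    with c have "w \<epsilon> < ereal c" by order
    from order_tendstoD(2)[OF lim[OF \<epsilon>] this] eventually_gt_at_top[of 0]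
    have "eventually (\<lambda>R. W \<epsilon> R / ereal R < ereal c \<and> 0 < R) at_top" by (rule eventually_conj)
    then obtain R1 where R1: "\<And>R. R \<ge> R1 \<Longrightarrow> W \<epsilon> R / ereal R < ereal c \<and> 0 < R"
      by (auto simp: eventually_at_top_linorder)
    show "\<exists>R0>0. \<forall>R\<ge>R0. \<exists>K f n. small_fibres \<epsilon> R K f \<and> covering_dim_le K (int n) \<and> real n < c * R"
    proof (intro exI[of _ R1] conjI allI impI)
      show "R1 > 0" using R1[of R1] by simp
      fix R assume "R \<ge> R1"
      then have R: "W \<epsilon> R / ereal R < ereal c" "0 < R" using R1 by auto
      have "0 \<le> W \<epsilon> R" unfolding W_def by (rule Widim_nonneg[OF X])
      then have "W \<epsilon> R < ereal (c * R)" using R by (cases "W \<epsilon> R") (auto simp: field_simps)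
      then show "\<exists>K f n. small_fibres \<epsilon> R K f \<and> covering_dim_le K (int n) \<and> real n < c * R"
        unfolding W_def by (rule Widim_lessE[OF X]) auto
    qed
  qed
qed

end

section \<open>Separating the sets of one colour\<close>

context metric_flow
begin

text \<open>
  The pairs of points that are at least \<open>\<epsilon>\<close> apart at some time in \<open>[0, R]\<close> form a compact
  set, and \<open>f\<close> maps none of them into the diagonal.  The image of this set in \<open>K \<times> K\<close> is
  closed, so the diagonal has a neighbourhood of squares that avoid it.
\<close>

lemma small_fibres_cover:
  assumes K: "small_fibres \<epsilon> R K f" and R: "0 \<le> R"
  obtains \<U> where "\<And>U. U \<in> \<U> \<Longrightarrow> openin K U" "\<Union>\<U> = topspace K"
    "\<And>U x x' r. U \<in> \<U> \<Longrightarrow> x \<in> topspace X \<Longrightarrow> x' \<in> topspace X \<Longrightarrow> f x \<in> U \<Longrightarrow> f x' \<in> U \<Longrightarrow>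
       r \<in> {0..R} \<Longrightarrow> d (\<Phi> r x) (\<Phi> r x') < \<epsilon>"
proof -
  have cK: "compact_space K" "metrizable_space K" "continuous_map X K f"
    using K by (auto simp: small_fibres_def)
  define T where "T = prod_topology (top_of_set {0..R}) (prod_topology X X)"
  define D where "D = (\<lambda>p. d (\<Phi> (fst p) (fst (snd p))) (\<Phi> (fst p) (snd (snd p))))"
  have f1: "continuous_map T euclideanreal fst"
    using continuous_map_fst[of "top_of_set {0..R}" "prod_topology X X"]
    by (simp add: T_def continuous_map_in_subtopology)
  have f2: "continuous_map T X (\<lambda>p. fst (snd p))" and f3: "continuous_map T X (\<lambda>p. snd (snd p))"
    unfolding T_def
    using continuous_map_compose[OF continuous_map_snd continuous_map_fst]
      continuous_map_compose[OF continuous_map_snd continuous_map_snd] by (simp_all add: o_def)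
  have contD: "continuous_map T euclideanreal D"
    unfolding D_def using f1 f2 f3 by (intro continuous_dist_compose continuous_flow_compose)
  have cT: "compact_space T"
    using compact by (simp add: T_def compact_space_prod_topology compact_space_subtopology)
  define P where "P = {p \<in> topspace T. D p \<in> {\<epsilon>..}}"
  have "closedin T P" unfolding P_def
    using contD by (rule closedin_continuous_map_preimage) simp
  then have "compactin T P" using cT by (rule closedin_compact_space[rotated])
  moreover have "continuous_map T (prod_topology K K) (\<lambda>p. (f (fst (snd p)), f (snd (snd p))))"
    using continuous_map_compose[OF f2 cK(3)] continuous_map_compose[OF f3 cK(3)]
    by (simp add: continuous_map_pairwise o_def)
  ultimately have "compactin (prod_topology K K) ((\<lambda>p. (f (fst (snd p)), f (snd (snd p)))) ` P)"
    by (rule image_compactin)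
  moreover have "Hausdorff_space (prod_topology K K)"
    using cK(2) metrizable_imp_Hausdorff_space Hausdorff_space_prod_topology by blast
  ultimately have cl: "closedin (prod_topology K K) ((\<lambda>p. (f (fst (snd p)), f (snd (snd p)))) ` P)"
    by (rule compactin_imp_closedin[rotated])
  define N where "N = topspace K \<times> topspace K - (\<lambda>p. (f (fst (snd p)), f (snd (snd p)))) ` P"
  have N: "openin (prod_topology K K) N"
    unfolding N_def using openin_diff[OF openin_topspace cl] by simp
  have yN: "(y, y) \<in> N" if y: "y \<in> topspace K" for y
  proof -
    have False if p: "p \<in> P" "(f (fst (snd p)), f (snd (snd p))) = (y, y)" for p
    proof -
      obtain r x x' where rx: "p = (r, x, x')" by (metis surj_pair)
      with p have *: "r \<in> {0..R}" "x \<in> topspace X" "x' \<in> topspace X" "f x = y" "f x' = y"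
        "\<epsilon> \<le> d (\<Phi> r x) (\<Phi> r x')" by (auto simp: P_def T_def D_def)
      have "d (\<Phi> r x) (\<Phi> r x') \<le> orbit_metric \<Phi> d R x x'"
        using * by (intro dist_le_orbit_metric) auto
      also have "\<dots> \<le> diam_wrt (orbit_metric \<Phi> d R) {x \<in> topspace X. f x = y}"
        using * R by (intro le_diam_orbit_metric) auto
      also have "\<dots> < \<epsilon>" using K y by (simp add: small_fibres_def)
      finally show False using *(6) by simp
    qed
    then show ?thesis using y by (fastforce simp: N_def)
  qed
  define \<U> where "\<U> = {U. openin K U \<and> U \<times> U \<subseteq> N}"
  show thesis
  proof (rule that[of \<U>])
    show "openin K U" if "U \<in> \<U>" for U using that by (simp add: \<U>_def)
    have "y \<in> \<Union>\<U>" if y: "y \<in> topspace K" for y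
    proof -
      obtain U V where "openin K U" "openin K V" "y \<in> U" "y \<in> V" "U \<times> V \<subseteq> N"
        using N[unfolded openin_prod_topology_alt, rule_format, OF yN[OF y]] by auto
      then have "U \<inter> V \<in> \<U>" "y \<in> U \<inter> V" by (auto simp: \<U>_def)
      then show ?thesis by blast
    qed
    moreover have "U \<subseteq> topspace K" if "U \<in> \<U>" for U
      using that by (simp add: \<U>_def openin_subset)
    ultimately show "\<Union>\<U> = topspace K" by blast
    show "d (\<Phi> r x) (\<Phi> r x') < \<epsilon>"
      if U: "U \<in> \<U>" and x: "x \<in> topspace X" "x' \<in> topspace X" "f x \<in> U" "f x' \<in> U" and r: "r \<in> {0..R}"
      for U x x' r
    proof (rule ccontr)
      assume "\<not> d (\<Phi> r x) (\<Phi> r x') < \<epsilon>"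
      then have "(r, x, x') \<in> P" using x r by (auto simp: P_def T_def D_def)
      then have "(f x, f x') \<notin> N" unfolding N_def by force
      then show False using U x by (auto simp: \<U>_def)
    qed
  qed
qed

text \<open>
  The colouring of \<open>K\<close> pulled back to \<open>X\<close>.  The closed sets \<open>A i\<close> are there because
  functions prescribed on them can be extended to \<open>X\<close>.
\<close>

lemma coloured_families:
  assumes K: "small_fibres \<epsilon> R K f" "covering_dim_le K (int n)" and R: "0 \<le> R"
  obtains F A where
    "\<And>i. i < Suc n + p \<Longrightarrow> pairwise disjnt (F i)"
    "\<And>i U. i < Suc n + p \<Longrightarrow> U \<in> F i \<Longrightarrow> openin X U"
    "\<And>i U x x' r. i < Suc n + p \<Longrightarrow> U \<in> F i \<Longrightarrow> x \<in> U \<Longrightarrow> x' \<in> U \<Longrightarrow> r \<in> {0..R} \<Longrightarrow>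
       d (\<Phi> r x) (\<Phi> r x') < \<epsilon>"
    "\<And>i. i < Suc n + p \<Longrightarrow> closedin X (A i)"
    "\<And>i. i < Suc n + p \<Longrightarrow> A i \<subseteq> \<Union>(F i)"
    "\<And>x. x \<in> topspace X \<Longrightarrow> Suc p \<le> card {i \<in> {..<Suc n + p}. x \<in> A i}"
proof -
  have cK: "compact_space K" "metrizable_space K" "continuous_map X K f"
    using K by (auto simp: small_fibres_def)
  obtain \<U> where \<U>: "\<And>U. U \<in> \<U> \<Longrightarrow> openin K U" "\<Union>\<U> = topspace K"
    and \<U>d: "\<And>U x x' r. U \<in> \<U> \<Longrightarrow> x \<in> topspace X \<Longrightarrow> x' \<in> topspace X \<Longrightarrow> f x \<in> U \<Longrightarrow> f x' \<in> U \<Longrightarrow>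
       r \<in> {0..R} \<Longrightarrow> d (\<Phi> r x) (\<Phi> r x') < \<epsilon>"
    using small_fibres_cover[OF K(1) R] by metis
  have "normal_space K" using cK(2) by (rule metrizable_imp_normal_space)
  then obtain G where G: "coloured_cover K \<U> (Suc n + p) (Suc p) G"
    using covering_dim_le_imp_coloured_cover[OF cK(1) _ K(2) \<U>, of p] by blast
  define F where "F i = (\<lambda>U. {x \<in> topspace X. f x \<in> U}) ` G i" for i
  have fin: "f x \<in> topspace K" if "x \<in> topspace X" for x
    using cK(3) that continuous_map_image_subset_topspace by blast
  have F1: "pairwise disjnt (F i)" if "i < Suc n + p" for i
  proof -
    have "pairwise disjnt (G i)" using G that by (auto simp: coloured_cover_def)
    then show ?thesis unfolding F_def pairwise_def disjnt_def by blast
  qed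
  have F2: "openin X U" if iU: "i < Suc n + p" "U \<in> F i" for i U
  proof -
    obtain V where V: "V \<in> G i" "U = {x \<in> topspace X. f x \<in> V}" using iU by (auto simp: F_def)
    then have "openin K V" using G iU by (auto simp: coloured_cover_def)
    then show ?thesis unfolding V(2) by (rule openin_continuous_map_preimage[OF cK(3)])
  qed
  have F3: "d (\<Phi> r x) (\<Phi> r x') < \<epsilon>"
    if iU: "i < Suc n + p" "U \<in> F i" "x \<in> U" "x' \<in> U" "r \<in> {0..R}" for i U x x' r
  proof -
    obtain V where V: "V \<in> G i" "U = {x \<in> topspace X. f x \<in> V}" using iU by (auto simp: F_def)
    have "\<exists>W\<in>\<U>. V \<subseteq> W" using G iU(1) V(1) unfolding coloured_cover_def by blast
    then obtain W where "W \<in> \<U>" "V \<subseteq> W" by blast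
    then show ?thesis using V iU by (intro \<U>d[of W]) auto
  qed
  have F4: "Suc p \<le> card {i \<in> {..<Suc n + p}. x \<in> \<Union>(F i)}" if "x \<in> topspace X" for x
  proof -
    have "Suc p \<le> card {i \<in> {..<Suc n + p}. f x \<in> \<Union>(G i)}"
      using G fin[OF that] by (auto simp: coloured_cover_def)
    also have "{i \<in> {..<Suc n + p}. f x \<in> \<Union>(G i)} = {i \<in> {..<Suc n + p}. x \<in> \<Union>(F i)}"
      using that by (auto simp: F_def)
    finally show ?thesis .
  qed
  have "openin X (\<Union>(F i))" if "i \<in> {..<Suc n + p}" for i
    using F2 that by (intro openin_Union) auto
  from shrink_keeping_multiplicity[OF normal finite_lessThan this F4]
  obtain W where W: "\<And>i. i \<in> {..<Suc n + p} \<Longrightarrow> openin X (W i)"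
    "\<And>i. i \<in> {..<Suc n + p} \<Longrightarrow> X closure_of (W i) \<subseteq> \<Union>(F i)"
    "\<And>x. x \<in> topspace X \<Longrightarrow> Suc p \<le> card {i \<in> {..<Suc n + p}. x \<in> W i}"
    by blast
  show thesis
  proof (rule that[of F "\<lambda>i. X closure_of (W i)"])
    show "Suc p \<le> card {i \<in> {..<Suc n + p}. x \<in> X closure_of (W i)}" if "x \<in> topspace X" for x
    proof -
      have "W i \<subseteq> X closure_of (W i)" if "i < Suc n + p" for i
        using W(1)[of i] that by (intro closure_of_subset openin_subset) auto
      then have "card {i \<in> {..<Suc n + p}. x \<in> W i} \<le> card {i \<in> {..<Suc n + p}. x \<in> X closure_of (W i)}"
        by (intro card_mono) auto
      with W(3)[OF that] show ?thesis by linarith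
    qed
  qed (use F1 F2 F3 W in auto)
qed

end

lemma injective_perturbation:
  fixes f :: "'b \<Rightarrow> real"
  assumes "finite S" "\<gamma> > 0"
  shows "\<exists>c. inj_on c S \<and> (\<forall>s\<in>S. \<bar>c s - f s\<bar> < \<gamma>)"
  using assms(1)
proof (induction S)
  case (insert s S)
  then obtain c where c: "inj_on c S" "\<forall>s\<in>S. \<bar>c s - f s\<bar> < \<gamma>" by blast
  have "infinite {f s - \<gamma><..<f s + \<gamma>}" using assms(2) by (intro infinite_Ioo) simp
  then have "infinite ({f s - \<gamma><..<f s + \<gamma>} - c ` S)"
    using insert.hyps(1) by (simp add: Diff_infinite_finite)
  then obtain v where v: "v \<in> {f s - \<gamma><..<f s + \<gamma>} - c ` S" using infinite_imp_nonempty by blast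
  have "inj_on (c(s := v)) (insert s S)"
    using c(1) v insert.hyps(2) by (auto simp: inj_on_def)
  moreover have "\<forall>t\<in>insert s S. \<bar>(c(s := v)) t - f t\<bar> < \<gamma>"
    using c(2) v by (auto simp: abs_less_iff)
  ultimately show ?case by blast
qed auto

lemma injective_on_finite_gap:
  fixes c :: "'b \<Rightarrow> real"
  assumes "finite S" "inj_on c S"
  obtains \<theta> where "\<theta> > 0" "\<And>s t. s \<in> S \<Longrightarrow> t \<in> S \<Longrightarrow> \<bar>c s - c t\<bar> \<le> \<theta> \<Longrightarrow> s = t"
proof -
  define D where "D = insert 1 ((\<lambda>(s, t). \<bar>c s - c t\<bar>) ` {(s, t) \<in> S \<times> S. s \<noteq> t})"
  have "finite {(s, t) \<in> S \<times> S. s \<noteq> t}"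
    by (rule finite_subset[of _ "S \<times> S"]) (use assms in auto)
  then have D: "finite D" "D \<noteq> {}" by (auto simp: D_def)
  have "\<forall>v\<in>D. v > 0" using assms(2) by (auto simp: D_def inj_on_def)
  then have pos: "Min D > 0" using D by simp
  show thesis
  proof (rule that[of "Min D / 2"])
    show "Min D / 2 > 0" using pos by simp
    fix s t assume st: "s \<in> S" "t \<in> S" "\<bar>c s - c t\<bar> \<le> Min D / 2"
    show "s = t"
    proof (rule ccontr)
      assume "s \<noteq> t"
      then have "\<bar>c s - c t\<bar> \<in> D" using st by (auto simp: D_def)
      then have "Min D \<le> \<bar>c s - c t\<bar>" using D by simp
      with st pos show False by simp
    qed
  qed
qed

text \<open>
  Sets of one colour are disjoint, and \<open>g\<close> varies by less than \<open>\<gamma>\<close> on each, so a small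
  change makes \<open>g\<close> constant on every piece of \<open>A\<close>, with different constants on different
  pieces.  Tietze's theorem extends the change to \<open>X\<close>.
\<close>

lemma colour_separating_correction:
  fixes g :: "'a \<Rightarrow> real"
  assumes X: "compact_space X" "normal_space X" and g: "continuous_map X euclideanreal g"
    and A: "closedin X A" "A \<subseteq> \<Union>F" and F: "pairwise disjnt F" "\<And>U. U \<in> F \<Longrightarrow> openin X U"
    and small: "\<And>U x y. U \<in> F \<Longrightarrow> x \<in> U \<Longrightarrow> y \<in> U \<Longrightarrow> \<bar>g x - g y\<bar> < \<gamma>" and \<gamma>: "\<gamma> > 0"
  shows "\<exists>u \<theta>. continuous_map X euclideanreal u \<and> (\<forall>x\<in>topspace X. \<bar>u x\<bar> \<le> 2 * \<gamma>) \<and> \<theta> > 0 \<and>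
    (\<forall>x\<in>A. \<forall>y\<in>A. \<bar>(g x + u x) - (g y + u y)\<bar> \<le> \<theta> \<longrightarrow> (\<exists>U\<in>F. x \<in> U \<and> y \<in> U))"
proof -
  have "compactin X A" using A(1) X(1) closedin_compact_space by blast
  then obtain F0 where F0: "finite F0" "F0 \<subseteq> F" "A \<subseteq> \<Union>F0"
    using A(2) F(2) unfolding compactin_def by meson
  define p where "p U = (SOME x. x \<in> U)" for U :: "'a set"
  obtain c where c: "inj_on c F0" "\<forall>U\<in>F0. \<bar>c U - g (p U)\<bar> < \<gamma>"
    using injective_perturbation[OF F0(1) \<gamma>, of "\<lambda>U. g (p U)"] by blast
  obtain \<theta> where \<theta>: "\<theta> > 0" "\<And>U V. U \<in> F0 \<Longrightarrow> V \<in> F0 \<Longrightarrow> \<bar>c U - c V\<bar> \<le> \<theta> \<Longrightarrow> U = V"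
    using injective_on_finite_gap[OF F0(1) c(1)] by blast
  define m where "m x = (THE U. U \<in> F0 \<and> x \<in> U)" for x
  have m: "m x = U" if "U \<in> F0" "x \<in> U" for x U
    unfolding m_def
  proof (rule the_equality)
    fix V assume "V \<in> F0 \<and> x \<in> V"
    then show "V = U" using that F0(2) F(1) by (auto simp: pairwise_def disjnt_def)
  qed (use that in auto)
  have mA: "m x \<in> F0" "x \<in> m x" if "x \<in> A" for x
    using that F0(3) m by auto
  have AX: "A \<subseteq> topspace X" using A(1) by (rule closedin_subset)
  have contc: "continuous_map (subtopology X A) euclideanreal (\<lambda>x. c (m x))"
    unfolding continuous_map_def
  proof (intro conjI allI impI)
    fix T :: "real set" assume "openin euclideanreal T"
    have "{x \<in> topspace (subtopology X A). c (m x) \<in> T} = A \<inter> \<Union>{U \<in> F0. c U \<in> T}"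
      using mA m AX by auto
    moreover have "openin X (\<Union>{U \<in> F0. c U \<in> T})" using F F0 by (intro openin_Union) auto
    ultimately show "openin (subtopology X A) {x \<in> topspace (subtopology X A). c (m x) \<in> T}"
      by (auto simp: openin_subtopology Int_commute)
  qed auto
  have "continuous_map (subtopology X A) euclideanreal (\<lambda>x. c (m x) - g x)"
    using contc continuous_map_from_subtopology[OF g] by (rule continuous_map_diff)
  moreover have "(\<lambda>x. c (m x) - g x) ` A \<subseteq> {-(2 * \<gamma>)..2 * \<gamma>}"
  proof safe
    fix x assume x: "x \<in> A"
    have "p (m x) \<in> m x" unfolding p_def using mA[OF x] by (metis someI)
    then have "\<bar>g (p (m x)) - g x\<bar> < \<gamma>" using mA[OF x] F0 by (intro small) auto
    moreover have "\<bar>c (m x) - g (p (m x))\<bar> < \<gamma>" using c mA[OF x] by auto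
    ultimately show "c (m x) - g x \<in> {-(2 * \<gamma>)..2 * \<gamma>}" by (auto simp: abs_less_iff)
  qed
  ultimately obtain u where u: "continuous_map X euclideanreal u" "\<And>x. x \<in> A \<Longrightarrow> u x = c (m x) - g x"
    "u ` topspace X \<subseteq> {-(2 * \<gamma>)..2 * \<gamma>}"
    using Tietze_extension_closed_real_interval[OF X(2) A(1), of "\<lambda>x. c (m x) - g x" "-(2 * \<gamma>)" "2 * \<gamma>"] \<gamma>
    by auto
  have "\<exists>U\<in>F. x \<in> U \<and> y \<in> U" if xy: "x \<in> A" "y \<in> A" "\<bar>(g x + u x) - (g y + u y)\<bar> \<le> \<theta>" for x y
  proof -
    have "\<bar>c (m x) - c (m y)\<bar> \<le> \<theta>" using xy u(2) by simp
    then have "m x = m y" using \<theta>(2) mA xy by blast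
    then show ?thesis using mA[OF xy(1)] mA[OF xy(2)] F0 by auto
  qed
  moreover have "\<forall>x\<in>topspace X. \<bar>u x\<bar> \<le> 2 * \<gamma>" using u(3) by (auto simp: image_subset_iff abs_le_iff)
  ultimately show ?thesis using u(1) \<theta>(1) by blast
qed

section \<open>The sinc function and its Fourier transform\<close>

definition sinc :: "real \<Rightarrow> real" where
  "sinc x = (if x = 0 then 1 else sin x / x)"

lemma sinc_zero [simp]: "sinc 0 = 1"
  by (simp add: sinc_def)

lemma sinc_minus [simp]: "sinc (- x) = sinc x"
  by (simp add: sinc_def)

lemma mult_sinc: "x * sinc x = sin x"
  by (simp add: sinc_def)

lemma abs_sinc_le_one: "\<bar>sinc x\<bar> \<le> 1"
  using abs_sin_x_le_abs_x[of x] by (auto simp: sinc_def divide_simps abs_if split: if_splits)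

lemma isCont_sinc: "isCont sinc x"
proof (cases "x = 0")
  case True
  have "((\<lambda>x. sin x / x :: real) \<longlongrightarrow> 1) (at 0)"
    using DERIV_sin[of "0::real"] by (simp add: has_field_derivative_iff)
  then have "(sinc \<longlongrightarrow> 1) (at 0)"
    by (rule Lim_transform_eventually) (auto simp: sinc_def eventually_at_filter)
  with True show ?thesis by (simp add: isCont_def)
next
  case False
  have "isCont (\<lambda>x. sin x / x) x" using False by (intro continuous_intros) auto
  moreover have "\<forall>\<^sub>F y in nhds x. sinc y = sin y / y"
    using t1_space_nhds[OF False] by eventually_elim (simp add: sinc_def)
  ultimately show ?thesis using isCont_cong by metis
qed

lemma continuous_on_sinc [continuous_intros]:
  "continuous_on S f \<Longrightarrow> continuous_on S (\<lambda>x. sinc (f x))"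
  using continuous_on_compose2[of UNIV sinc S f] isCont_sinc
  by (auto simp: continuous_on_eq_continuous_at)

lemma borel_measurable_sinc [measurable]: "sinc \<in> borel_measurable borel"
  by (intro borel_measurable_continuous_onI continuous_intros)

lemma sinc_squared_le:
  assumes "\<delta> > 0"
  shows "(sinc (\<delta> * t))\<^sup>2 \<le> (1 + 1 / \<delta>\<^sup>2) / (1 + t\<^sup>2)"
proof -
  have "(\<delta> * t * sinc (\<delta> * t))\<^sup>2 \<le> 1"
    using mult_sinc[of "\<delta> * t"] by (simp add: abs_square_le_1)
  then have "t\<^sup>2 * (sinc (\<delta> * t))\<^sup>2 \<le> 1 / \<delta>\<^sup>2"
    using assms by (simp add: power_mult_distrib field_simps)
  moreover have "(sinc (\<delta> * t))\<^sup>2 \<le> 1"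
    using abs_sinc_le_one by (simp add: abs_square_le_1)
  ultimately have "(sinc (\<delta> * t))\<^sup>2 * (1 + t\<^sup>2) \<le> 1 + 1 / \<delta>\<^sup>2"
    by (simp add: algebra_simps)
  moreover have "1 + t\<^sup>2 > 0" by (simp add: add_pos_nonneg)
  ultimately show ?thesis by (simp add: pos_le_divide_eq)
qed

lemma integrable_inverse_one_plus_square: "integrable lborel (\<lambda>x::real. 1 / (1 + x\<^sup>2))"
proof -
  define f where "f x = 1 / (1 + x\<^sup>2)" for x :: real
  have nn: "(\<integral>\<^sup>+x. ennreal (f x) * indicator {0..} x \<partial>lborel) = pi / 2 - arctan 0"
  proof (rule nn_integral_FTC_atLeast)
    show "(arctan \<longlongrightarrow> pi / 2) at_top" by (rule tendsto_arctan_at_top)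
    show "f \<in> borel_measurable borel" unfolding f_def by measurable
    show "DERIV arctan x :> f x" for x
      using DERIV_arctan[of x] by (simp add: f_def inverse_eq_divide)
    show "0 \<le> f x" for x unfolding f_def by (simp add: add_pos_nonneg less_imp_le)
  qed
  have "integrable lborel (\<lambda>x. f x * indicator {0..} x)"
  proof (rule integrableI_nonneg)
    show "(\<integral>\<^sup>+x. ennreal (f x * indicator {0..} x) \<partial>lborel) < \<infinity>"
    proof -
      have "ennreal (f x * indicator {0..} x) = ennreal (f x) * indicator {0..} x" for x
        by (simp add: indicator_def)
      then show ?thesis using nn by simp
    qed
    show "AE x in lborel. 0 \<le> f x * indicator {0..} x" by (simp add: f_def indicator_def add_pos_nonneg less_imp_le)
  qed (simp add: f_def)
  from this lborel_integrable_real_affine[OF this, of "-1" 0]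
  have "integrable lborel (\<lambda>x. f x * indicator {0..} x + f (0 + -1 * x) * indicator {0..} (0 + -1 * x))"
    by (intro Bochner_Integration.integrable_add) auto
  then show ?thesis
  proof (rule Bochner_Integration.integrable_bound)
    show "AE x in lborel. norm (1 / (1 + x\<^sup>2)) \<le>
        norm (f x * indicator {0..} x + f (0 + -1 * x) * indicator {0..} (0 + -1 * x))"
      by (auto simp: f_def indicator_def add_pos_nonneg less_imp_le)
  qed simp
qed

lemma integrable_sinc_squared:
  assumes "\<delta> > 0"
  shows "integrable lborel (\<lambda>t. (sinc (\<delta> * t))\<^sup>2)"
proof (rule Bochner_Integration.integrable_bound)
  show "integrable lborel (\<lambda>t. (1 + 1 / \<delta>\<^sup>2) * (1 / (1 + t\<^sup>2)))"
    by (intro integrable_mult_right integrable_inverse_one_plus_square)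
  show "AE t in lborel. norm ((sinc (\<delta> * t))\<^sup>2) \<le> norm ((1 + 1 / \<delta>\<^sup>2) * (1 / (1 + t\<^sup>2)))"
  proof (rule AE_I2)
    fix t :: real
    have "(sinc (\<delta> * t))\<^sup>2 \<le> (1 + 1 / \<delta>\<^sup>2) * (1 / (1 + t\<^sup>2))"
      using sinc_squared_le[OF assms, of t] by simp
    then show "norm ((sinc (\<delta> * t))\<^sup>2) \<le> norm ((1 + 1 / \<delta>\<^sup>2) * (1 / (1 + t\<^sup>2)))" by simp
  qed
qed simp

definition ft :: "(real \<Rightarrow> complex) \<Rightarrow> real \<Rightarrow> complex" where
  "ft w \<omega> = (LINT t|lborel. w t * cis (- (\<omega> * t)))"

definition spectrum_in :: "real \<Rightarrow> real \<Rightarrow> (real \<Rightarrow> complex) \<Rightarrow> bool" where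
  "spectrum_in a b w \<longleftrightarrow> integrable lborel w \<and> (\<forall>\<omega>. \<omega> < a \<or> b < \<omega> \<longrightarrow> ft w \<omega> = 0)"

lemma borel_measurable_cis [measurable]: "cis \<in> borel_measurable borel"
  by (intro borel_measurable_continuous_onI continuous_intros)

lemma integrable_mult_bounded:
  fixes f h :: "real \<Rightarrow> complex"
  assumes "integrable lborel f" "h \<in> borel_measurable borel" "\<And>x. norm (h x) \<le> B"
  shows "integrable lborel (\<lambda>x. f x * h x)"
proof (rule Bochner_Integration.integrable_bound)
  show "integrable lborel (\<lambda>x. B * norm (f x))" using assms(1) by simp
  have [measurable]: "f \<in> borel_measurable borel" using assms(1) by auto
  show "(\<lambda>x. f x * h x) \<in> borel_measurable lborel" using assms(2) by simp
  have "norm (f x * h x) \<le> B * norm (f x)" for x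
    using mult_left_mono[OF assms(3)[of x], of "norm (f x)"] by (simp add: norm_mult mult.commute)
  moreover have "0 \<le> B" using assms(3)[of 0] norm_ge_zero order_trans by blast
  ultimately show "AE x in lborel. norm (f x * h x) \<le> norm (B * norm (f x))" by simp
qed

lemma swap_kernel_integrals:
  fixes f g :: "real \<Rightarrow> complex" and h :: "real \<Rightarrow> real \<Rightarrow> complex"
  assumes f: "integrable lborel f" and g: "integrable lborel g"
    and h[measurable]: "(\<lambda>(x, y). h x y) \<in> borel_measurable (borel \<Otimes>\<^sub>M borel)" and h1: "\<And>x y. norm (h x y) \<le> 1"
  shows "(LINT x|lborel. f x * (LINT y|lborel. g y * h x y)) = (LINT y|lborel. g y * (LINT x|lborel. f x * h x y))"
proof -
  have [measurable]: "f \<in> borel_measurable borel" "g \<in> borel_measurable borel" using f g by auto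
  have hx[measurable]: "(\<lambda>y. h x y) \<in> borel_measurable borel" for x by measurable
  have hy[measurable]: "(\<lambda>x. h x y) \<in> borel_measurable borel" for y by measurable
  have int: "integrable (lborel \<Otimes>\<^sub>M lborel) (\<lambda>(x, y). f x * (g y * h x y))"
  proof (rule lborel_pair.Fubini_integrable)
    show "(\<lambda>(x, y). f x * (g y * h x y)) \<in> borel_measurable (lborel \<Otimes>\<^sub>M lborel)" by measurable
    have gh: "integrable lborel (\<lambda>y. norm (g y * h x y))" for x
      using integrable_mult_bounded[OF g hx h1] by (rule integrable_norm)
    show "integrable lborel (\<lambda>x. LINT y|lborel. norm (case (x, y) of (x, y) \<Rightarrow> f x * (g y * h x y)))"
    proof (rule Bochner_Integration.integrable_bound)
      show "integrable lborel (\<lambda>x. (LINT y|lborel. norm (g y)) * norm (f x))" using f by simp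
      show "(\<lambda>x. LINT y|lborel. norm (case (x, y) of (x, y) \<Rightarrow> f x * (g y * h x y))) \<in> borel_measurable lborel"
        by measurable
      show "AE x in lborel. norm (LINT y|lborel. norm (case (x, y) of (x, y) \<Rightarrow> f x * (g y * h x y)))
              \<le> norm ((LINT y|lborel. norm (g y)) * norm (f x))"
      proof (rule AE_I2)
        fix x
        have "(LINT y|lborel. norm (f x) * norm (g y * h x y)) = norm (f x) * (LINT y|lborel. norm (g y * h x y))"
          by simp
        also have "(LINT y|lborel. norm (g y * h x y)) \<le> (LINT y|lborel. norm (g y))"
          using gh g h1 by (intro integral_mono) (auto simp: norm_mult mult_left_le)
        finally have "(LINT y|lborel. norm (f x) * norm (g y * h x y)) \<le> norm (f x) * (LINT y|lborel. norm (g y))"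
          by (simp add: mult_left_mono)
        moreover have "0 \<le> (LINT y|lborel. norm (f x) * norm (g y * h x y))" by (intro integral_nonneg_AE) auto
        moreover have "0 \<le> (LINT y|lborel. norm (g y))" by (intro integral_nonneg_AE) auto
        ultimately show "norm (LINT y|lborel. norm (case (x, y) of (x, y) \<Rightarrow> f x * (g y * h x y)))
              \<le> norm ((LINT y|lborel. norm (g y)) * norm (f x))"
          by (simp add: norm_mult abs_mult mult.commute)
      qed
    qed
    show "AE x in lborel. integrable lborel (\<lambda>y. case (x, y) of (x, y) \<Rightarrow> f x * (g y * h x y))"
      using integrable_mult_bounded[OF g hx h1] by (intro AE_I2) simp
  qed
  have "(LINT x|lborel. f x * (LINT y|lborel. g y * h x y)) = (LINT x|lborel. LINT y|lborel. f x * (g y * h x y))"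
    by simp
  also have "\<dots> = (LINT y|lborel. LINT x|lborel. f x * (g y * h x y))"
    by (rule lborel_pair.Fubini_integral[symmetric, OF int])
  also have "\<dots> = (LINT y|lborel. LINT x|lborel. g y * (f x * h x y))"
    by (simp add: mult.left_commute)
  also have "\<dots> = (LINT y|lborel. g y * (LINT x|lborel. f x * h x y))" by simp
  finally show ?thesis .
qed

lemma sinc_average: "complex_of_real (sinc x) = (LINT u|lborel. complex_of_real (indicator {-1..1} u / 2) * cis (u * x))"
proof (cases "x = 0")
  case True
  have "(LINT (u::real)|lborel. complex_of_real (indicator {-1..1} u / 2)) =
      complex_of_real (LINT (u::real)|lborel. indicator {-1..1} u / 2)"
    by (rule integral_complex_of_real)
  then show ?thesis using True by simp
next
  case False
  define F where "F u = cis (u * x) / (\<i> * of_real x) / 2" for u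
  have "(LINT u|lborel. indicator {-1..1} u *\<^sub>R (cis (u * x) / 2)) = F 1 - F (-1)"
  proof (rule integral_FTC_Icc)
    show "(F has_vector_derivative cis (u * x) / 2) (at u within {-1..1})" for u
      unfolding F_def has_vector_derivative_def using False
      by (auto intro!: derivative_eq_intros simp: fun_eq_iff field_simps scaleR_conv_of_real)
  qed (auto intro!: continuous_intros)
  also have "\<dots> = complex_of_real (sinc x)"
    using False by (auto simp: F_def sinc_def complex_eq_iff field_simps Re_divide Im_divide power2_eq_square)
  finally show ?thesis
    by (simp add: scaleR_conv_of_real)
qed

lemma integrable_half_indicator: "integrable lborel (\<lambda>u::real. complex_of_real (indicator {-1..1} u / 2))"
  by (intro integrable_of_real integrable_divide_zero) (auto simp: integrable_indicator_iff)

text \<open>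
  A sinc is an average of waves with frequencies between \<open>- \<alpha>\<close> and \<open>\<alpha>\<close>; multiplying by
  one such wave shifts the spectrum by its frequency.
\<close>

lemma spectrum_in_mult_sinc:
  assumes w: "spectrum_in a b w" and \<alpha>: "0 \<le> \<alpha>"
  shows "spectrum_in (a - \<alpha>) (b + \<alpha>) (\<lambda>t. w t * complex_of_real (sinc (\<alpha> * (t - s))))"
proof -
  have iw: "integrable lborel w" using w by (simp add: spectrum_in_def)
  have [measurable]: "w \<in> borel_measurable borel" using iw by auto
  have "integrable lborel (\<lambda>t. w t * complex_of_real (sinc (\<alpha> * (t - s))))"
    using abs_sinc_le_one by (intro integrable_mult_bounded[OF iw, where B = 1]) auto
  moreover have "ft (\<lambda>t. w t * complex_of_real (sinc (\<alpha> * (t - s)))) \<omega> = 0"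
    if \<omega>: "\<omega> < a - \<alpha> \<or> b + \<alpha> < \<omega>" for \<omega>
  proof -
    define f where "f u = complex_of_real (indicator {-1..1} u / 2)" for u :: real
    define g where "g t = w t * cis (- (\<omega> * t))" for t
    define h where "h u t = cis (u * (\<alpha> * (t - s)))" for u t
    have "ft (\<lambda>t. w t * complex_of_real (sinc (\<alpha> * (t - s)))) \<omega> = (LINT t|lborel. g t * (LINT u|lborel. f u * h u t))"
      unfolding ft_def g_def f_def h_def sinc_average by (simp add: mult_ac)
    also have "\<dots> = (LINT u|lborel. f u * (LINT t|lborel. g t * h u t))"
    proof (rule swap_kernel_integrals[symmetric])
      show "integrable lborel f" unfolding f_def by (rule integrable_half_indicator)
      show "integrable lborel g" unfolding g_def
        by (intro integrable_mult_bounded[OF iw, where B = 1]) auto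
      show "(\<lambda>(u, t). h u t) \<in> borel_measurable (borel \<Otimes>\<^sub>M borel)" unfolding h_def by measurable
    qed (simp add: h_def)
    also have "\<dots> = (LINT u|(lborel::real measure). 0)"
    proof (rule Bochner_Integration.integral_cong)
      fix u :: real
      show "f u * (LINT t|lborel. g t * h u t) = 0"
      proof (cases "u \<in> {-1..1}")
        case True
        then have "\<bar>u * \<alpha>\<bar> \<le> \<alpha>" using \<alpha> by (simp add: abs_mult abs_le_iff mult_left_le_one_le)
        then have "ft w (\<omega> - u * \<alpha>) = 0" using w \<omega> by (auto simp: spectrum_in_def abs_le_iff)
        moreover have "g t * h u t = cis (- (u * \<alpha> * s)) * (w t * cis (- ((\<omega> - u * \<alpha>) * t)))" for t
          by (simp add: g_def h_def mult_ac cis_mult algebra_simps)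
        then have "(LINT t|lborel. g t * h u t) = cis (- (u * \<alpha> * s)) * ft w (\<omega> - u * \<alpha>)"
          by (simp add: ft_def)
        ultimately show ?thesis by simp
      qed (simp add: f_def)
    qed simp
    finally show ?thesis by simp
  qed
  ultimately show ?thesis by (simp add: spectrum_in_def)
qed

lemma spectrum_in_modulate:
  assumes w: "spectrum_in a b w"
  shows "spectrum_in (a + \<mu>) (b + \<mu>) (\<lambda>t. w t * cis (\<mu> * t))"
proof -
  have iw: "integrable lborel w" using w by (simp add: spectrum_in_def)
  have "integrable lborel (\<lambda>t. w t * cis (\<mu> * t))"
    by (intro integrable_mult_bounded[OF iw, where B = 1]) auto
  moreover have "ft (\<lambda>t. w t * cis (\<mu> * t)) \<omega> = ft w (\<omega> - \<mu>)" for \<omega>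
    unfolding ft_def by (simp add: mult.assoc cis_mult algebra_simps)
  ultimately show ?thesis using w by (auto simp: spectrum_in_def)
qed

lemma spectrum_in_translate:
  assumes w: "spectrum_in a b w"
  shows "spectrum_in a b (\<lambda>t. w (t - s))"
proof -
  have iw: "integrable lborel w" using w by (simp add: spectrum_in_def)
  have "integrable lborel (\<lambda>t. w (t - s))"
    using lborel_integrable_real_affine[OF iw, of 1 "-s"] by simp
  moreover have "ft (\<lambda>t. w (t - s)) \<omega> = cis (- (\<omega> * s)) * ft w \<omega>" for \<omega>
  proof -
    have "ft (\<lambda>t. w (t - s)) \<omega> = (LINT t|lborel. w t * cis (- (\<omega> * (s + t))))"
      unfolding ft_def by (subst lborel_integral_real_affine[of 1 _ s]) auto
    also have "\<dots> = (LINT t|lborel. cis (- (\<omega> * s)) * (w t * cis (- (\<omega> * t))))"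
      by (simp add: mult.left_commute cis_mult algebra_simps)
    finally show ?thesis by (simp add: ft_def)
  qed
  ultimately show ?thesis using w by (auto simp: spectrum_in_def)
qed

definition sinc_energy :: real where
  "sinc_energy = (LINT t|lborel. (sinc t)\<^sup>2)"

lemma sinc_energy_pos: "sinc_energy > 0"
proof -
  have int: "integrable lborel (\<lambda>t. (sinc t)\<^sup>2)"
    using integrable_sinc_squared[of 1] by simp
  have "sinc_energy \<ge> 0" unfolding sinc_energy_def by (rule integral_nonneg_AE) simp
  moreover have "sinc_energy \<noteq> 0"
  proof
    assume "sinc_energy = 0"
    then have "AE t in lborel. (sinc t)\<^sup>2 = 0"
      using integral_nonneg_eq_0_iff_AE[OF int] by (simp add: sinc_energy_def)
    then have "AE t in lborel. t \<notin> {0<..<1::real}"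
    proof eventually_elim
      case (elim t)
      show ?case
      proof
        assume t: "t \<in> {0<..<1}"
        then have "sin t > 0" using pi_gt3 by (intro sin_gt_zero) auto
        with elim t show False by (simp add: sinc_def)
      qed
    qed
    then have "emeasure lborel {0<..<1::real} = 0"
      by (subst (asm) AE_iff_measurable[of "{0<..<1}"]) auto
    then show False by simp
  qed
  ultimately show ?thesis by simp
qed

lemma integral_sinc_squared_scaled: "(LINT t|lborel. c\<^sup>2 * (sinc (c * t))\<^sup>2) = \<bar>c\<bar> * sinc_energy"
proof (cases "c = 0")
  case False
  have "sinc_energy = \<bar>c\<bar> *\<^sub>R (LINT t|lborel. (sinc (0 + c * t))\<^sup>2)"
    unfolding sinc_energy_def by (rule lborel_integral_real_affine[OF False])
  then have E: "sinc_energy = \<bar>c\<bar> * (LINT t|lborel. (sinc (c * t))\<^sup>2)" by simp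
  have "\<bar>c\<bar> * (\<bar>c\<bar> * I) = c\<^sup>2 * I" for I :: real
    by (simp add: power2_eq_square flip: mult.assoc)
  then show ?thesis unfolding E by (simp add: power2_eq_square)
qed simp

lemma integrable_scaled_sinc_squared: "integrable lborel (\<lambda>t. c\<^sup>2 * (sinc (c * t))\<^sup>2)"
proof (cases "c = 0")
  case False
  then have "integrable lborel (\<lambda>t. (sinc (\<bar>c\<bar> * t))\<^sup>2)" by (intro integrable_sinc_squared) auto
  moreover have "(sinc (\<bar>c\<bar> * t))\<^sup>2 = (sinc (c * t))\<^sup>2" for t by (cases "c \<ge> 0") auto
  ultimately show ?thesis by simp
qed simp

text \<open>
  By scaling, \<open>c\<^sup>2 (sinc (c t))\<^sup>2\<close> has integral \<open>\<bar>c\<bar>\<close> times a constant, and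
  \<open>(sinc (\<delta> t))\<^sup>2 cos (\<omega> t)\<close> is a combination of three functions of this form.  The transform
  thus comes out as a second difference of the absolute value: a hat function.
\<close>

lemma ft_sinc_squared:
  assumes \<delta>: "\<delta> > 0"
  shows "ft (\<lambda>t. complex_of_real ((sinc (\<delta> * t))\<^sup>2)) \<omega> =
    complex_of_real (sinc_energy / (2 * \<delta>\<^sup>2) * (\<bar>\<omega> / 2 + \<delta>\<bar> + \<bar>\<omega> / 2 - \<delta>\<bar> - \<bar>\<omega>\<bar>))"
proof -
  define p q where "p = \<omega> / 2 + \<delta>" and "q = \<omega> / 2 - \<delta>"
  define v where "v t = (sinc (\<delta> * t))\<^sup>2" for t
  have v: "integrable lborel v" using integrable_sinc_squared[OF \<delta>] by (simp add: v_def[abs_def])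
  have [measurable]: "v \<in> borel_measurable borel" using v by auto
  have ic: "integrable lborel (\<lambda>t. v t * cos (\<omega> * t))" and isn: "integrable lborel (\<lambda>t. v t * sin (\<omega> * t))"
    by (rule Bochner_Integration.integrable_bound[OF v], simp, simp add: abs_mult mult_left_le v_def)+
  have sq: "c\<^sup>2 * (sinc (c * t))\<^sup>2 * t\<^sup>2 = (sin (c * t))\<^sup>2" for c t
    using mult_sinc[of "c * t"] by (simp add: power_mult_distrib[symmetric] mult_ac)
  have eq: "v t * cos (\<omega> * t) =
      1 / (2 * \<delta>\<^sup>2) * (p\<^sup>2 * (sinc (p * t))\<^sup>2 + q\<^sup>2 * (sinc (q * t))\<^sup>2 - 2 * ((\<omega> / 2)\<^sup>2 * (sinc (\<omega> / 2 * t))\<^sup>2))" for t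
  proof (cases "t = 0")
    case True
    then show ?thesis using \<delta> by (simp add: v_def p_def q_def field_simps power2_eq_square)
  next
    case False
    have s2: "(sin y)\<^sup>2 = (1 - cos (2 * y)) / 2" for y :: real using cos_double_sin[of y] by simp
    have "2 * ((sin (\<delta> * t))\<^sup>2 * cos (\<omega> * t)) = (sin (p * t))\<^sup>2 + (sin (q * t))\<^sup>2 - 2 * (sin (\<omega> / 2 * t))\<^sup>2"
    proof -
      have "cos (2 * (p * t)) = cos (\<omega> * t + 2 * \<delta> * t)" "cos (2 * (q * t)) = cos (\<omega> * t - 2 * \<delta> * t)"
        by (simp_all add: p_def q_def algebra_simps)
      then have "cos (2 * (p * t)) + cos (2 * (q * t)) = 2 * cos (\<omega> * t) * cos (2 * (\<delta> * t))"
        by (simp add: cos_add cos_diff mult.assoc)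
      moreover have "2 * ((1 - D) / 2 * W) = (1 - P) / 2 + (1 - Q) / 2 - 2 * ((1 - W) / 2)"
        if "P + Q = 2 * W * D" for P Q W D :: real
        using that by (simp add: field_simps)
      moreover have "2 * (\<omega> / 2 * t) = \<omega> * t" by simp
      ultimately show ?thesis unfolding s2 by metis
    qed
    then have "2 * \<delta>\<^sup>2 * (v t * cos (\<omega> * t)) * t\<^sup>2 =
      (p\<^sup>2 * (sinc (p * t))\<^sup>2 + q\<^sup>2 * (sinc (q * t))\<^sup>2 - 2 * ((\<omega> / 2)\<^sup>2 * (sinc (\<omega> / 2 * t))\<^sup>2)) * t\<^sup>2"
      using sq[of \<delta> t] sq[of p t] sq[of q t] sq[of "\<omega> / 2" t] unfolding v_def
      by (simp add: algebra_simps)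
    then have "2 * \<delta>\<^sup>2 * (v t * cos (\<omega> * t)) =
      p\<^sup>2 * (sinc (p * t))\<^sup>2 + q\<^sup>2 * (sinc (q * t))\<^sup>2 - 2 * ((\<omega> / 2)\<^sup>2 * (sinc (\<omega> / 2 * t))\<^sup>2)"
      using False by (metis mult_right_cancel power_not_zero)
    then show ?thesis using \<delta> by (simp add: field_simps)
  qed
  have "(LINT t|lborel. v t * cos (\<omega> * t)) =
      1 / (2 * \<delta>\<^sup>2) * (\<bar>p\<bar> * sinc_energy + \<bar>q\<bar> * sinc_energy - 2 * (\<bar>\<omega> / 2\<bar> * sinc_energy))"
    unfolding eq integral_mult_right_zero
    by (subst Bochner_Integration.integral_diff, intro Bochner_Integration.integrable_add integrable_scaled_sinc_squared,
        intro integrable_mult_right integrable_scaled_sinc_squared,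
        subst Bochner_Integration.integral_add, (intro integrable_scaled_sinc_squared)+)
       (simp only: integral_mult_right_zero integral_sinc_squared_scaled[unfolded integral_mult_right_zero])
  also have "\<dots> = sinc_energy / (2 * \<delta>\<^sup>2) * (\<bar>p\<bar> + \<bar>q\<bar> - \<bar>\<omega>\<bar>)" by (simp add: field_simps)
  finally have C: "(LINT t|lborel. v t * cos (\<omega> * t)) = sinc_energy / (2 * \<delta>\<^sup>2) * (\<bar>p\<bar> + \<bar>q\<bar> - \<bar>\<omega>\<bar>)" .
  have "(LINT t|lborel. v t * sin (\<omega> * t)) = (LINT t|lborel. v (0 + -1 * t) * sin (\<omega> * (0 + -1 * t)))"
    by (subst lborel_integral_real_affine[of "-1" _ 0]) auto
  also have "\<dots> = - (LINT t|lborel. v t * sin (\<omega> * t))" by (simp add: v_def)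
  finally have S: "(LINT t|lborel. v t * sin (\<omega> * t)) = 0" by simp
  have "complex_of_real (v t) * cis (- (\<omega> * t)) =
      complex_of_real (v t * cos (\<omega> * t)) - \<i> * complex_of_real (v t * sin (\<omega> * t))" for t
    by (simp add: complex_eq_iff)
  then have "ft (\<lambda>t. complex_of_real (v t)) \<omega> = (LINT t|lborel. complex_of_real (v t * cos (\<omega> * t))
      - \<i> * complex_of_real (v t * sin (\<omega> * t)))" by (simp only: ft_def)
  also have "\<dots> = complex_of_real (LINT t|lborel. v t * cos (\<omega> * t)) - \<i> * complex_of_real (LINT t|lborel. v t * sin (\<omega> * t))"
    by (subst Bochner_Integration.integral_diff, intro integrable_of_real ic,
        intro integrable_mult_right integrable_of_real isn) (simp only: integral_mult_right_zero integral_complex_of_real)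
  finally show ?thesis unfolding C S by (simp add: v_def p_def q_def)
qed

lemma spectrum_in_sinc_squared:
  assumes \<delta>: "\<delta> > 0"
  shows "spectrum_in (- (2 * \<delta>)) (2 * \<delta>) (\<lambda>t. complex_of_real ((sinc (\<delta> * t))\<^sup>2))"
proof -
  have "\<bar>\<omega> / 2 + \<delta>\<bar> + \<bar>\<omega> / 2 - \<delta>\<bar> - \<bar>\<omega>\<bar> = 0" if "\<omega> < - (2 * \<delta>) \<or> 2 * \<delta> < \<omega>" for \<omega>
    using that \<delta> by (auto simp: abs_if)
  then show ?thesis unfolding spectrum_in_def ft_sinc_squared[OF \<delta>]
    using integrable_of_real[OF integrable_sinc_squared[OF \<delta>]] by fastforce
qed

lemma ft_norm_le:
  assumes "integrable lborel w"
  shows "norm (ft w \<omega>) \<le> (LINT t|lborel. norm (w t))"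
proof -
  have "norm (ft w \<omega>) \<le> (LINT t|lborel. norm (w t * cis (- (\<omega> * t))))"
    unfolding ft_def by (rule integral_norm_bound)
  then show ?thesis by (simp add: norm_mult)
qed

lemma compactly_supported_integrable:
  fixes f :: "real \<Rightarrow> complex"
  assumes "continuous_on UNIV f" "\<And>x. M < \<bar>x\<bar> \<Longrightarrow> f x = 0"
  shows "integrable lborel f"
proof -
  have "set_integrable lborel {-M..M} f"
    using assms(1) by (intro borel_integrable_atLeastAtMost') (auto intro: continuous_on_subset)
  moreover have "indicator {-M..M} x *\<^sub>R f x = f x" for x
    using assms(2)[of x] by (cases "x \<in> {-M..M}") (auto simp: abs_le_iff not_le)
  ultimately show ?thesis by (simp add: set_integrable_def)
qed

lemma ft_derivative:
  fixes f f' :: "real \<Rightarrow> complex"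
  assumes f: "\<And>x. (f has_vector_derivative f' x) (at x)" and f': "continuous_on UNIV f'"
    and M: "M > 0" "\<And>x. M \<le> \<bar>x\<bar> \<Longrightarrow> f x = 0" "\<And>x. M < \<bar>x\<bar> \<Longrightarrow> f' x = 0"
  shows "ft f' \<omega> = \<i> * of_real \<omega> * ft f \<omega>"
proof -
  have contf: "continuous_on UNIV f"
    using f by (meson continuous_on_vector_derivative has_vector_derivative_at_within)
  have intf: "integrable lborel f" "integrable lborel f'"
    using M contf f' by (auto intro!: compactly_supported_integrable[where M = M])
  have i1: "integrable lborel (\<lambda>x. f x * cis (- (\<omega> * x)))" "integrable lborel (\<lambda>x. f' x * cis (- (\<omega> * x)))"
    using intf by (auto intro!: integrable_mult_bounded[where B = 1])
  define F where "F x = f x * cis (- (\<omega> * x))" for x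
  define G where "G x = f' x * cis (- (\<omega> * x)) - \<i> * of_real \<omega> * (f x * cis (- (\<omega> * x)))" for x
  have "(LINT x|lborel. indicator {-M..M} x *\<^sub>R G x) = F M - F (-M)"
  proof (rule integral_FTC_Icc)
    have cis': "((\<lambda>x. cis (- (\<omega> * x))) has_vector_derivative - \<i> * of_real \<omega> * cis (- (\<omega> * x))) (at x within {-M..M})" for x
      unfolding has_vector_derivative_def
      by (auto intro!: derivative_eq_intros simp: fun_eq_iff scaleR_conv_of_real)
    show "(F has_vector_derivative G x) (at x within {-M..M})" for x
      using has_vector_derivative_mult[OF has_vector_derivative_at_within[OF f[of x]] cis'[of x]]
      unfolding F_def[abs_def] G_def by (simp add: algebra_simps)
    show "continuous_on {-M..M} G" unfolding G_def
      by (intro continuous_intros continuous_on_subset[OF contf] continuous_on_subset[OF f']) auto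
  qed (use M in auto)
  moreover have "indicator {-M..M} x *\<^sub>R G x = G x" for x
    using M(2,3)[of x] by (cases "x \<in> {-M..M}") (auto simp: G_def abs_le_iff not_le)
  moreover have "F M = 0" "F (-M) = 0" using M by (auto simp: F_def)
  ultimately have "(LINT x|lborel. G x) = 0" by simp
  moreover have "(LINT x|lborel. G x) = ft f' \<omega> - \<i> * of_real \<omega> * ft f \<omega>"
    unfolding G_def ft_def using i1
    by (subst Bochner_Integration.integral_diff) (auto simp del: of_real_mult)
  ultimately show ?thesis by simp
qed

lemma fourier_eq_ft: "fourier \<phi> \<xi> = ft \<phi> (2 * pi * \<xi>)"
proof -
  have "exp (- (2 * complex_of_real pi * \<i> * complex_of_real \<xi> * complex_of_real x)) = cis (- (2 * pi * \<xi> * x))" for x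
    unfolding cis_conv_exp by (simp add: mult_ac)
  then show ?thesis by (simp add: fourier_def ft_def)
qed

lemma test_function_zero_off:
  assumes "\<phi> \<in> test_functions_on U" "\<xi> \<notin> U"
  shows "\<phi> \<xi> = 0"
proof (rule ccontr)
  assume "\<phi> \<xi> \<noteq> 0"
  then have "\<xi> \<in> closure {x. \<phi> x \<noteq> 0}" using closure_subset[of "{x. \<phi> x \<noteq> 0}"] by auto
  then show False using assms unfolding test_functions_on_def by blast
qed

text \<open>
  Integrating by parts twice trades two derivatives for a factor \<open>\<omega>\<^sup>2\<close>.
\<close>

lemma test_function_bounds:
  assumes "\<phi> \<in> test_functions_on U"
  obtains B where "integrable lborel \<phi>" "\<And>\<omega>. norm (ft \<phi> \<omega>) \<le> B / (1 + \<omega>\<^sup>2)"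
proof -
  define f where "f n = nth_deriv n \<phi>" for n
  have f0: "f 0 = \<phi>" by (simp add: f_def nth_deriv_def)
  have fS: "f (Suc n) x = vector_derivative (f n) (at x)" for n x by (simp add: f_def nth_deriv_def)
  have "smooth \<phi>" using assms by (simp add: test_functions_on_def)
  have der: "(f n has_vector_derivative f (Suc n) x) (at x)" for n x
  proof -
    have "f n differentiable (at x)" using \<open>smooth \<phi>\<close> by (simp add: smooth_def f_def)
    then show ?thesis unfolding fS by (simp add: vector_derivative_works)
  qed
  have cont: "continuous_on UNIV (f n)" for n
    using der by (meson continuous_on_vector_derivative has_vector_derivative_at_within)
  have "compact (closure {x. \<phi> x \<noteq> 0})" using assms by (simp add: test_functions_on_def)
  then have "bounded {x. \<phi> x \<noteq> 0}" by (rule bounded_subset[OF compact_imp_bounded closure_subset])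
  then obtain M0 where M0: "\<And>x. \<phi> x \<noteq> 0 \<Longrightarrow> \<bar>x\<bar> \<le> M0" unfolding bounded_iff by auto
  define M where "M = \<bar>M0\<bar> + 1"
  have z: "f n x = 0" if "M0 < \<bar>x\<bar>" for n x
    using that
  proof (induction n arbitrary: x)
    case 0
    then show ?case using M0[of x] f0 by force
  next
    case (Suc n)
    have "open {y. M0 < \<bar>y\<bar>}" by (intro open_Collect_less continuous_intros)
    then have "((\<lambda>_. 0) has_vector_derivative f (Suc n) x) (at x)"
      using der[of n x] Suc by (rule_tac has_vector_derivative_transform_within_open[of "f n" _ _ "{y. M0 < \<bar>y\<bar>}"]) auto
    then show ?case using vector_derivative_unique_at[OF _ has_vector_derivative_const] by blast
  qed
  have int: "integrable lborel (f n)" for n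
    using cont z by (rule compactly_supported_integrable)
  have step: "ft (f (Suc n)) \<omega> = \<i> * of_real \<omega> * ft (f n) \<omega>" for n \<omega>
    by (rule ft_derivative[OF der cont, of M]) (auto simp: M_def intro!: z)
  define B where "B = (LINT t|lborel. norm (f 0 t)) + (LINT t|lborel. norm (f 2 t))"
  have "norm (ft \<phi> \<omega>) \<le> B / (1 + \<omega>\<^sup>2)" for \<omega>
  proof -
    have "ft (f 2) \<omega> = (\<i> * of_real \<omega>) * ((\<i> * of_real \<omega>) * ft (f 0) \<omega>)"
      using step[of 1 \<omega>] step[of 0 \<omega>] by (simp add: numeral_2_eq_2)
    then have "norm (ft (f 2) \<omega>) = \<omega>\<^sup>2 * norm (ft \<phi> \<omega>)"
      by (simp add: norm_mult f0 power2_eq_square)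
    moreover have "norm (ft (f 2) \<omega>) \<le> (LINT t|lborel. norm (f 2 t))" by (rule ft_norm_le[OF int])
    moreover have "norm (ft \<phi> \<omega>) \<le> (LINT t|lborel. norm (f 0 t))" using ft_norm_le[OF int, of 0] f0 by simp
    ultimately have "norm (ft \<phi> \<omega>) * (1 + \<omega>\<^sup>2) \<le> B" by (simp add: B_def algebra_simps)
    moreover have "1 + \<omega>\<^sup>2 > 0" by (simp add: add_pos_nonneg)
    ultimately show ?thesis by (simp add: pos_le_divide_eq)
  qed
  with int[of 0] f0 show thesis using that by metis
qed

lemma integrable_fourier_test_function:
  assumes \<phi>: "\<phi> \<in> test_functions_on U"
  shows "integrable lborel (fourier \<phi>)"
proof -
  obtain B where B: "integrable lborel \<phi>" "\<And>\<omega>. norm (ft \<phi> \<omega>) \<le> B / (1 + \<omega>\<^sup>2)"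
    using test_function_bounds[OF \<phi>] by metis
  have [measurable]: "\<phi> \<in> borel_measurable borel" using B(1) by auto
  have B0: "0 \<le> B" using order_trans[OF norm_ge_zero B(2)[of 0]] by simp
  show ?thesis
  proof (rule Bochner_Integration.integrable_bound)
    show "integrable lborel (\<lambda>x::real. B * (1 / (1 + x\<^sup>2)))"
      by (intro integrable_mult_right integrable_inverse_one_plus_square)
    show "fourier \<phi> \<in> borel_measurable lborel"
      unfolding fourier_eq_ft[abs_def] ft_def by measurable
    show "AE x in lborel. norm (fourier \<phi> x) \<le> norm (B * (1 / (1 + x\<^sup>2)))"
    proof (rule AE_I2)
      fix x :: real
      have "norm (fourier \<phi> x) \<le> B / (1 + (2 * pi * x)\<^sup>2)" using B(2) by (simp add: fourier_eq_ft)
      also have "\<dots> \<le> B / (1 + x\<^sup>2)"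
      proof (rule divide_left_mono)
        have "\<bar>x\<bar> \<le> \<bar>2 * pi * x\<bar>" using pi_gt3 mult_right_mono[of 1 "2 * pi" "\<bar>x\<bar>"] by (simp add: abs_mult)
        then show "1 + x\<^sup>2 \<le> 1 + (2 * pi * x)\<^sup>2" by (simp add: abs_le_square_iff)
        show "0 < (1 + (2 * pi * x)\<^sup>2) * (1 + x\<^sup>2)" by (intro mult_pos_pos add_pos_nonneg) auto
      qed (rule B0)
      finally show "norm (fourier \<phi> x) \<le> norm (B * (1 / (1 + x\<^sup>2)))"
        using B0 by (simp add: add_pos_nonneg less_imp_le)
    qed
  qed
qed

text \<open>
  Exchanging the integrals moves the transform from \<open>\<phi>\<close> to \<open>w\<close>.
\<close>

lemma integral_mult_fourier_eq_0:
  assumes w: "spectrum_in a b w" and \<phi>: "integrable lborel \<phi>"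
    and z: "\<And>\<xi>. a \<le> 2 * pi * \<xi> \<Longrightarrow> 2 * pi * \<xi> \<le> b \<Longrightarrow> \<phi> \<xi> = 0"
  shows "(LINT t|lborel. w t * fourier \<phi> t) = 0"
proof -
  have "2 * pi * t * \<xi> = 2 * pi * \<xi> * t" for t \<xi> :: real by simp
  then have "(LINT t|lborel. w t * fourier \<phi> t) = (LINT t|lborel. w t * (LINT \<xi>|lborel. \<phi> \<xi> * cis (- (2 * pi * \<xi> * t))))"
    unfolding fourier_eq_ft ft_def by (simp only:)
  also have "\<dots> = (LINT \<xi>|lborel. \<phi> \<xi> * (LINT t|lborel. w t * cis (- (2 * pi * \<xi> * t))))"
  proof (rule swap_kernel_integrals)
    show "integrable lborel w" using w by (simp add: spectrum_in_def)
    show "(\<lambda>(t, \<xi>). cis (- (2 * pi * \<xi> * t))) \<in> borel_measurable (borel \<Otimes>\<^sub>M borel)" by measurable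
  qed (use \<phi> in auto)
  also have "\<dots> = (LINT \<xi>|lborel. \<phi> \<xi> * ft w (2 * pi * \<xi>))" by (simp add: ft_def)
  also have "\<dots> = (LINT (\<xi>::real)|lborel. 0)"
  proof (rule Bochner_Integration.integral_cong)
    fix \<xi>
    show "\<phi> \<xi> * ft w (2 * pi * \<xi>) = 0"
      using w z[of \<xi>] by (cases "2 * pi * \<xi> < a \<or> b < 2 * pi * \<xi>") (auto simp: spectrum_in_def)
  qed simp
  finally show ?thesis by simp
qed

text \<open>
  A pure wave is not integrable.  Damped slowly by a squared sinc it is, with its spectrum
  in a small interval around \<open>\<omega>\<close>, and dominated convergence removes the damping.
\<close>

lemma integral_wave_mult_fourier_eq_0:
  assumes \<phi>: "\<phi> \<in> test_functions_on U" and \<eta>: "\<eta> > 0"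
    and z: "\<And>\<xi>. \<bar>2 * pi * \<xi> - \<omega>\<bar> \<le> \<eta> \<Longrightarrow> \<phi> \<xi> = 0"
  shows "(LINT t|lborel. cis (\<omega> * t) * fourier \<phi> t) = 0"
proof -
  obtain B where "integrable lborel \<phi>" using test_function_bounds[OF \<phi>] by metis
  note int = this integrable_fourier_test_function[OF \<phi>]
  have [measurable]: "fourier \<phi> \<in> borel_measurable borel" using int(2) by auto
  define \<delta> where "\<delta> n = \<eta> / 2 / real (Suc n)" for n
  define w where "w n t = complex_of_real ((sinc (\<delta> n * t))\<^sup>2) * cis (\<omega> * t)" for n t
  have "(LINT t|lborel. w n t * fourier \<phi> t) = 0" for n
  proof (rule integral_mult_fourier_eq_0[OF _ int(1)])
    have pos: "\<delta> n > 0" using \<eta> by (simp add: \<delta>_def)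
    show "spectrum_in (- (2 * \<delta> n) + \<omega>) (2 * \<delta> n + \<omega>) (w n)"
      unfolding w_def[abs_def] using pos by (intro spectrum_in_modulate spectrum_in_sinc_squared)
    have "2 * \<delta> n \<le> \<eta>" using \<eta> by (simp add: \<delta>_def field_simps)
    then show "\<phi> \<xi> = 0" if "- (2 * \<delta> n) + \<omega> \<le> 2 * pi * \<xi>" "2 * pi * \<xi> \<le> 2 * \<delta> n + \<omega>" for \<xi>
      using that by (intro z) (auto simp: abs_le_iff)
  qed
  moreover have lim: "(\<lambda>n. LINT t|lborel. w n t * fourier \<phi> t) \<longlonglongrightarrow> (LINT t|lborel. cis (\<omega> * t) * fourier \<phi> t)"
  proof (rule integral_dominated_convergence)
    show "integrable lborel (\<lambda>t. norm (fourier \<phi> t))" using int(2) by simp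
    show "(\<lambda>t. w n t * fourier \<phi> t) \<in> borel_measurable lborel" for n unfolding w_def by measurable
    show "AE t in lborel. norm (w n t * fourier \<phi> t) \<le> norm (fourier \<phi> t)" for n
    proof (rule AE_I2)
      fix t
      have "(sinc (\<delta> n * t))\<^sup>2 \<le> 1" using abs_sinc_le_one by (simp add: abs_square_le_1)
      then have "norm (w n t) \<le> 1" by (simp add: w_def norm_mult norm_power)
      then show "norm (w n t * fourier \<phi> t) \<le> norm (fourier \<phi> t)"
        by (simp add: norm_mult mult_left_le_one_le)
    qed
    show "AE t in lborel. (\<lambda>n. w n t * fourier \<phi> t) \<longlonglongrightarrow> cis (\<omega> * t) * fourier \<phi> t"
    proof (rule AE_I2)
      fix t
      have "(\<lambda>n. \<eta> / 2 * inverse (real (Suc n)) * t) \<longlonglongrightarrow> \<eta> / 2 * 0 * t"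
        by (intro tendsto_intros LIMSEQ_inverse_real_of_nat)
      moreover have "\<eta> / 2 * inverse (real (Suc n)) * t = \<delta> n * t" for n
        by (simp only: \<delta>_def divide_inverse)
      ultimately have "(\<lambda>n. \<delta> n * t) \<longlonglongrightarrow> 0" by (simp only: mult_zero_right mult_zero_left)
      from isCont_tendsto_compose[OF isCont_sinc this]
      have "(\<lambda>n. sinc (\<delta> n * t)) \<longlonglongrightarrow> 1" by simp
      then have "(\<lambda>n. w n t * fourier \<phi> t) \<longlonglongrightarrow> complex_of_real (1\<^sup>2) * cis (\<omega> * t) * fourier \<phi> t"
        unfolding w_def by (intro tendsto_intros)
      then show "(\<lambda>n. w n t * fourier \<phi> t) \<longlonglongrightarrow> cis (\<omega> * t) * fourier \<phi> t" by simp
    qed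
  qed simp
  ultimately have "(\<lambda>n. 0) \<longlonglongrightarrow> (LINT t|lborel. cis (\<omega> * t) * fourier \<phi> t)" by (simp only:)
  from LIMSEQ_unique[OF this tendsto_const] show ?thesis .
qed

section \<open>The interpolation kernel\<close>

text \<open>
  The first factor makes the kernel vanish at the lattice points \<open>j / r\<close> with \<open>j \<noteq> 0\<close>; the
  second makes it summable along the lattice, at the cost of enlarging its band by \<open>2 \<delta>\<close>.
\<close>

definition interp :: "real \<Rightarrow> real \<Rightarrow> real \<Rightarrow> real" where
  "interp r \<delta> t = sinc (pi * r * t) * (sinc (\<delta> * t))\<^sup>2"

lemma interp_at_lattice:
  assumes "r > 0"
  shows "interp r \<delta> (real_of_int j / r) = (if j = 0 then 1 else 0)"
proof (cases "j = 0")
  case False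
  have "sinc (pi * r * (real_of_int j / r)) = 0"
    using assms False by (simp add: sinc_def sin_zero_iff_int2)
  then show ?thesis using False by (simp add: interp_def)
qed (simp add: interp_def)

lemma abs_interp_le:
  assumes "\<delta> > 0"
  shows "\<bar>interp r \<delta> t\<bar> \<le> (1 + 1 / \<delta>\<^sup>2) / (1 + t\<^sup>2)"
proof -
  have "\<bar>interp r \<delta> t\<bar> \<le> (sinc (\<delta> * t))\<^sup>2"
    using abs_sinc_le_one[of "pi * r * t"] by (simp add: interp_def abs_mult mult_left_le_one_le)
  with sinc_squared_le[OF assms, of t] show ?thesis by linarith
qed

lemma continuous_on_interp [continuous_intros]:
  "continuous_on S f \<Longrightarrow> continuous_on S (\<lambda>x. interp r \<delta> (f x))"
  unfolding interp_def by (intro continuous_intros)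

lemma borel_measurable_interp [measurable]: "interp r \<delta> \<in> borel_measurable borel"
  by (intro borel_measurable_continuous_onI continuous_intros)

lemma spectrum_in_interp:
  assumes "\<delta> > 0" "r > 0"
  shows "spectrum_in (- (pi * r + 2 * \<delta>)) (pi * r + 2 * \<delta>) (\<lambda>t. complex_of_real (interp r \<delta> (t - s)))"
proof -
  have "spectrum_in (- (2 * \<delta>) - pi * r) (2 * \<delta> + pi * r)
     (\<lambda>t. complex_of_real ((sinc (\<delta> * t))\<^sup>2) * complex_of_real (sinc (pi * r * (t - 0))))"
    using assms by (intro spectrum_in_mult_sinc spectrum_in_sinc_squared) auto
  from spectrum_in_translate[OF this, of s]
  have "spectrum_in (- (2 * \<delta>) - pi * r) (2 * \<delta> + pi * r) (\<lambda>t. complex_of_real ((sinc (\<delta> * (t - s)))\<^sup>2) *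
      complex_of_real (sinc (pi * r * (t - s - 0))))" .
  moreover have "complex_of_real ((sinc (\<delta> * (t - s)))\<^sup>2) * complex_of_real (sinc (pi * r * (t - s - 0))) =
      complex_of_real (interp r \<delta> (t - s))" for t
    by (simp add: interp_def)
  moreover have "- (2 * \<delta>) - pi * r = - (pi * r + 2 * \<delta>)" "2 * \<delta> + pi * r = pi * r + 2 * \<delta>" by simp_all
  ultimately show ?thesis by (simp only:)
qed

text \<open>
  Pairing with these kernels kills all translates of \<^const>\<open>interp\<close>, hence everything that
  is interpolated from lattice data.  This expresses band limitation by conditions that are
  preserved by uniform limits, and it can be tested both against Fourier transforms of test
  functions and against \<open>wave_kernel\<close> below.
\<close>

definition null_kernels :: "real \<Rightarrow> real \<Rightarrow> (real \<Rightarrow> complex) set" where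
  "null_kernels r \<delta> = {k. integrable lborel k \<and>
     (\<forall>s. (LINT t|lborel. complex_of_real (interp r \<delta> (t - s)) * k t) = 0)}"

lemma fourier_in_null_kernels:
  assumes "\<delta> > 0" "r > 0" "pi * r + 2 * \<delta> \<le> pi * a"
    and \<phi>: "\<phi> \<in> test_functions_on (- {- (a / 2)..a / 2})"
  shows "fourier \<phi> \<in> null_kernels r \<delta>"
proof -
  obtain B where int: "integrable lborel \<phi>" using test_function_bounds[OF \<phi>] by metis
  have z: "\<phi> \<xi> = 0" if "\<xi> \<in> {- (a / 2)..a / 2}" for \<xi>
    by (rule test_function_zero_off[OF \<phi>]) (use that in simp)
  have "(LINT t|lborel. complex_of_real (interp r \<delta> (t - s)) * fourier \<phi> t) = 0" for s
  proof (rule integral_mult_fourier_eq_0[OF spectrum_in_interp[OF assms(1,2)] int])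
    fix \<xi> assume "- (pi * r + 2 * \<delta>) \<le> 2 * pi * \<xi>" "2 * pi * \<xi> \<le> pi * r + 2 * \<delta>"
    moreover have "2 * pi * \<xi> = pi * (2 * \<xi>)" "- (pi * r + 2 * \<delta>) \<ge> pi * (- a)"
      using assms(3) by auto
    ultimately have "pi * (2 * \<xi>) \<le> pi * a" "pi * (- a) \<le> pi * (2 * \<xi>)"
      using assms(3) by linarith+
    then have "2 * \<xi> \<le> a" "- a \<le> 2 * \<xi>"
      using mult_le_cancel_left_pos[OF pi_gt_zero] by blast+
    then show "\<phi> \<xi> = 0" by (intro z) auto
  qed
  with integrable_fourier_test_function[OF \<phi>] show ?thesis by (simp add: null_kernels_def)
qed

text \<open>
  Pairing with this kernel extracts the coefficient of the wave of frequency \<open>\<omega>\<close> from a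
  signal that has no other frequencies within distance \<open>2 \<delta>\<close>.
\<close>

definition wave_kernel :: "real \<Rightarrow> real \<Rightarrow> real \<Rightarrow> complex" where
  "wave_kernel \<delta> \<omega> t = complex_of_real ((sinc (\<delta> * t))\<^sup>2) * cis (- (\<omega> * t))"

lemma integrable_wave_kernel: "\<delta> > 0 \<Longrightarrow> integrable lborel (wave_kernel \<delta> \<omega>)"
  unfolding wave_kernel_def[abs_def]
  using integrable_of_real[OF integrable_sinc_squared]
  by (intro integrable_mult_bounded[where B = 1]) auto

lemma wave_kernel_in_null_kernels:
  assumes "\<delta> > 0" "r > 0" "\<delta>' > 0" "pi * r + 2 * \<delta> + 2 * \<delta>' < \<omega>"
  shows "wave_kernel \<delta>' \<omega> \<in> null_kernels r \<delta>"
proof -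
  have "(LINT t|lborel. complex_of_real (interp r \<delta> (t - s)) * wave_kernel \<delta>' \<omega> t) = 0" for s
  proof -
    define w where "w t = complex_of_real (interp r \<delta> (t - s)) *
        complex_of_real (sinc (\<delta>' * (t - 0))) * complex_of_real (sinc (\<delta>' * (t - 0)))" for t
    have "spectrum_in (- (pi * r + 2 * \<delta>) - \<delta>' - \<delta>') (pi * r + 2 * \<delta> + \<delta>' + \<delta>') w"
      unfolding w_def[abs_def] using assms by (intro spectrum_in_mult_sinc spectrum_in_interp) auto
    then have "ft w \<omega> = 0" using assms by (auto simp: spectrum_in_def)
    then show ?thesis by (simp add: ft_def w_def wave_kernel_def power2_eq_square mult_ac)
  qed
  with integrable_wave_kernel[OF assms(3)] show ?thesis by (simp add: null_kernels_def)
qed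

lemma integral_cis_wave_kernel:
  assumes "\<delta> > 0"
  shows "(LINT t|lborel. cis (\<mu> * t) * wave_kernel \<delta> \<mu> t) = complex_of_real (sinc_energy / \<delta>)"
    and "2 * \<delta> < \<bar>\<omega> - \<mu>\<bar> \<Longrightarrow> (LINT t|lborel. cis (\<mu> * t) * wave_kernel \<delta> \<omega> t) = 0"
proof -
  have eq: "(LINT t|lborel. cis (\<mu> * t) * wave_kernel \<delta> \<omega> t) =
      ft (\<lambda>t. complex_of_real ((sinc (\<delta> * t))\<^sup>2)) (\<omega> - \<mu>)" for \<omega>
  proof -
    have "cis (- ((\<omega> - \<mu>) * t)) = cis (\<mu> * t) * cis (- (\<omega> * t))" for t
      by (simp add: cis_mult algebra_simps)
    then show ?thesis unfolding ft_def wave_kernel_def by (simp only: mult_ac)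
  qed
  show "(LINT t|lborel. cis (\<mu> * t) * wave_kernel \<delta> \<mu> t) = complex_of_real (sinc_energy / \<delta>)"
    unfolding eq ft_sinc_squared[OF assms] using assms by (simp add: power2_eq_square)
  show "(LINT t|lborel. cis (\<mu> * t) * wave_kernel \<delta> \<omega> t) = 0" if "2 * \<delta> < \<bar>\<omega> - \<mu>\<bar>"
    unfolding eq using spectrum_in_sinc_squared[OF assms] that by (auto simp: spectrum_in_def abs_if split: if_splits)
qed

section \<open>Characters of the solenoid\<close>

lemma cis_rmod:
  assumes "c > 0"
  shows "cis (2 * pi * (x rmod c) / c) = cis (2 * pi * x / c)"
proof -
  define k where "k = \<lfloor>x / c\<rfloor>"
  have "2 * pi * (x rmod c) / c = 2 * pi * x / c - 2 * pi * of_int k"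
    using assms by (simp add: rmod_def k_def field_simps)
  then have "cis (2 * pi * (x rmod c) / c) = cis (2 * pi * x / c) / cis (2 * pi * of_int k)"
    by (simp only: cis_divide)
  then show ?thesis by (simp add: cis_multiple_2pi)
qed

text \<open>
  The circle carries the quotient topology, so continuity can be checked on \<open>[0, c]\<close>.
\<close>

lemma continuous_circle_character:
  assumes "c > 0"
  shows "continuous_map (circle_topology c) euclidean (\<lambda>x. cis (2 * pi * x / c))"
proof -
  define q where "q x = (if x = c then 0 else x)" for x :: real
  have q: "quotient_map (top_of_set {0..c}) (circle_topology c) q"
    unfolding circle_topology_def q_def[abs_def] by (rule quotient_map_quotient_topology)
  have "cis (2 * pi * q x / c) = cis (2 * pi * x / c)" for x
    using assms by (simp add: q_def)
  then have "(\<lambda>x. cis (2 * pi * x / c)) \<circ> q = (\<lambda>x. cis (2 * pi * x / c))" by (simp add: fun_eq_iff)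
  moreover have "continuous_map (top_of_set {0..c}) euclidean (\<lambda>x. cis (2 * pi * x / c))"
    using assms by (auto intro!: continuous_intros)
  ultimately show ?thesis using continuous_compose_quotient_map[OF q] by metis
qed

lemma topspace_solenoid_nonempty: "topspace solenoid \<noteq> {}"
proof -
  have "(\<lambda>n\<in>{1..}. 0) \<in> topspace solenoid"
    by (auto simp: solenoid_def circle_topology_def topspace_quotient_topology image_iff intro!: bexI[of _ 0])
  then show ?thesis by blast
qed

context metric_flow
begin

text \<open>
  The coordinates of the solenoid, read as points of the unit circle and pulled back to
  \<open>X\<close>.  The factor map enters the proof through these functions alone: they are clocks with
  periods \<open>n!\<close>, each of which determines those of shorter period.
\<close>

lemma solenoid_extension_characters:
  assumes "flow_extension X \<Phi> solenoid solenoid_flow"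
  shows "topspace X \<noteq> {}" and
    "\<exists>\<kappa>. (\<forall>n\<ge>1. continuous_map X euclidean (\<kappa> n)) \<and>
       (\<forall>n\<ge>1. \<forall>x\<in>topspace X. norm (\<kappa> n x) = 1) \<and>
       (\<forall>n\<ge>1. \<forall>x\<in>topspace X. \<forall>t. \<kappa> n (\<Phi> t x) = cis (2 * pi * t / fact n) * \<kappa> n x) \<and>
       (\<forall>n\<ge>1. \<forall>x\<in>topspace X. \<kappa> n x = \<kappa> (Suc n) x ^ Suc n)"
proof -
  obtain p where p: "continuous_map X solenoid p" "p ` topspace X = topspace solenoid"
    "\<And>t x. x \<in> topspace X \<Longrightarrow> p (\<Phi> t x) = solenoid_flow t (p x)"
    using assms unfolding flow_extension_def by auto
  show "topspace X \<noteq> {}" using p(2) topspace_solenoid_nonempty by (metis image_is_empty)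
  define \<kappa> where "\<kappa> n x = cis (2 * pi * p x n / fact n)" for n :: nat and x
  have cont: "continuous_map X euclidean (\<kappa> n)" if n: "n \<ge> 1" for n
  proof -
    have "continuous_map X (product_topology (\<lambda>n. circle_topology (fact n)) {1..}) p"
      using p(1) by (simp add: solenoid_def continuous_map_in_subtopology)
    moreover have "continuous_map (product_topology (\<lambda>n. circle_topology (fact n)) {1..}) (circle_topology (fact n)) (\<lambda>x. x n)"
      using n by (intro continuous_map_product_projection) auto
    ultimately have "continuous_map X (circle_topology (fact n)) ((\<lambda>x. x n) \<circ> p)"
      by (rule continuous_map_compose)
    from continuous_map_compose[OF this continuous_circle_character]
    show ?thesis by (simp add: \<kappa>_def[abs_def] o_def)
  qed
  have equi: "\<kappa> n (\<Phi> t x) = cis (2 * pi * t / fact n) * \<kappa> n x" if "n \<ge> 1" "x \<in> topspace X" for n x t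
  proof -
    have "\<kappa> n (\<Phi> t x) = cis (2 * pi * ((p x n + t) rmod fact n) / fact n)"
      using that p(3) by (simp add: \<kappa>_def solenoid_flow_def)
    also have "\<dots> = cis (2 * pi * (p x n + t) / fact n)" by (rule cis_rmod) simp
    also have "\<dots> = cis (2 * pi * t / fact n) * \<kappa> n x"
      by (simp add: \<kappa>_def cis_mult add_divide_distrib distrib_left add.commute)
    finally show ?thesis .
  qed
  have pow: "\<kappa> n x = \<kappa> (Suc n) x ^ Suc n" if "n \<ge> 1" "x \<in> topspace X" for n x
  proof -
    have "p x \<in> topspace solenoid" using p(2) that by blast
    then have "p x n = p x (Suc n) rmod fact n"
      using that(1) unfolding solenoid_def topspace_subtopology by blast
    then have "\<kappa> n x = cis (2 * pi * (p x (Suc n) rmod fact n) / fact n)" by (simp add: \<kappa>_def)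
    also have "\<dots> = cis (2 * pi * p x (Suc n) / fact n)" by (rule cis_rmod) simp
    also have "2 * pi * p x (Suc n) / fact n = real (Suc n) * (2 * pi * p x (Suc n) / fact (Suc n))"
      by (simp add: divide_simps del: of_nat_Suc)
    also have "cis \<dots> = \<kappa> (Suc n) x ^ Suc n"
      unfolding \<kappa>_def by (rule Complex.DeMoivre[symmetric])
    finally show ?thesis .
  qed
  show "\<exists>\<kappa>. (\<forall>n\<ge>1. continuous_map X euclidean (\<kappa> n)) \<and>
       (\<forall>n\<ge>1. \<forall>x\<in>topspace X. norm (\<kappa> n x) = 1) \<and>
       (\<forall>n\<ge>1. \<forall>x\<in>topspace X. \<forall>t. \<kappa> n (\<Phi> t x) = cis (2 * pi * t / fact n) * \<kappa> n x) \<and>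
       (\<forall>n\<ge>1. \<forall>x\<in>topspace X. \<kappa> n x = \<kappa> (Suc n) x ^ Suc n)"
  proof (intro exI[of _ \<kappa>] conjI allI impI ballI)
    show "norm (\<kappa> n x) = 1" for n x by (simp add: \<kappa>_def)
  qed (rule cont equi pow; assumption)+
qed

end

section \<open>Interpolation along orbits\<close>

lemma summable_on_int_inverse_square: "(\<lambda>j::int. 1 / (1 + (real_of_int j)\<^sup>2)) summable_on UNIV"
proof -
  have "summable (\<lambda>n::nat. 1 / (1 + (real n)\<^sup>2))"
  proof (rule summable_comparison_test')
    show "summable (\<lambda>n. inverse ((real n) ^ 2))" by (rule inverse_power_summable) simp
    show "norm (1 / (1 + (real n)\<^sup>2)) \<le> inverse ((real n)\<^sup>2)" if "n \<ge> 1" for n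
      using that by (auto simp: inverse_eq_divide intro!: divide_left_mono mult_pos_pos add_pos_nonneg)
  qed
  then have N: "(\<lambda>n::nat. 1 / (1 + (real n)\<^sup>2)) summable_on UNIV"
    by (subst summable_on_UNIV_nonneg_real_iff) auto
  have 1: "(\<lambda>j::int. 1 / (1 + (real_of_int j)\<^sup>2)) summable_on range int"
    by (subst summable_on_reindex) (use N in \<open>auto simp: o_def\<close>)
  have 2: "(\<lambda>j::int. 1 / (1 + (real_of_int j)\<^sup>2)) summable_on range (\<lambda>n. - int n)"
    by (subst summable_on_reindex) (use N in \<open>auto simp: o_def inj_on_def\<close>)
  have "(\<lambda>j::int. 1 / (1 + (real_of_int j)\<^sup>2)) summable_on (range (\<lambda>n. - int n) - range int)"
    using 2 by (rule summable_on_subset_banach) auto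
  from summable_on_Un_disjoint[OF 1 this]
  have "(\<lambda>j::int. 1 / (1 + (real_of_int j)\<^sup>2)) summable_on (range int \<union> (range (\<lambda>n. - int n) - range int))"
    by auto
  also have "range int \<union> (range (\<lambda>n. - int n) - range int) = UNIV"
  proof -
    have "j \<in> range int \<union> range (\<lambda>n. - int n)" for j :: int
      by (cases j rule: int_cases2) auto
    then show ?thesis by auto
  qed
  finally show ?thesis .
qed

definition lattice_energy :: real where
  "lattice_energy = (\<Sum>\<^sub>\<infinity>j::int. 1 / (1 + (real_of_int j)\<^sup>2))"

text \<open>
  Shifting the index by the integer part of \<open>x\<close> reduces the estimate to \<open>0 \<le> x \<le> 1\<close>.
\<close>

lemma lattice_sum_bounds:
  shows "(\<lambda>j::int. 1 / (1 + (x - real_of_int j)\<^sup>2)) summable_on UNIV"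
    and "(\<Sum>\<^sub>\<infinity>j::int. 1 / (1 + (x - real_of_int j)\<^sup>2)) \<le> 3 * lattice_energy"
proof -
  define f where "f = x - of_int \<lfloor>x\<rfloor>"
  have f: "0 \<le> f" "f \<le> 1" unfolding f_def by linarith+
  define g where "g i = 1 / (1 + (f - real_of_int i)\<^sup>2)" for i :: int
  have le: "g i \<le> 3 * (1 / (1 + (real_of_int i)\<^sup>2))" for i
  proof -
    define v where "v = f - real_of_int i"
    have iv: "real_of_int i = f - v" by (simp add: v_def)
    have "(f - v)\<^sup>2 \<le> 2 * v\<^sup>2 + 2 * f\<^sup>2"
      using zero_le_power2[of "f + v"] by (simp add: power2_eq_square algebra_simps)
    moreover have "f\<^sup>2 \<le> 1" using f by (simp add: abs_square_le_1)
    moreover have "0 \<le> v\<^sup>2" by simp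
    ultimately have "1 + (f - v)\<^sup>2 \<le> 3 * (1 + v\<^sup>2)" by argo
    then have "1 + (real_of_int i)\<^sup>2 \<le> 3 * (1 + (f - real_of_int i)\<^sup>2)"
      unfolding iv by simp
    then show ?thesis unfolding g_def by (simp add: divide_simps add_pos_nonneg)
  qed
  have g0: "0 \<le> g i" for i by (simp add: g_def)
  have s3: "(\<lambda>i::int. 3 * (1 / (1 + (real_of_int i)\<^sup>2))) summable_on UNIV"
    by (intro summable_on_cmult_right summable_on_int_inverse_square)
  have gs: "g summable_on UNIV"
    using s3 le g0 by (rule summable_on_comparison_test)
  have bij: "bij_betw (\<lambda>j. j - \<lfloor>x\<rfloor>) UNIV UNIV"
    by (rule bij_betwI[of _ _ _ "\<lambda>j. j + \<lfloor>x\<rfloor>"]) auto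
  have eq: "1 / (1 + (x - real_of_int j)\<^sup>2) = g (j - \<lfloor>x\<rfloor>)" for j
    by (simp add: g_def f_def)
  show "(\<lambda>j::int. 1 / (1 + (x - real_of_int j)\<^sup>2)) summable_on UNIV"
    unfolding eq using gs by (subst summable_on_reindex_bij_betw[OF bij])
  have "(\<Sum>\<^sub>\<infinity>j::int. 1 / (1 + (x - real_of_int j)\<^sup>2)) = infsum g UNIV"
    unfolding eq by (rule infsum_reindex_bij_betw[OF bij])
  also have "\<dots> \<le> (\<Sum>\<^sub>\<infinity>i::int. 3 * (1 / (1 + (real_of_int i)\<^sup>2)))"
    using gs s3 le by (rule infsum_mono)
  also have "\<dots> = 3 * lattice_energy" unfolding lattice_energy_def by (rule infsum_cmult_right')
  finally show "(\<Sum>\<^sub>\<infinity>j::int. 1 / (1 + (x - real_of_int j)\<^sup>2)) \<le> 3 * lattice_energy" .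
qed

definition interp_decay :: "real \<Rightarrow> real \<Rightarrow> real" where
  "interp_decay r \<delta> = (1 + 1 / \<delta>\<^sup>2) * (1 + r\<^sup>2)"

lemma interp_decay_nonneg: "0 \<le> interp_decay r \<delta>"
  by (simp add: interp_decay_def)

lemma abs_interp_lattice_le:
  assumes "\<delta> > 0" "r > 0"
  shows "\<bar>interp r \<delta> (\<tau> - real_of_int j / r)\<bar> \<le> interp_decay r \<delta> * (1 / (1 + (\<tau> * r - real_of_int j)\<^sup>2))"
proof -
  define \<theta> where "\<theta> = \<tau> - real_of_int j / r"
  have \<theta>: "\<tau> * r - real_of_int j = \<theta> * r" using assms by (simp add: \<theta>_def field_simps)
  have pos: "1 + \<theta>\<^sup>2 > 0" "1 + (\<theta> * r)\<^sup>2 > 0" by (simp_all add: add_pos_nonneg)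
  have "1 + (\<theta> * r)\<^sup>2 \<le> (1 + r\<^sup>2) * (1 + \<theta>\<^sup>2)"
    by (simp add: algebra_simps power_mult_distrib)
  then have "1 / (1 + \<theta>\<^sup>2) \<le> (1 + r\<^sup>2) * (1 / (1 + (\<theta> * r)\<^sup>2))"
    using pos by (simp add: divide_simps)
  then have "(1 + 1 / \<delta>\<^sup>2) * (1 / (1 + \<theta>\<^sup>2)) \<le> (1 + 1 / \<delta>\<^sup>2) * ((1 + r\<^sup>2) * (1 / (1 + (\<theta> * r)\<^sup>2)))"
    by (intro mult_left_mono) auto
  with abs_interp_le[OF assms(1), of r \<theta>] show ?thesis
    unfolding \<theta> \<theta>_def[symmetric] interp_decay_def by (simp add: mult.assoc)
qed

lemma cis_minus_mult: "z = cis t \<Longrightarrow> cis (- t) * z = 1"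
  by (simp add: cis_mult)

lemma filterlim_int_intervals:
  "filterlim (\<lambda>n::nat. {- int n..int n}) (finite_subsets_at_top UNIV) sequentially"
  unfolding filterlim_finite_subsets_at_top
proof (intro allI impI)
  fix X :: "int set" assume X: "finite X \<and> X \<subseteq> UNIV"
  then obtain b where b: "\<forall>x\<in>X. \<bar>x\<bar> \<le> b"
    by (metis finite_imageI finite_set_decode imageI Max_ge)
  have "eventually (\<lambda>n. nat b \<le> n) sequentially" by (rule eventually_ge_at_top)
  then show "eventually (\<lambda>n. finite {- int n..int n} \<and> X \<subseteq> {- int n..int n} \<and> {- int n..int n} \<subseteq> UNIV) sequentially"
  proof eventually_elim
    case (elim n)
    then show ?case using b by fastforce
  qed
qed

context metric_flow
begin

text \<open>
  Index \<open>j = k m + i\<close> with \<open>0 \<le> i < m\<close> stands for the \<open>i\<close>-th sample time of the \<open>k\<close>-th period.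
\<close>

definition samples :: "(nat \<Rightarrow> 'a \<Rightarrow> real) \<Rightarrow> nat \<Rightarrow> real \<Rightarrow> 'a \<Rightarrow> int \<Rightarrow> real" where
  "samples u m L y j = u (nat (j mod int m)) (\<Phi> (real_of_int (j div int m) * L) y)"

definition interpolant :: "real \<Rightarrow> real \<Rightarrow> (nat \<Rightarrow> 'a \<Rightarrow> real) \<Rightarrow> nat \<Rightarrow> real \<Rightarrow> 'a \<Rightarrow> real \<Rightarrow> real" where
  "interpolant r \<delta> u m L y \<tau> = (\<Sum>\<^sub>\<infinity>j. samples u m L y j * interp r \<delta> (\<tau> - real_of_int j / r))"

end

locale orbit_interpolation = metric_flow X d \<Phi>
  for X :: "'a topology" and d and \<Phi> +
  fixes r \<delta> L \<eta> :: real and m :: nat and u :: "nat \<Rightarrow> 'a \<Rightarrow> real" and \<kappa> :: "'a \<Rightarrow> complex"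
  assumes r: "r > 0" and \<delta>: "\<delta> > 0" and m: "m > 0" and L: "real m = L * r"
    and u: "\<And>i. i < m \<Longrightarrow> continuous_map X euclideanreal (u i)"
    and u_le: "\<And>i x. i < m \<Longrightarrow> x \<in> topspace X \<Longrightarrow> \<bar>u i x\<bar> \<le> \<eta>"
    and \<kappa>: "continuous_map X euclidean \<kappa>" "\<And>x. x \<in> topspace X \<Longrightarrow> norm (\<kappa> x) = 1"
    and \<kappa>_flow: "\<And>x t. x \<in> topspace X \<Longrightarrow> \<kappa> (\<Phi> t x) = cis (2 * pi * t / L) * \<kappa> x"
begin

lemma L_pos: "L > 0"
proof -
  have "0 < real m" using m by simp
  then have "0 < L * r" by (simp only: L)
  then show ?thesis using r by (simp add: zero_less_mult_iff)
qed

lemma index_less: "nat (j mod int m) < m"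
  using m by (simp add: nat_less_iff)

lemma samples_le: "y \<in> topspace X \<Longrightarrow> \<bar>samples u m L y j\<bar> \<le> \<eta>"
  unfolding samples_def using u_le[OF index_less] flow_in by blast

lemma term_le:
  assumes "y \<in> topspace X"
  shows "\<bar>samples u m L y j * interp r \<delta> (\<tau> - real_of_int j / r)\<bar> \<le>
     \<eta> * interp_decay r \<delta> * (1 / (1 + (\<tau> * r - real_of_int j)\<^sup>2))"
proof -
  have "\<bar>samples u m L y j\<bar> * \<bar>interp r \<delta> (\<tau> - real_of_int j / r)\<bar> \<le>
      \<eta> * (interp_decay r \<delta> * (1 / (1 + (\<tau> * r - real_of_int j)\<^sup>2)))"
    using samples_le[OF assms, of j] abs_interp_lattice_le[OF \<delta> r, of \<tau> j] by (intro mult_mono) auto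
  then show ?thesis by (simp add: abs_mult mult.assoc)
qed

lemma terms_abs_summable:
  assumes "y \<in> topspace X"
  shows "(\<lambda>j. norm (samples u m L y j * interp r \<delta> (\<tau> - real_of_int j / r))) summable_on UNIV"
proof (rule summable_on_comparison_test)
  show "(\<lambda>j. \<eta> * interp_decay r \<delta> * (1 / (1 + (\<tau> * r - real_of_int j)\<^sup>2))) summable_on UNIV"
    by (intro summable_on_cmult_right lattice_sum_bounds)
qed (use term_le[OF assms] in auto)

lemma terms_has_sum:
  assumes "y \<in> topspace X"
  shows "((\<lambda>j. samples u m L y j * interp r \<delta> (\<tau> - real_of_int j / r)) has_sum interpolant r \<delta> u m L y \<tau>) UNIV"
  unfolding interpolant_def
  by (rule has_sum_infsum[OF abs_summable_summable[OF terms_abs_summable[OF assms]]])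

lemma sum_norms_le:
  assumes "y \<in> topspace X"
  shows "(\<Sum>\<^sub>\<infinity>j. norm (samples u m L y j * interp r \<delta> (\<tau> - real_of_int j / r))) \<le>
    3 * interp_decay r \<delta> * lattice_energy * \<eta>"
proof -
  have "\<eta> \<ge> 0" using samples_le[OF assms, of 0] by linarith
  have "(\<Sum>\<^sub>\<infinity>j. norm (samples u m L y j * interp r \<delta> (\<tau> - real_of_int j / r))) \<le>
      (\<Sum>\<^sub>\<infinity>j. \<eta> * interp_decay r \<delta> * (1 / (1 + (\<tau> * r - real_of_int j)\<^sup>2)))"
    using term_le[OF assms] by (intro infsum_mono terms_abs_summable assms summable_on_cmult_right lattice_sum_bounds) auto
  also have "\<dots> = \<eta> * interp_decay r \<delta> * (\<Sum>\<^sub>\<infinity>j::int. 1 / (1 + (\<tau> * r - real_of_int j)\<^sup>2))"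
    by (rule infsum_cmult_right')
  also have "\<dots> \<le> \<eta> * interp_decay r \<delta> * (3 * lattice_energy)"
    using \<open>\<eta> \<ge> 0\<close> interp_decay_nonneg by (intro mult_left_mono lattice_sum_bounds) auto
  finally show ?thesis by (simp add: mult_ac)
qed

lemma abs_interpolant_le:
  assumes "y \<in> topspace X"
  shows "\<bar>interpolant r \<delta> u m L y \<tau>\<bar> \<le> 3 * interp_decay r \<delta> * lattice_energy * \<eta>"
proof -
  have "norm (interpolant r \<delta> u m L y \<tau>) \<le>
      (\<Sum>\<^sub>\<infinity>j. norm (samples u m L y j * interp r \<delta> (\<tau> - real_of_int j / r)))"
    unfolding interpolant_def by (rule norm_infsum_bound[OF terms_abs_summable[OF assms]])
  also have "\<dots> \<le> 3 * interp_decay r \<delta> * lattice_energy * \<eta>" by (rule sum_norms_le[OF assms])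
  finally show ?thesis by simp
qed

text \<open>
  Moving the base point by whole periods only renumbers the samples.
\<close>

lemma interpolant_shift:
  assumes y: "y \<in> topspace X"
  shows "interpolant r \<delta> u m L (\<Phi> (real_of_int k * L) y) \<tau> = interpolant r \<delta> u m L y (\<tau> + real_of_int k * L)"
proof -
  have s: "samples u m L (\<Phi> (real_of_int k * L) y) j = samples u m L y (j + k * int m)" for j
    using m y flow_add[of y "real_of_int (j div int m) * L" "real_of_int k * L"]
    by (simp add: samples_def algebra_simps)
  have t: "\<tau> - real_of_int j / r = \<tau> + real_of_int k * L - real_of_int (j + k * int m) / r" for j
    using L r by (simp add: field_simps)
  have bij: "bij_betw (\<lambda>j. j + k * int m) UNIV UNIV"
    by (rule bij_betwI[of _ _ _ "\<lambda>j. j - k * int m"]) auto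
  have "interpolant r \<delta> u m L (\<Phi> (real_of_int k * L) y) \<tau> =
     (\<Sum>\<^sub>\<infinity>j. samples u m L y (j + k * int m) *
        interp r \<delta> (\<tau> + real_of_int k * L - real_of_int (j + k * int m) / r))"
    unfolding interpolant_def s by (intro infsum_cong) (simp only: t)
  also have "\<dots> = interpolant r \<delta> u m L y (\<tau> + real_of_int k * L)"
    unfolding interpolant_def
    by (rule infsum_reindex_bij_betw[OF bij, where f = "\<lambda>j. samples u m L y j * interp r \<delta> (\<tau> + real_of_int k * L - real_of_int j / r)"])
  finally show ?thesis .
qed

lemma interpolant_at_lattice:
  assumes y: "y \<in> topspace X" and i: "i < m"
  shows "interpolant r \<delta> u m L y (real i / r) = u i y"
proof -
  have z: "interp r \<delta> (real i / r - real_of_int j / r) = (if j = int i then 1 else 0)" for j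
  proof -
    have "real i / r - real_of_int j / r = real_of_int (int i - j) / r" by (simp add: diff_divide_distrib)
    then have "interp r \<delta> (real i / r - real_of_int j / r) = (if int i - j = 0 then 1 else 0)"
      by (simp only: interp_at_lattice[OF r])
    then show ?thesis by simp
  qed
  have "interpolant r \<delta> u m L y (real i / r) = (\<Sum>\<^sub>\<infinity>j\<in>{int i}. samples u m L y j)"
    unfolding interpolant_def z by (rule infsum_cong_neutral) auto
  also have "\<dots> = u i y"
    using i y flow_zero by (simp add: samples_def)
  finally show ?thesis .
qed

text \<open>
  Every term of the interpolation series is killed by \<open>k\<close>, and the partial sums are
  uniformly bounded, so dominated convergence applies.
\<close>

lemma integral_interpolant_null_kernel:
  assumes y: "y \<in> topspace X" and k: "k \<in> null_kernels r \<delta>"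
  shows "(LINT \<tau>|lborel. complex_of_real (interpolant r \<delta> u m L y (\<tau> + c)) * k \<tau>) = 0"
proof -
  have ik: "integrable lborel k" using k by (simp add: null_kernels_def)
  have [measurable]: "k \<in> borel_measurable borel" using ik by auto
  define p where "p j \<tau> = samples u m L y j * interp r \<delta> (\<tau> + c - real_of_int j / r)" for j \<tau>
  define q where "q n \<tau> = (\<Sum>j\<in>{- int n..int n}. p j \<tau>)" for n :: nat and \<tau>
  have [measurable]: "p j \<in> borel_measurable borel" for j unfolding p_def[abs_def] by measurable
  have pi: "(LINT \<tau>|lborel. complex_of_real (p j \<tau>) * k \<tau>) = 0" for j
  proof -
    have "(LINT \<tau>|lborel. complex_of_real (interp r \<delta> (\<tau> - (real_of_int j / r - c))) * k \<tau>) = 0"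
      using k by (simp add: null_kernels_def)
    then have "(LINT \<tau>|lborel. complex_of_real (samples u m L y j) *
        (complex_of_real (interp r \<delta> (\<tau> - (real_of_int j / r - c))) * k \<tau>)) = 0"
      by (simp only: integral_mult_right_zero mult_zero_right)
    moreover have "\<tau> - (real_of_int j / r - c) = \<tau> + c - real_of_int j / r" for \<tau> by simp
    ultimately show ?thesis by (simp only: p_def of_real_mult mult.assoc)
  qed
  have pint: "integrable lborel (\<lambda>\<tau>. complex_of_real (p j \<tau>) * k \<tau>)" for j
  proof -
    have "norm (complex_of_real (p j \<tau>)) \<le> \<eta> * interp_decay r \<delta>" for \<tau>
    proof -
      have "\<bar>p j \<tau>\<bar> \<le> \<eta> * interp_decay r \<delta> * (1 / (1 + ((\<tau> + c) * r - real_of_int j)\<^sup>2))"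
        unfolding p_def by (rule term_le[OF y])
      also have "\<dots> \<le> \<eta> * interp_decay r \<delta> * 1"
        using samples_le[OF y, of 0] interp_decay_nonneg[of r \<delta>]
        by (intro mult_left_mono mult_nonneg_nonneg) (auto simp: divide_simps add_pos_nonneg)
      finally show ?thesis by simp
    qed
    then have "integrable lborel (\<lambda>\<tau>. k \<tau> * complex_of_real (p j \<tau>))"
      by (intro integrable_mult_bounded[OF ik]) auto
    then show ?thesis by (simp add: mult.commute)
  qed
  have q0: "(LINT \<tau>|lborel. complex_of_real (q n \<tau>) * k \<tau>) = 0" for n
  proof -
    have "(LINT \<tau>|lborel. complex_of_real (q n \<tau>) * k \<tau>) =
        (LINT \<tau>|lborel. (\<Sum>j\<in>{- int n..int n}. complex_of_real (p j \<tau>) * k \<tau>))"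
      by (simp add: q_def sum_distrib_right)
    also have "\<dots> = (\<Sum>j\<in>{- int n..int n}. (LINT \<tau>|lborel. complex_of_real (p j \<tau>) * k \<tau>))"
      using pint by (intro Bochner_Integration.integral_sum)
    finally show ?thesis by (simp add: pi)
  qed
  define B where "B = 3 * interp_decay r \<delta> * lattice_energy * \<eta>"
  have "(\<lambda>n. LINT \<tau>|lborel. complex_of_real (q n \<tau>) * k \<tau>) \<longlonglongrightarrow>
      (LINT \<tau>|lborel. complex_of_real (interpolant r \<delta> u m L y (\<tau> + c)) * k \<tau>)"
  proof (rule integral_dominated_convergence)
    have qm[measurable]: "q n \<in> borel_measurable borel" for n unfolding q_def[abs_def] by measurable
    show "(\<lambda>\<tau>. complex_of_real (q n \<tau>) * k \<tau>) \<in> borel_measurable lborel" for n by measurable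
    have lim: "(\<lambda>n. q n \<tau>) \<longlonglongrightarrow> interpolant r \<delta> u m L y (\<tau> + c)" for \<tau>
      using filterlim_compose[OF terms_has_sum[OF y, of "\<tau> + c", unfolded has_sum_def] filterlim_int_intervals]
      by (simp add: q_def p_def)
    then have [measurable]: "(\<lambda>\<tau>. interpolant r \<delta> u m L y (\<tau> + c)) \<in> borel_measurable borel"
      using qm by (rule borel_measurable_LIMSEQ_metric[rotated])
    show "(\<lambda>\<tau>. complex_of_real (interpolant r \<delta> u m L y (\<tau> + c)) * k \<tau>) \<in> borel_measurable lborel"
      by measurable
    show "integrable lborel (\<lambda>\<tau>. B * norm (k \<tau>))" using ik by simp
    show "AE \<tau> in lborel. (\<lambda>n. complex_of_real (q n \<tau>) * k \<tau>) \<longlonglongrightarrow>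
        complex_of_real (interpolant r \<delta> u m L y (\<tau> + c)) * k \<tau>"
      using lim by (intro AE_I2 tendsto_intros)
    show "AE \<tau> in lborel. norm (complex_of_real (q n \<tau>) * k \<tau>) \<le> B * norm (k \<tau>)" for n
    proof (rule AE_I2)
      fix \<tau>
      have "\<bar>q n \<tau>\<bar> \<le> (\<Sum>j\<in>{- int n..int n}. norm (p j \<tau>))"
        unfolding q_def using norm_sum[of "\<lambda>j. p j \<tau>"] by simp
      also have "\<dots> \<le> (\<Sum>\<^sub>\<infinity>j. norm (p j \<tau>))"
        unfolding p_def using terms_abs_summable[OF y] by (intro finite_sum_le_infsum) auto
      also have "\<dots> \<le> B" unfolding p_def B_def by (rule sum_norms_le[OF y])
      finally show "norm (complex_of_real (q n \<tau>) * k \<tau>) \<le> B * norm (k \<tau>)"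
        by (simp add: norm_mult mult_right_mono)
    qed
  qed
  then have "(\<lambda>n. 0) \<longlonglongrightarrow> (LINT \<tau>|lborel. complex_of_real (interpolant r \<delta> u m L y (\<tau> + c)) * k \<tau>)"
    by (simp only: q0)
  from LIMSEQ_unique[OF this tendsto_const] show ?thesis .
qed

text \<open>
  On a bounded range of phases the terms of the series have a common summable bound.
\<close>

lemma continuous_interpolant:
  assumes \<sigma>: "continuous_map (subtopology X D) euclideanreal \<sigma>" and Q: "\<And>x. \<bar>\<sigma> x\<bar> \<le> Q"
  shows "continuous_map (subtopology X D) euclideanreal (\<lambda>x. interpolant r \<delta> u m L (\<Phi> (\<sigma> x) x) (- \<sigma> x))"
proof -
  define f where "f j x = samples u m L (\<Phi> (\<sigma> x) x) j * interp r \<delta> (- \<sigma> x - real_of_int j / r)" for j x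
  define M where "M j = \<eta> * interp_decay r \<delta> * (2 + 2 * (Q * r)\<^sup>2) * (1 / (1 + (real_of_int j)\<^sup>2))" for j :: int
  have idm: "continuous_map (subtopology X D) X (\<lambda>x. x)"
    by (rule continuous_map_from_subtopology[OF continuous_map_id[unfolded id_def]])
  have cf: "continuous_map (subtopology X D) euclideanreal (f j)" for j
    unfolding f_def[abs_def]
  proof (rule continuous_map_real_mult)
    have "continuous_map (subtopology X D) X (\<lambda>x. \<Phi> (real_of_int (j div int m) * L) (\<Phi> (\<sigma> x) x))"
      by (rule continuous_flow_compose[OF _ continuous_flow_compose[OF \<sigma> idm]]) simp
    from continuous_map_compose[OF this u[OF index_less[of j]]]
    show "continuous_map (subtopology X D) euclideanreal (\<lambda>x. samples u m L (\<Phi> (\<sigma> x) x) j)"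
      by (simp add: samples_def o_def)
    have "continuous_map euclideanreal euclideanreal (\<lambda>s. interp r \<delta> (- s - real_of_int j / r))"
      by (auto intro!: continuous_intros)
    from continuous_map_compose[OF \<sigma> this]
    show "continuous_map (subtopology X D) euclideanreal (\<lambda>x. interp r \<delta> (- \<sigma> x - real_of_int j / r))"
      by (simp add: o_def)
  qed
  have Ms: "M summable_on UNIV"
    unfolding M_def by (intro summable_on_cmult_right summable_on_int_inverse_square)
  have "norm (f j x) \<le> M j" if "x \<in> topspace (subtopology X D)" for j x
  proof -
    have x: "\<Phi> (\<sigma> x) x \<in> topspace X" using that flow_in by auto
    have \<eta>0: "0 \<le> \<eta> * interp_decay r \<delta>" using samples_le[OF x, of 0] interp_decay_nonneg[of r \<delta>] by simp
    have "\<bar>f j x\<bar> \<le> \<eta> * interp_decay r \<delta> * (1 / (1 + (- \<sigma> x * r - real_of_int j)\<^sup>2))"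
      unfolding f_def by (rule term_le[OF x])
    also have "\<dots> \<le> \<eta> * interp_decay r \<delta> * ((2 + 2 * (Q * r)\<^sup>2) * (1 / (1 + (real_of_int j)\<^sup>2)))"
    proof (intro mult_left_mono \<eta>0)
      define v where "v = - \<sigma> x * r - real_of_int j"
      have "(\<sigma> x * r)\<^sup>2 \<le> (Q * r)\<^sup>2"
        using Q[of x] r by (intro power2_le_iff_abs_le[THEN iffD2]) (auto simp: abs_mult)
      moreover have "(real_of_int j)\<^sup>2 \<le> 2 * v\<^sup>2 + 2 * (\<sigma> x * r)\<^sup>2"
        using zero_le_power2[of "v - \<sigma> x * r"] by (simp add: v_def power2_eq_square algebra_simps)
      ultimately have "1 + (real_of_int j)\<^sup>2 \<le> (2 + 2 * (Q * r)\<^sup>2) + 2 * v\<^sup>2" by simp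
      also have "\<dots> \<le> (2 + 2 * (Q * r)\<^sup>2) * (1 + v\<^sup>2)" by (simp add: algebra_simps)
      finally have "1 / (1 + v\<^sup>2) \<le> (2 + 2 * (Q * r)\<^sup>2) * (1 / (1 + (real_of_int j)\<^sup>2))"
        by (simp add: divide_simps add_pos_nonneg)
      then show "1 / (1 + (- \<sigma> x * r - real_of_int j)\<^sup>2) \<le> (2 + 2 * (Q * r)\<^sup>2) * (1 / (1 + (real_of_int j)\<^sup>2))"
        by (simp only: v_def)
    qed
    finally show ?thesis by (simp add: M_def mult.assoc)
  qed
  then have ul: "uniform_limit (topspace (subtopology X D)) (\<lambda>F x. \<Sum>j\<in>F. f j x) (\<lambda>x. \<Sum>\<^sub>\<infinity>j. f j x) (finite_subsets_at_top UNIV)"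
    by (intro Weierstrass_m_test_general[OF _ Ms]) auto
  have "continuous_map (subtopology X D) Met_TC.mtopology (\<lambda>x. \<Sum>\<^sub>\<infinity>j. f j x)"
  proof (rule Met_TC.continuous_map_uniform_limit)
    show "\<forall>\<^sub>F F in finite_subsets_at_top UNIV. continuous_map (subtopology X D) Met_TC.mtopology (\<lambda>x. \<Sum>j\<in>F. f j x)"
      by (rule eventually_finite_subsets_at_top_weakI) (simp add: cf continuous_map_sum)
    show "\<forall>\<^sub>F F in finite_subsets_at_top UNIV. \<forall>x\<in>topspace (subtopology X D).
        (\<Sum>\<^sub>\<infinity>j. f j x) \<in> UNIV \<and> dist (\<Sum>j\<in>F. f j x) (\<Sum>\<^sub>\<infinity>j. f j x) < \<epsilon>" if "\<epsilon> > 0" for \<epsilon>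
      using uniform_limitD[OF ul that] by simp
  qed simp
  then show ?thesis by (simp add: interpolant_def f_def)
qed

text \<open>
  The time \<open>s\<close> takes \<open>x\<close> to a point whose clock \<open>\<kappa>\<close> shows \<open>1\<close>.  Another choice of \<open>s\<close>
  differs by whole periods and gives the same value; therefore the correction, followed along
  an orbit, is a single interpolated signal.
\<close>

definition correction :: "'a \<Rightarrow> real" where
  "correction x = (let s = - L * Arg (\<kappa> x) / (2 * pi) in interpolant r \<delta> u m L (\<Phi> s x) (- s))"

lemma correction_eq:
  assumes x: "x \<in> topspace X" and s: "\<kappa> (\<Phi> s x) = 1"
  shows "correction x = interpolant r \<delta> u m L (\<Phi> s x) (- s)"
proof -
  define s0 where "s0 = - L * Arg (\<kappa> x) / (2 * pi)"
  have "\<kappa> x = cis (Arg (\<kappa> x))"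
    using \<kappa>(2)[OF x] by (metis cis_Arg div_by_1 norm_zero of_real_1 sgn_eq zero_neq_one)
  then have 1: "\<kappa> (\<Phi> s0 x) = 1"
    using L_pos \<kappa>_flow[OF x, of s0] cis_minus_mult by (simp add: s0_def)
  have "cis (2 * pi * s / L) * \<kappa> x = cis (2 * pi * s0 / L) * \<kappa> x"
    using s 1 \<kappa>_flow[OF x] by simp
  moreover have "\<kappa> x \<noteq> 0" using \<kappa>(2)[OF x] by auto
  ultimately have "cis (2 * pi * s / L) = cis (2 * pi * s0 / L)" by simp
  then have "cis (2 * pi * (s - s0) / L) = 1"
    by (simp add: diff_divide_distrib right_diff_distrib flip: cis_divide)
  then have "cos (2 * pi * (s - s0) / L) = 1" by (metis cis.simps(1) one_complex.simps(1))
  then obtain k :: int where "2 * pi * (s - s0) / L = of_int k * (2 * pi)"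
    unfolding cos_one_2pi_int by (auto simp: mult_ac)
  moreover have "(s - s0) / L = (2 * pi * (s - s0) / L) / (2 * pi)" by simp
  ultimately have "(s - s0) / L = of_int k" by simp
  then have "s - s0 = of_int k * L" using L_pos by (simp add: divide_eq_eq)
  then have k: "s = of_int k * L + s0" by simp
  have "interpolant r \<delta> u m L (\<Phi> s x) (- s) = interpolant r \<delta> u m L (\<Phi> (of_int k * L) (\<Phi> s0 x)) (- s)"
    using k flow_add[OF x] by simp
  also have "\<dots> = interpolant r \<delta> u m L (\<Phi> s0 x) (- s0)"
    using interpolant_shift[OF flow_in[OF x]] k by simp
  finally have "interpolant r \<delta> u m L (\<Phi> s x) (- s) = interpolant r \<delta> u m L (\<Phi> s0 x) (- s0)" .
  moreover have "correction x = interpolant r \<delta> u m L (\<Phi> s0 x) (- s0)"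
    by (simp only: correction_def Let_def s0_def)
  ultimately show ?thesis by (simp only:)
qed

lemma phase_exists:
  assumes x: "x \<in> topspace X"
  obtains s where "\<kappa> (\<Phi> s x) = 1" "- L \<le> s" "s \<le> 0"
proof -
  define s where "s = - L * Arg2pi (\<kappa> x) / (2 * pi)"
  have "\<kappa> x = cis (Arg2pi (\<kappa> x))"
    using Arg2pi_eq[of "\<kappa> x"] \<kappa>(2)[OF x] by (simp add: cis_conv_exp)
  then have "\<kappa> (\<Phi> s x) = 1"
    using L_pos \<kappa>_flow[OF x, of s] cis_minus_mult by (simp add: s_def)
  moreover have "- L \<le> s" "s \<le> 0"
    using L_pos Arg2pi_ge_0[of "\<kappa> x"] Arg2pi_lt_2pi[of "\<kappa> x"] by (simp_all add: s_def field_simps)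
  ultimately show thesis by (rule that)
qed

lemma correction_orbit:
  assumes x: "x \<in> topspace X" and s: "\<kappa> (\<Phi> s x) = 1"
  shows "correction (\<Phi> t x) = interpolant r \<delta> u m L (\<Phi> s x) (t - s)"
proof -
  have e: "\<Phi> (s - t) (\<Phi> t x) = \<Phi> s x" using flow_add[OF x, of "s - t" t] by simp
  then have "correction (\<Phi> t x) = interpolant r \<delta> u m L (\<Phi> (s - t) (\<Phi> t x)) (- (s - t))"
    using s by (intro correction_eq flow_in x) simp
  with e show ?thesis by simp
qed

lemma abs_correction_le:
  assumes "x \<in> topspace X"
  shows "\<bar>correction x\<bar> \<le> 3 * interp_decay r \<delta> * lattice_energy * \<eta>"
  unfolding correction_def Let_def by (rule abs_interpolant_le[OF flow_in[OF assms]])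

lemma correction_null:
  assumes x: "x \<in> topspace X" and k: "k \<in> null_kernels r \<delta>"
  shows "(LINT t|lborel. complex_of_real (correction (\<Phi> t x)) * k t) = 0"
proof -
  obtain s where s: "\<kappa> (\<Phi> s x) = 1" using phase_exists[OF x] by metis
  show ?thesis unfolding correction_orbit[OF x s]
    using integral_interpolant_null_kernel[OF flow_in[OF x] k, of s "- s"] by simp
qed

lemma correction_at_lattice:
  assumes x: "x \<in> topspace X" "\<kappa> x = 1" and i: "i < m"
  shows "correction (\<Phi> (real i / r) x) = u i x"
proof -
  have x0: "\<Phi> 0 x = x" using x(1) by (rule flow_zero)
  have "correction (\<Phi> (real i / r) x) = interpolant r \<delta> u m L (\<Phi> 0 x) (real i / r - 0)"
    by (rule correction_orbit[OF x(1)]) (simp only: x0 x(2))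
  then show ?thesis using interpolant_at_lattice[OF x(1) i] by (simp only: x0 diff_zero)
qed

text \<open>
  The argument jumps on the negative half-axis.  Measuring it from the opposite direction
  gives a phase that jumps on the positive half-axis instead; both lead to the same
  correction, and one of them is continuous near any given point.
\<close>

lemma continuous_correction: "continuous_map X euclideanreal correction"
proof -
  define s1 where "s1 x = - L * Arg (\<kappa> x) / (2 * pi)" for x
  define s2 where "s2 x = - L * (Arg (- \<kappa> x) + pi) / (2 * pi)" for x
  define O1 where "O1 = {x \<in> topspace X. \<kappa> x \<in> - \<real>\<^sub>\<le>\<^sub>0}"
  define O2 where "O2 = {x \<in> topspace X. \<kappa> x \<in> - \<real>\<^sub>\<ge>\<^sub>0}"
  have "openin euclidean (- \<real>\<^sub>\<le>\<^sub>0 :: complex set)" "openin euclidean (- \<real>\<^sub>\<ge>\<^sub>0 :: complex set)"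
    using closed_nonpos_Reals_complex closed_nonneg_Reals_complex by (simp_all add: open_Compl)
  then have op: "openin X O1" "openin X O2"
    unfolding O1_def O2_def using openin_continuous_map_preimage[OF \<kappa>(1)] by blast+
  have ArgO: "continuous_map (subtopology euclidean (- \<real>\<^sub>\<le>\<^sub>0)) euclideanreal Arg"
    by (simp add: continuous_map_iff_continuous continuous_on_Arg)
  have c1: "continuous_map (subtopology X O1) (subtopology euclidean (- \<real>\<^sub>\<le>\<^sub>0)) \<kappa>"
    using \<kappa>(1) by (auto simp: continuous_map_in_subtopology continuous_map_from_subtopology O1_def)
  have "continuous_map (subtopology X O2) euclidean (\<lambda>x. - \<kappa> x)"
    by (intro continuous_map_minus continuous_map_from_subtopology \<kappa>(1))
  then have c2: "continuous_map (subtopology X O2) (subtopology euclidean (- \<real>\<^sub>\<le>\<^sub>0)) (\<lambda>x. - \<kappa> x)"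
    by (auto simp: continuous_map_in_subtopology O2_def)
  have a1: "continuous_map (subtopology X O1) euclideanreal (\<lambda>x. Arg (\<kappa> x))"
    using continuous_map_compose[OF c1 ArgO] by (simp add: o_def)
  have a2: "continuous_map (subtopology X O2) euclideanreal (\<lambda>x. Arg (- \<kappa> x))"
    using continuous_map_compose[OF c2 ArgO] by (simp add: o_def)
  have t1: "continuous_map (subtopology X O1) euclideanreal s1"
  proof -
    have "continuous_map (subtopology X O1) euclideanreal (\<lambda>x. (- L / (2 * pi)) * Arg (\<kappa> x))"
      by (intro continuous_map_real_mult a1) auto
    then show ?thesis by (simp add: s1_def[abs_def])
  qed
  have t2: "continuous_map (subtopology X O2) euclideanreal s2"
  proof -
    have "continuous_map (subtopology X O2) euclideanreal (\<lambda>x. (- L / (2 * pi)) * (Arg (- \<kappa> x) + pi))"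
      by (intro continuous_map_real_mult continuous_map_add a2) auto
    then show ?thesis by (simp add: s2_def[abs_def])
  qed
  have b1: "\<bar>s1 x\<bar> \<le> L" for x
  proof -
    have "\<bar>Arg (\<kappa> x)\<bar> \<le> pi" using Arg_bounded[of "\<kappa> x"] by (auto simp: abs_le_iff)
    then have "L * \<bar>Arg (\<kappa> x)\<bar> \<le> L * (2 * pi)" using L_pos by (intro mult_left_mono) auto
    then show ?thesis using L_pos by (simp add: s1_def abs_mult field_simps)
  qed
  have b2: "\<bar>s2 x\<bar> \<le> L" for x
  proof -
    define v where "v = Arg (- \<kappa> x) + pi"
    have "\<bar>v\<bar> \<le> 2 * pi" using Arg_bounded[of "- \<kappa> x"] by (auto simp: abs_le_iff v_def)
    then have "L * \<bar>v\<bar> \<le> L * (2 * pi)" using L_pos by (intro mult_left_mono) auto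
    then have "L * \<bar>v\<bar> / (2 * pi) \<le> L" by (simp add: divide_le_eq)
    moreover have "\<bar>s2 x\<bar> = L * \<bar>v\<bar> / (2 * pi)"
      using L_pos by (simp only: s2_def v_def abs_divide abs_mult abs_minus_cancel) simp
    ultimately show ?thesis by simp
  qed
  define g where "g i = (if i = (0::nat) then (\<lambda>x. interpolant r \<delta> u m L (\<Phi> (s1 x) x) (- s1 x))
                         else (\<lambda>x. interpolant r \<delta> u m L (\<Phi> (s2 x) x) (- s2 x)))" for i
  define T where "T i = (if i = (0::nat) then O1 else O2)" for i
  have polar: "z = cis (Arg z)" if "norm z = 1" for z :: complex
    using that by (metis cis_Arg div_by_1 norm_zero of_real_1 sgn_eq zero_neq_one)
  have ph: "\<kappa> (\<Phi> (s1 x) x) = 1" "\<kappa> (\<Phi> (s2 x) x) = 1" if x: "x \<in> topspace X" for x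
  proof -
    have "cis (2 * pi * s1 x / L) = cis (- Arg (\<kappa> x))" using L_pos by (simp add: s1_def)
    then show "\<kappa> (\<Phi> (s1 x) x) = 1"
      using \<kappa>_flow[OF x, of "s1 x"] cis_minus_mult[OF polar[OF \<kappa>(2)[OF x]]] by simp
    have "cis (- Arg (- \<kappa> x)) * (- \<kappa> x) = 1"
      by (rule cis_minus_mult, rule polar) (simp add: \<kappa>(2)[OF x])
    moreover have "2 * pi * s2 x / L = - Arg (- \<kappa> x) + - pi"
      using L_pos by (simp add: s2_def)
    then have "cis (2 * pi * s2 x / L) = cis (- Arg (- \<kappa> x)) * cis (- pi)"
      by (simp only: cis_mult)
    moreover have "cis (- pi) = -1" by (simp add: complex_eq_iff)
    ultimately show "\<kappa> (\<Phi> (s2 x) x) = 1"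
      using \<kappa>_flow[OF x, of "s2 x"] by simp
  qed
  show ?thesis
  proof (rule pasting_lemma[where I = "{0, 1}" and T = T and f = g])
    show "openin X (T i)" for i using op by (simp add: T_def)
    show "continuous_map (subtopology X (T i)) euclideanreal (g i)" for i
      using continuous_interpolant[OF t1 b1] continuous_interpolant[OF t2 b2] by (simp add: T_def g_def)
    have gc: "g i x = correction x" if "x \<in> topspace X" for i x
    proof (cases "i = 0")
      case True
      then show ?thesis unfolding correction_eq[OF that ph(1)[OF that]] by (simp add: g_def)
    next
      case False
      then show ?thesis unfolding correction_eq[OF that ph(2)[OF that]] by (simp add: g_def)
    qed
    then show "g i x = g j x" if "x \<in> topspace X \<inter> T i \<inter> T j" for i j x using that by simp
    show "\<exists>j. j \<in> {0, 1} \<and> x \<in> T j \<and> correction x = g j x" if x: "x \<in> topspace X" for x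
    proof -
      have "x \<in> O1 \<or> x \<in> O2"
        using x \<kappa>(2)[OF x] by (auto simp: O1_def O2_def nonneg_Reals_def nonpos_Reals_def)
      then show ?thesis using gc[OF x] by (auto simp: T_def)
    qed
  qed
qed

end

section \<open>Separating points up to phase\<close>

context metric_flow
begin

text \<open>
  The continuous functions whose values along all orbits are signals in the band of
  \<^const>\<open>interp\<close>.
\<close>

definition admissible :: "real \<Rightarrow> real \<Rightarrow> ('a \<Rightarrow> real) \<Rightarrow> bool" where
  "admissible r \<delta> F \<longleftrightarrow> continuous_map X euclideanreal F \<and>
     (\<forall>x\<in>topspace X. \<forall>k\<in>null_kernels r \<delta>. (LINT t|lborel. complex_of_real (F (\<Phi> t x)) * k t) = 0)"

lemma continuous_bounded:
  assumes "continuous_map X euclideanreal F"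
  shows "\<exists>B. \<forall>x\<in>topspace X. \<bar>F x\<bar> \<le> B"
proof -
  have "compactin euclideanreal (F ` topspace X)"
    by (rule image_compactin[OF compact[unfolded compact_space_def] assms])
  then have "bounded (F ` topspace X)" by (simp add: compact_imp_bounded)
  then show ?thesis by (auto simp: bounded_iff)
qed

lemma integrable_orbit_mult:
  assumes F: "continuous_map X euclideanreal F" and x: "x \<in> topspace X" and k: "integrable lborel k"
  shows "integrable lborel (\<lambda>t. complex_of_real (F (\<Phi> t x)) * k t)"
proof -
  obtain B where B: "\<forall>x\<in>topspace X. \<bar>F x\<bar> \<le> B" using continuous_bounded[OF F] by blast
  have "(\<lambda>t. F (\<Phi> t x)) \<in> borel_measurable borel"
    by (rule borel_measurable_continuous_onI[OF continuous_orbit[OF F x]])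
  then have "integrable lborel (\<lambda>t. k t * complex_of_real (F (\<Phi> t x)))"
    using B flow_in[OF x] by (intro integrable_mult_bounded[OF k, where B = B]) auto
  then show ?thesis by (simp add: mult.commute)
qed

lemma admissible_add:
  assumes F: "admissible r \<delta> F" and G: "admissible r \<delta> G"
  shows "admissible r \<delta> (\<lambda>x. F x + G x)"
proof -
  have c: "continuous_map X euclideanreal F" "continuous_map X euclideanreal G"
    using F G by (auto simp: admissible_def)
  have "(LINT t|lborel. complex_of_real (F (\<Phi> t x) + G (\<Phi> t x)) * k t) = 0"
    if "x \<in> topspace X" "k \<in> null_kernels r \<delta>" for x k
  proof -
    have ik: "integrable lborel k" using that by (simp add: null_kernels_def)
    have "(LINT t|lborel. complex_of_real (F (\<Phi> t x) + G (\<Phi> t x)) * k t) =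
      (LINT t|lborel. complex_of_real (F (\<Phi> t x)) * k t + complex_of_real (G (\<Phi> t x)) * k t)"
      by (simp add: distrib_right)
    also have "\<dots> = (LINT t|lborel. complex_of_real (F (\<Phi> t x)) * k t) + (LINT t|lborel. complex_of_real (G (\<Phi> t x)) * k t)"
      by (intro Bochner_Integration.integral_add integrable_orbit_mult c that ik)
    finally show ?thesis using F G that by (simp add: admissible_def)
  qed
  then show ?thesis using continuous_map_add[OF c] by (simp add: admissible_def)
qed

lemma uniformly_continuous:
  assumes F: "continuous_map X euclideanreal F" and \<gamma>: "\<gamma> > 0"
  shows "\<exists>e>0. \<forall>x\<in>topspace X. \<forall>y\<in>topspace X. d x y < e \<longrightarrow> \<bar>F x - F y\<bar> < \<gamma>"
proof -
  have c: "continuous_map (prod_topology X X) X fst" "continuous_map (prod_topology X X) X snd"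
    by (rule continuous_map_fst continuous_map_snd)+
  have "continuous_map (prod_topology X X) euclideanreal (\<lambda>p. \<bar>F (fst p) - F (snd p)\<bar>)"
    using continuous_map_compose[OF c(1) F] continuous_map_compose[OF c(2) F]
    by (intro continuous_map_real_abs continuous_map_diff) (simp_all add: o_def)
  then have "closedin (prod_topology X X) {p \<in> topspace (prod_topology X X). \<bar>F (fst p) - F (snd p)\<bar> \<in> {\<gamma>..}}"
    by (rule closedin_continuous_map_preimage) simp
  moreover have "compact_space (prod_topology X X)" using compact by (simp add: compact_space_prod_topology)
  ultimately have "compactin (prod_topology X X) {p \<in> topspace (prod_topology X X). \<bar>F (fst p) - F (snd p)\<bar> \<in> {\<gamma>..}}"
    by (rule closedin_compact_space[rotated])
  moreover have "continuous_map (prod_topology X X) euclideanreal (\<lambda>p. d (fst p) (snd p))"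
    by (rule continuous_dist_compose[OF c])
  ultimately have "compactin euclideanreal ((\<lambda>p. d (fst p) (snd p)) `
      {p \<in> topspace (prod_topology X X). \<bar>F (fst p) - F (snd p)\<bar> \<in> {\<gamma>..}})"
    by (rule image_compactin)
  then have "closed ((\<lambda>p. d (fst p) (snd p)) `
      {p \<in> topspace (prod_topology X X). \<bar>F (fst p) - F (snd p)\<bar> \<in> {\<gamma>..}})" (is "closed ?S")
    by (simp add: compact_imp_closed)
  moreover have "0 \<notin> ?S"
    using \<gamma> Metric_space.zero[OF metric] by (auto simp: image_iff)
  ultimately have "open (- ?S)" "0 \<in> - ?S" by (simp_all only: open_Compl Compl_iff not_False_eq_True)
  then obtain e where e: "e > 0" "ball 0 e \<subseteq> - ?S" unfolding open_contains_ball by blast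
  have "\<bar>F x - F y\<bar> < \<gamma>" if "x \<in> topspace X" "y \<in> topspace X" "d x y < e" for x y
  proof (rule ccontr)
    assume "\<not> \<bar>F x - F y\<bar> < \<gamma>"
    then have "(x, y) \<in> {p \<in> topspace (prod_topology X X). \<bar>F (fst p) - F (snd p)\<bar> \<in> {\<gamma>..}}" using that by simp
    then have "(\<lambda>p. d (fst p) (snd p)) (x, y) \<in> ?S" by (rule imageI)
    then have "d x y \<in> ?S" by (simp only: fst_conv snd_conv)
    moreover have "d x y \<in> ball 0 e" using that dist_nonneg[of x y] by simp
    ultimately show False using e by blast
  qed
  with e show ?thesis by blast
qed

text \<open>
  The margin \<open>\<eta>\<close> makes the property stable: it passes, with half the margin, to functions
  that differ from \<open>F\<close> by at most \<open>\<eta> / 4\<close>.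
\<close>

definition separates_modulo :: "('a \<Rightarrow> complex) \<Rightarrow> ('a \<Rightarrow> real) \<Rightarrow> real \<Rightarrow> real \<Rightarrow> bool" where
  "separates_modulo \<kappa> F \<eta> \<epsilon> \<longleftrightarrow> (\<forall>x\<in>topspace X. \<forall>y\<in>topspace X. \<kappa> x = \<kappa> y \<longrightarrow>
     (\<forall>t. \<bar>F (\<Phi> t x) - F (\<Phi> t y)\<bar> \<le> \<eta>) \<longrightarrow> d x y < \<epsilon>)"

text \<open>
  The heart of the matter.  The clock \<open>\<kappa> N\<close> with period \<open>L = N!\<close> equips every orbit with a
  lattice of sample times of spacing \<open>1 / r\<close>, with \<open>m = L r\<close> of them in a period.  To the
  \<open>i\<close>-th sample time in a period corresponds the \<open>i\<close>-th of \<open>m\<close> colours, and by interpolation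
  the values of \<open>F\<close> at the sample times can be changed at will, by small amounts, so that the
  \<open>i\<close>-th sample distinguishes all sets of colour \<open>i\<close>.  As the dimension \<open>n\<close> is less than
  \<open>m / 2\<close>, a point misses fewer than half of the colours.  So any two points have a colour in
  common, and if their samples agree, then they lie in the same set of this colour.
\<close>

proposition separating_perturbation:
  fixes p q :: nat
  assumes dims: "\<And>\<epsilon>. \<epsilon> > 0 \<Longrightarrow>
      \<exists>R0>0. \<forall>R\<ge>R0. \<exists>K f n. small_fibres \<epsilon> R K f \<and> covering_dim_le K (int n) \<and> real n < c * R"
    and r: "r = real p / real q" "p > 0" "q > 0" "2 * c < r" and \<delta>: "\<delta> > 0"
    and \<kappa>: "\<And>n. n \<ge> 1 \<Longrightarrow> continuous_map X euclidean (\<kappa> n)"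
      "\<And>n x. n \<ge> 1 \<Longrightarrow> x \<in> topspace X \<Longrightarrow> norm (\<kappa> n x) = 1"
      "\<And>n x t. n \<ge> 1 \<Longrightarrow> x \<in> topspace X \<Longrightarrow> \<kappa> n (\<Phi> t x) = cis (2 * pi * t / fact n) * \<kappa> n x"
    and F: "admissible r \<delta> F" and \<gamma>: "\<gamma> > 0" and \<epsilon>: "\<epsilon> > 0"
  shows "\<exists>F' N \<eta>. admissible r \<delta> F' \<and> (\<forall>x\<in>topspace X. \<bar>F' x - F x\<bar> \<le> \<gamma>) \<and> N \<ge> 1 \<and> \<eta> > 0 \<and>
     separates_modulo (\<kappa> N) F' \<eta> \<epsilon>"
proof -
  have r0: "r > 0" using r by simp
  have cF: "continuous_map X euclideanreal F" using F by (simp add: admissible_def)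
  \<comment> \<open>Changing the samples by at most \<open>2 * \<gamma>0\<close> changes the interpolated signal by at most \<open>\<gamma>\<close>.\<close>
  define B where "B = \<bar>3 * interp_decay r \<delta> * lattice_energy\<bar> + 1"
  define \<gamma>0 where "\<gamma>0 = \<gamma> / (2 * B)"
  have B: "B > 0" by (simp add: B_def)
  have \<gamma>0: "\<gamma>0 > 0" "B * (2 * \<gamma>0) = \<gamma>" using \<gamma> B by (simp_all add: \<gamma>0_def)
  obtain e where e: "e > 0" "\<forall>x\<in>topspace X. \<forall>y\<in>topspace X. d x y < e \<longrightarrow> \<bar>F x - F y\<bar> < \<gamma>0"
    using uniformly_continuous[OF cF \<gamma>0(1)] by blast
  define \<epsilon>' where "\<epsilon>' = min e \<epsilon>"
  have \<epsilon>': "\<epsilon>' > 0" using e \<epsilon> by (simp add: \<epsilon>'_def)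
  obtain R0 where R0: "R0 > 0" "\<forall>R\<ge>R0. \<exists>K f n. small_fibres \<epsilon>' R K f \<and> covering_dim_le K (int n) \<and> real n < c * R"
    using dims[OF \<epsilon>'] by blast
  \<comment> \<open>\<open>N\<close> is so large that \<open>L r\<close> is an integer and exceeds \<open>2 c L\<close>, hence \<open>2 n\<close>, by at least \<open>1\<close>.\<close>
  obtain N0 :: nat where N0: "max R0 (1 / (r - 2 * c)) \<le> real N0" using real_arch_simple by blast
  define N where "N = max N0 (max q 1)"
  define L :: real where "L = fact N"
  have "real N \<le> real (fact N)" by (rule of_nat_mono[OF fact_ge_self])
  then have "real N \<le> L" by (simp add: L_def)
  moreover have "real N0 \<le> real N" by (simp add: N_def)
  ultimately have L1: "R0 \<le> L" "1 / (r - 2 * c) \<le> L" using N0 by auto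
  have L2: "1 \<le> (r - 2 * c) * L" using L1(2) r(4) by (simp add: field_simps)
  have L0: "L > 0" by (simp add: L_def)
  define m where "m = p * (fact N div q)"
  have "q dvd fact N" using r(3) by (intro dvd_fact) (auto simp: N_def)
  then have "fact N = q * (fact N div q)" by simp
  then have LN: "L = real q * real (fact N div q)"
    unfolding L_def by (metis of_nat_fact of_nat_mult)
  then have mL: "real m = L * r" using r by (simp add: m_def)
  then have m0: "m > 0" using L0 r0 by (metis mult_pos_pos of_nat_0_less_iff)
  obtain K f n where K: "small_fibres \<epsilon>' L K f" "covering_dim_le K (int n)" "real n < c * L"
    using R0 L1 by blast
  have "2 * real n < 2 * c * L" using K(3) by simp
  then have "2 * real n + 1 < real m" using L2 mL by (simp add: algebra_simps)
  then have nm: "2 * n + 1 < m" by linarith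
  \<comment> \<open>With \<open>Suc n + s\<close> colours, every point sees at least \<open>Suc s\<close>, more than half of them.\<close>
  define s where "s = m - Suc n"
  have sm: "m = Suc n + s" "n < s" using nm by (auto simp: s_def)
  obtain Fam A where Fam: "\<And>i. i < m \<Longrightarrow> pairwise disjnt (Fam i)"
    "\<And>i U. i < m \<Longrightarrow> U \<in> Fam i \<Longrightarrow> openin X U"
    "\<And>i U x x' \<tau>. i < m \<Longrightarrow> U \<in> Fam i \<Longrightarrow> x \<in> U \<Longrightarrow> x' \<in> U \<Longrightarrow> \<tau> \<in> {0..L} \<Longrightarrow> d (\<Phi> \<tau> x) (\<Phi> \<tau> x') < \<epsilon>'"
    "\<And>i. i < m \<Longrightarrow> closedin X (A i)" "\<And>i. i < m \<Longrightarrow> A i \<subseteq> \<Union>(Fam i)"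
    "\<And>x. x \<in> topspace X \<Longrightarrow> Suc s \<le> card {i \<in> {..<m}. x \<in> A i}"
    by (rule coloured_families[OF K(1,2) less_imp_le[OF L0], of s, folded sm(1)]) (rule that; assumption)
  define g where "g i x = F (\<Phi> (real i / r) x)" for i :: nat and x
  have gi: "\<exists>u \<theta>. continuous_map X euclideanreal u \<and> (\<forall>x\<in>topspace X. \<bar>u x\<bar> \<le> 2 * \<gamma>0) \<and> \<theta> > 0 \<and>
    (\<forall>x\<in>A i. \<forall>y\<in>A i. \<bar>(g i x + u x) - (g i y + u y)\<bar> \<le> \<theta> \<longrightarrow> (\<exists>U\<in>Fam i. x \<in> U \<and> y \<in> U))"
    if i: "i < m" for i
  proof (rule colour_separating_correction[OF compact normal _ Fam(4,5)[OF i] Fam(1,2)[OF i]])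
    show "continuous_map X euclideanreal (g i)"
      using continuous_map_compose[OF continuous_flow_at cF] by (simp add: g_def[abs_def] o_def)
    show "\<bar>g i x - g i y\<bar> < \<gamma>0" if U: "U \<in> Fam i" "x \<in> U" "y \<in> U" for U x y
    proof -
      have "real i \<le> L * r" using i mL by linarith
      then have "real i / r \<in> {0..L}" using r0 by (simp add: divide_le_eq)
      then have "d (\<Phi> (real i / r) x) (\<Phi> (real i / r) y) < e"
        using Fam(3)[OF i U] by (fastforce simp: \<epsilon>'_def)
      moreover have "x \<in> topspace X" "y \<in> topspace X" using Fam(2)[OF i U(1)] U openin_subset by blast+
      ultimately show ?thesis using e(2) flow_in unfolding g_def by blast
    qed
  qed (assumption | rule \<gamma>0)+
  have "\<forall>i\<in>{..<m}. \<exists>z. continuous_map X euclideanreal (fst z) \<and> (\<forall>x\<in>topspace X. \<bar>fst z x\<bar> \<le> 2 * \<gamma>0) \<and> snd z > 0 \<and>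
    (\<forall>x\<in>A i. \<forall>y\<in>A i. \<bar>(g i x + fst z x) - (g i y + fst z y)\<bar> \<le> snd z \<longrightarrow> (\<exists>U\<in>Fam i. x \<in> U \<and> y \<in> U))"
    using gi by simp
  from bchoice[OF this] obtain z where z: "\<forall>i\<in>{..<m}. continuous_map X euclideanreal (fst (z i)) \<and>
    (\<forall>x\<in>topspace X. \<bar>fst (z i) x\<bar> \<le> 2 * \<gamma>0) \<and> snd (z i) > 0 \<and>
    (\<forall>x\<in>A i. \<forall>y\<in>A i. \<bar>(g i x + fst (z i) x) - (g i y + fst (z i) y)\<bar> \<le> snd (z i) \<longrightarrow> (\<exists>U\<in>Fam i. x \<in> U \<and> y \<in> U))" ..
  define u where "u i = fst (z i)" for i
  have u: "continuous_map X euclideanreal (u i)" "\<And>x. x \<in> topspace X \<Longrightarrow> \<bar>u i x\<bar> \<le> 2 * \<gamma>0" if "i < m" for i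
    using z that by (auto simp: u_def)
  define \<eta> where "\<eta> = Min ((\<lambda>i. snd (z i)) ` {..<m})"
  have \<eta>: "\<eta> > 0" "\<And>i. i < m \<Longrightarrow> \<eta> \<le> snd (z i)"
    using z m0 by (auto simp: \<eta>_def lessThan_empty_iff)
  have N1: "N \<ge> 1" by (simp add: N_def)
  note \<kappa>N = \<kappa>[OF N1, folded L_def]
  interpret I: orbit_interpolation X d \<Phi> r \<delta> L "2 * \<gamma>0" m u "\<kappa> N"
    using r0 \<delta> m0 mL u \<kappa>N by unfold_locales
  define C where "C = I.correction"
  have C: "admissible r \<delta> C"
    unfolding admissible_def C_def
    using I.continuous_correction I.correction_null by blast
  have Cle: "\<bar>C x\<bar> \<le> \<gamma>" if "x \<in> topspace X" for x
  proof -
    have "\<bar>C x\<bar> \<le> 3 * interp_decay r \<delta> * lattice_energy * (2 * \<gamma>0)"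
      unfolding C_def by (rule I.abs_correction_le[OF that])
    also have "\<dots> \<le> B * (2 * \<gamma>0)" using \<gamma>0(1) by (intro mult_right_mono) (auto simp: B_def)
    finally show ?thesis using \<gamma>0 by simp
  qed
  define F' where "F' x = F x + C x" for x
  have "separates_modulo (\<kappa> N) F' \<eta> \<epsilon>"
    unfolding separates_modulo_def
  proof (intro ballI impI)
    fix x y assume x: "x \<in> topspace X" and y: "y \<in> topspace X" and xy: "\<kappa> N x = \<kappa> N y"
      and close: "\<forall>t. \<bar>F' (\<Phi> t x) - F' (\<Phi> t y)\<bar> \<le> \<eta>"
    obtain \<sigma> where \<sigma>: "\<kappa> N (\<Phi> \<sigma> x) = 1" "- L \<le> \<sigma>" "\<sigma> \<le> 0" by (rule I.phase_exists[OF x])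
    then have \<sigma>y: "\<kappa> N (\<Phi> \<sigma> y) = 1" using \<kappa>N(3) x y xy by simp
    define x' y' where "x' = \<Phi> \<sigma> x" and "y' = \<Phi> \<sigma> y"
    have x': "x' \<in> topspace X" "y' \<in> topspace X" using x y flow_in by (auto simp: x'_def y'_def)
    define I where "I = {i \<in> {..<m}. x' \<in> A i}"
    define J where "J = {i \<in> {..<m}. y' \<in> A i}"
    have "Suc s \<le> card I" "Suc s \<le> card J" using Fam(6) x' by (auto simp: I_def J_def)
    moreover have "card (I \<union> J) \<le> m" using card_mono[of "{..<m}" "I \<union> J"] by (auto simp: I_def J_def)
    moreover have "card I + card J = card (I \<union> J) + card (I \<inter> J)"
      by (rule card_Un_Int) (auto simp: I_def J_def)
    ultimately have "card (I \<inter> J) \<noteq> 0" using sm by linarith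
    then have "I \<inter> J \<noteq> {}" by auto
    then obtain i where i: "i < m" "x' \<in> A i" "y' \<in> A i" by (auto simp: I_def J_def)
    have val: "F' (\<Phi> (real i / r) w) = g i w + fst (z i) w" if "w \<in> topspace X" "\<kappa> N w = 1" for w
      unfolding F'_def C_def I.correction_at_lattice[OF that i(1)] by (simp add: g_def u_def)
    have "F' (\<Phi> (real i / r) x') = F' (\<Phi> (real i / r + \<sigma>) x)" "F' (\<Phi> (real i / r) y') = F' (\<Phi> (real i / r + \<sigma>) y)"
      using flow_add x y by (simp_all add: x'_def y'_def)
    then have "\<bar>F' (\<Phi> (real i / r) x') - F' (\<Phi> (real i / r) y')\<bar> \<le> \<eta>" using close by simp
    then have "\<bar>(g i x' + fst (z i) x') - (g i y' + fst (z i) y')\<bar> \<le> snd (z i)"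
      using val[OF x'(1)] val[OF x'(2)] \<sigma> \<sigma>y \<eta>(2)[OF i(1)] by (simp add: x'_def y'_def)
    then obtain U where U: "U \<in> Fam i" "x' \<in> U" "y' \<in> U" using z i by blast
    have "d (\<Phi> (- \<sigma>) x') (\<Phi> (- \<sigma>) y') < \<epsilon>'" using \<sigma> by (intro Fam(3)[OF i(1) U]) auto
    moreover have "\<Phi> (- \<sigma>) x' = x" "\<Phi> (- \<sigma>) y' = y"
      using flow_add[of x "- \<sigma>" \<sigma>] flow_add[of y "- \<sigma>" \<sigma>] flow_zero x y by (simp_all add: x'_def y'_def)
    ultimately show "d x y < \<epsilon>" by (simp add: \<epsilon>'_def)
  qed
  moreover have "admissible r \<delta> F'" unfolding F'_def by (rule admissible_add[OF F C])
  moreover have "\<forall>x\<in>topspace X. \<bar>F' x - F x\<bar> \<le> \<gamma>" using Cle by (simp add: F'_def)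
  ultimately show ?thesis using N1 \<eta>(1) by blast
qed

end

section \<open>Limits of separating functions\<close>

context metric_flow
begin

lemma continuous_uniform_limit_real:
  fixes f :: "nat \<Rightarrow> 'a \<Rightarrow> real"
  assumes f: "\<And>n. continuous_map X euclideanreal (f n)" and lim: "uniform_limit (topspace X) f F sequentially"
  shows "continuous_map X euclideanreal F"
proof -
  have "continuous_map X Met_TC.mtopology F"
  proof (rule Met_TC.continuous_map_uniform_limit)
    show "\<forall>\<^sub>F n in sequentially. continuous_map X Met_TC.mtopology (f n)" using f by simp
    show "\<forall>\<^sub>F n in sequentially. \<forall>x\<in>topspace X. F x \<in> UNIV \<and> dist (f n x) (F x) < \<epsilon>" if "\<epsilon> > 0" for \<epsilon>
      using uniform_limitD[OF lim that] by simp
  qed simp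
  then show ?thesis by simp
qed

lemma integral_orbit_uniform_limit:
  fixes f :: "nat \<Rightarrow> 'a \<Rightarrow> real"
  assumes f: "\<And>n. continuous_map X euclideanreal (f n)" and lim: "uniform_limit (topspace X) f F sequentially"
    and x: "x \<in> topspace X" and k: "integrable lborel k"
  shows "(\<lambda>n. LINT t|lborel. complex_of_real (f n (\<Phi> t x)) * k t) \<longlonglongrightarrow>
         (LINT t|lborel. complex_of_real (F (\<Phi> t x)) * k t)"
proof -
  have F: "continuous_map X euclideanreal F" by (rule continuous_uniform_limit_real[OF f lim])
  obtain B where B: "\<forall>x\<in>topspace X. \<bar>F x\<bar> \<le> B" using continuous_bounded[OF F] by blast
  obtain n0 where n0: "\<And>n y. n \<ge> n0 \<Longrightarrow> y \<in> topspace X \<Longrightarrow> dist (f n y) (F y) < 1"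
    using uniform_limitD[OF lim, of 1] by (auto simp: eventually_sequentially)
  note meas = borel_measurable_integrable[OF integrable_orbit_mult[OF _ x k]]
  have "(\<lambda>n. LINT t|lborel. complex_of_real (f (n + n0) (\<Phi> t x)) * k t) \<longlonglongrightarrow>
         (LINT t|lborel. complex_of_real (F (\<Phi> t x)) * k t)"
  proof (rule integral_dominated_convergence)
    show "integrable lborel (\<lambda>t. (B + 1) * norm (k t))" using k by simp
    show "AE t in lborel. (\<lambda>n. complex_of_real (f (n + n0) (\<Phi> t x)) * k t) \<longlonglongrightarrow> complex_of_real (F (\<Phi> t x)) * k t"
      using tendsto_uniform_limitI[OF lim flow_in[OF x]] by (intro AE_I2 tendsto_intros LIMSEQ_ignore_initial_segment)
    show "AE t in lborel. norm (complex_of_real (f (n + n0) (\<Phi> t x)) * k t) \<le> (B + 1) * norm (k t)" for n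
    proof (rule AE_I2)
      fix t
      have "\<bar>f (n + n0) (\<Phi> t x)\<bar> \<le> B + 1"
        using n0[of "n + n0" "\<Phi> t x"] B flow_in[OF x, of t] by (auto simp: dist_real_def)
      then show "norm (complex_of_real (f (n + n0) (\<Phi> t x)) * k t) \<le> (B + 1) * norm (k t)"
        by (simp add: norm_mult mult_right_mono)
    qed
  qed (rule meas f F)+
  then show ?thesis by (rule LIMSEQ_offset)
qed

lemma admissible_uniform_limit:
  assumes f: "\<And>n. admissible r \<delta> (f n)" and lim: "uniform_limit (topspace X) f F sequentially"
  shows "admissible r \<delta> F"
proof -
  have cf: "continuous_map X euclideanreal (f n)" for n using f by (simp add: admissible_def)
  have "(LINT t|lborel. complex_of_real (F (\<Phi> t x)) * k t) = 0"
    if x: "x \<in> topspace X" and k: "k \<in> null_kernels r \<delta>" for x k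
  proof -
    have "integrable lborel k" using k by (simp add: null_kernels_def)
    from integral_orbit_uniform_limit[OF cf lim x this]
    have "(\<lambda>n. 0) \<longlonglongrightarrow> (LINT t|lborel. complex_of_real (F (\<Phi> t x)) * k t)"
      using f x k by (simp add: admissible_def)
    from LIMSEQ_unique[OF this tendsto_const] show ?thesis .
  qed
  with continuous_uniform_limit_real[OF cf lim] show ?thesis by (simp add: admissible_def)
qed

text \<open>
  A sequence of perturbations, the \<open>n\<close>-th of which separates points at scale \<open>1 / n\<close>.  The
  tolerance \<open>\<tau> n\<close> bounds the sum of all later changes, and it is chosen so small that these
  cannot destroy the separation already achieved.
\<close>

lemma separating_limit:
  fixes \<kappa> :: "nat \<Rightarrow> 'a \<Rightarrow> complex"
  assumes step: "\<And>F \<gamma> \<epsilon>. admissible r \<delta> F \<Longrightarrow> \<gamma> > 0 \<Longrightarrow> \<epsilon> > 0 \<Longrightarrow>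
    \<exists>F' N \<eta>. admissible r \<delta> F' \<and> (\<forall>x\<in>topspace X. \<bar>F' x - F x\<bar> \<le> \<gamma>) \<and> N \<ge> 1 \<and> \<eta> > 0 \<and>
      separates_modulo (\<kappa> N) F' \<eta> \<epsilon>"
  shows "\<exists>F. admissible r \<delta> F \<and> (\<forall>x\<in>topspace X. \<bar>F x\<bar> \<le> 1 / 2) \<and>
    (\<forall>x\<in>topspace X. \<forall>y\<in>topspace X. (\<forall>n\<ge>1. \<kappa> n x = \<kappa> n y) \<longrightarrow> (\<forall>t. F (\<Phi> t x) = F (\<Phi> t y)) \<longrightarrow> x = y)"
proof -
  \<comment> \<open>A state consists of the current function and the tolerance for all later changes.\<close>
  define P where "P n z \<longleftrightarrow> admissible r \<delta> (fst z) \<and> 0 < snd z \<and> (n = 0 \<longrightarrow> z = ((\<lambda>_. 0), 1 / 2)) \<and>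
    (n > 0 \<longrightarrow> (\<exists>N\<ge>1. separates_modulo (\<kappa> N) (fst z) (2 * snd z) (1 / real n)))"
    for n :: nat and z :: "('a \<Rightarrow> real) \<times> real"
  define Q where "Q n z z' \<longleftrightarrow> (\<forall>x\<in>topspace X. \<bar>fst z' x - fst z x\<bar> \<le> snd z / 2) \<and> snd z' \<le> snd z / 2"
    for n :: nat and z z' :: "('a \<Rightarrow> real) \<times> real"
  have "\<exists>f. \<forall>n. P n (f n) \<and> Q n (f n) (f (Suc n))"
  proof (rule dependent_nat_choice)
    have "P 0 ((\<lambda>_. 0), 1 / 2)" by (simp add: P_def admissible_def)
    then show "\<exists>z. P 0 z" ..
    fix z n assume z: "P n z"
    then obtain F' N \<eta> where F': "admissible r \<delta> F'" "\<forall>x\<in>topspace X. \<bar>F' x - fst z x\<bar> \<le> snd z / 2"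
        "N \<ge> 1" "\<eta> > 0" "separates_modulo (\<kappa> N) F' \<eta> (1 / real (Suc n))"
      using step[of "fst z" "snd z / 2" "1 / real (Suc n)"] by (auto simp: P_def)
    define \<tau> where "\<tau> = min (snd z / 2) (\<eta> / 2)"
    have \<tau>: "0 < \<tau>" "2 * \<tau> \<le> \<eta>" "\<tau> \<le> snd z / 2" using z F' by (auto simp: \<tau>_def P_def)
    have "separates_modulo (\<kappa> N) F' (2 * \<tau>) (1 / real (Suc n))"
      using F'(5) \<tau>(2) unfolding separates_modulo_def by (meson order_trans)
    with F' \<tau> have "P (Suc n) (F', \<tau>) \<and> Q n z (F', \<tau>)" unfolding P_def Q_def by auto
    then show "\<exists>z'. P (Suc n) z' \<and> Q n z z'" ..
  qed
  then obtain f where f: "\<forall>n. P n (f n) \<and> Q n (f n) (f (Suc n))" ..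
  define G where "G n = fst (f n)" for n
  define \<tau> where "\<tau> n = snd (f n)" for n
  have adm: "admissible r \<delta> (G n)" and \<tau>pos: "0 < \<tau> n" for n
    using f by (auto simp: P_def G_def \<tau>_def)
  have f0: "f 0 = ((\<lambda>_. 0), 1 / 2)" using f by (simp add: P_def)
  have near: "\<bar>G (Suc n) x - G n x\<bar> \<le> \<tau> n / 2" if "x \<in> topspace X" for n x
    using f that by (simp add: Q_def G_def \<tau>_def)
  have half: "\<tau> (Suc n) \<le> \<tau> n / 2" for n
    using f by (simp add: Q_def \<tau>_def)
  have sep: "\<exists>N\<ge>1. separates_modulo (\<kappa> N) (G n) (2 * \<tau> n) (1 / real n)" if "n > 0" for n
    using f that by (simp add: P_def G_def \<tau>_def)
  have tele: "\<bar>G (i + j) x - G i x\<bar> \<le> \<tau> i - \<tau> (i + j)" if x: "x \<in> topspace X" for i j x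
  proof (induction j)
    case (Suc j)
    have "\<bar>G (i + Suc j) x - G i x\<bar> \<le> \<bar>G (Suc (i + j)) x - G (i + j) x\<bar> + \<bar>G (i + j) x - G i x\<bar>" by simp
    then show ?case using near[OF x, of "i + j"] half[of "i + j"] Suc by simp
  qed simp
  have \<tau>le: "\<tau> n \<le> (1 / 2) ^ n" for n
  proof (induction n)
    case (Suc n)
    then show ?case using half[of n] by simp
  qed (use f0 in \<open>simp add: \<tau>_def\<close>)
  have \<tau>lim: "\<tau> \<longlonglongrightarrow> 0"
  proof (rule tendsto_sandwich[where f = "\<lambda>_. 0" and h = "\<lambda>n. (1 / 2) ^ n"])
    show "(\<lambda>n. (1 / 2 :: real) ^ n) \<longlonglongrightarrow> 0" by (rule LIMSEQ_realpow_zero) auto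
  qed (use \<tau>pos \<tau>le less_imp_le in \<open>auto intro!: always_eventually\<close>)
  define F where "F x = lim (\<lambda>n. G n x)" for x
  have lim: "(\<lambda>n. G n x) \<longlonglongrightarrow> F x" if x: "x \<in> topspace X" for x
  proof -
    have "Cauchy (\<lambda>n. G n x)"
    proof (rule metric_CauchyI)
      fix e :: real assume "e > 0"
      then obtain M where M: "\<tau> M < e / 2"
        using order_tendstoD(2)[OF \<tau>lim, of "e / 2"] by (auto simp: eventually_sequentially)
      have "\<bar>G m x - G M x\<bar> \<le> \<tau> M" if "m \<ge> M" for m
        using tele[OF x, of M "m - M"] \<tau>pos[of m] that by simp
      then have "dist (G m x) (G n x) < e" if "m \<ge> M" "n \<ge> M" for m n
        using that M by (smt (verit) dist_real_def field_sum_of_halves)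
      then show "\<exists>M. \<forall>m\<ge>M. \<forall>n\<ge>M. dist (G m x) (G n x) < e" by blast
    qed
    then show ?thesis unfolding F_def by (simp add: Cauchy_convergent_iff convergent_LIMSEQ_iff)
  qed
  have close: "\<bar>F x - G i x\<bar> \<le> \<tau> i" if x: "x \<in> topspace X" for i x
  proof (rule LIMSEQ_le_const2)
    show "(\<lambda>n. \<bar>G n x - G i x\<bar>) \<longlonglongrightarrow> \<bar>F x - G i x\<bar>" by (intro tendsto_intros lim x)
    have "\<bar>G n x - G i x\<bar> \<le> \<tau> i" if "n \<ge> i" for n
      using tele[OF x, of i "n - i"] \<tau>pos[of n] that by simp
    then show "\<exists>N. \<forall>n\<ge>N. \<bar>G n x - G i x\<bar> \<le> \<tau> i" by blast
  qed
  have "uniform_limit (topspace X) G F sequentially"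
  proof (rule uniform_limitI)
    fix e :: real assume "e > 0"
    from order_tendstoD(2)[OF \<tau>lim this]
    show "\<forall>\<^sub>F n in sequentially. \<forall>x\<in>topspace X. dist (G n x) (F x) < e"
    proof eventually_elim
      case (elim n)
      show ?case
      proof
        fix x assume "x \<in> topspace X"
        then show "dist (G n x) (F x) < e"
          using close[of x n] elim by (simp add: dist_real_def abs_minus_commute)
      qed
    qed
  qed
  from admissible_uniform_limit[OF adm this] have "admissible r \<delta> F" .
  moreover have "\<bar>F x\<bar> \<le> 1 / 2" if "x \<in> topspace X" for x
    using close[OF that, of 0] f0 by (simp add: G_def \<tau>_def)
  moreover have "x = y"
    if x: "x \<in> topspace X" and y: "y \<in> topspace X" and ph: "\<forall>n\<ge>1. \<kappa> n x = \<kappa> n y"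
      and eq: "\<forall>t. F (\<Phi> t x) = F (\<Phi> t y)" for x y
  proof (rule ccontr)
    assume "x \<noteq> y"
    then have "d x y > 0"
      using dist_nonneg[of x y] Metric_space.zero[OF metric x y] by linarith
    then obtain n where n: "n > 0" "1 / real n < d x y"
      using ex_inverse_of_nat_less[of "d x y"] by (auto simp: inverse_eq_divide)
    obtain N where N: "N \<ge> 1" "separates_modulo (\<kappa> N) (G n) (2 * \<tau> n) (1 / real n)"
      using sep[OF n(1)] by blast
    have "\<bar>G n (\<Phi> t x) - G n (\<Phi> t y)\<bar> \<le> 2 * \<tau> n" for t
      using close[OF flow_in[OF x], of t n] close[OF flow_in[OF y], of t n] eq by (auto simp: abs_le_iff)
    then have "d x y < 1 / real n"
      using N ph x y by (simp add: separates_modulo_def)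
    with n show False by simp
  qed
  ultimately show ?thesis by blast
qed

end

section \<open>Wave series\<close>

locale wave_series = metric_flow X d \<Phi>
  for X :: "'a topology" and d and \<Phi> +
  fixes \<omega> :: "nat \<Rightarrow> real" and z :: "nat \<Rightarrow> 'a \<Rightarrow> complex"
  assumes z: "\<And>i. continuous_map X euclidean (z i)" "\<And>i x. x \<in> topspace X \<Longrightarrow> norm (z i x) = 1"
    and z_flow: "\<And>i x t. x \<in> topspace X \<Longrightarrow> z i (\<Phi> t x) = cis (\<omega> i * t) * z i x"
begin

text \<open>
  The weights only need to be positive and summable; with these the total is \<open>1 / 2\<close>.
\<close>

definition waves :: "'a \<Rightarrow> real" where
  "waves x = (\<Sum>i. (1 / 2) ^ (i + 2) * Re (z i x))"

lemma summable_weights: "summable (\<lambda>i. (1 / 2 :: real) ^ (i + 2))"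
  by (intro summable_ignore_initial_segment summable_geometric) simp

lemma term_le:
  assumes "x \<in> topspace X"
  shows "norm ((1 / 2) ^ (i + 2) * Re (z i x)) \<le> (1 / 2 :: real) ^ (i + 2)"
  using abs_Re_le_cmod[of "z i x"] z(2)[OF assms, of i] by (simp add: abs_mult)

lemma uniform_limit_waves:
  "uniform_limit (topspace X) (\<lambda>n x. \<Sum>i<n. (1 / 2) ^ (i + 2) * Re (z i x)) waves sequentially"
  unfolding waves_def[abs_def] by (rule Weierstrass_m_test[OF term_le summable_weights])

lemma continuous_partial_sum:
  "continuous_map X euclideanreal (\<lambda>x. \<Sum>i<n. (1 / 2) ^ (i + 2) * Re (z i x))"
proof (rule continuous_map_sum)
  fix i
  have "continuous_map euclidean euclideanreal Re"
    by (simp add: continuous_map_iff_continuous2 continuous_on_Re)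
  from continuous_map_compose[OF z(1) this]
  show "continuous_map X euclideanreal (\<lambda>x. (1 / 2) ^ (i + 2) * Re (z i x))"
    by (intro continuous_map_real_mult) (simp_all add: o_def)
qed simp

lemma continuous_waves: "continuous_map X euclideanreal waves"
  by (rule continuous_uniform_limit_real[OF continuous_partial_sum uniform_limit_waves])

lemma abs_waves_le:
  assumes "x \<in> topspace X"
  shows "\<bar>waves x\<bar> \<le> 1 / 2"
proof -
  have "norm (waves x) \<le> (\<Sum>i. (1 / 2 :: real) ^ (i + 2))"
    unfolding waves_def by (rule norm_suminf_le[OF term_le[OF assms] summable_weights])
  also have "\<dots> = 1 / 2"
  proof -
    have "(\<lambda>i. (1 / 2 :: real) ^ i * (1 / 4)) sums (1 / (1 - 1 / 2) * (1 / 4))"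
      by (intro sums_mult2 geometric_sums) simp
    then have "(\<lambda>i. (1 / 2 :: real) ^ (i + 2)) sums (1 / 2)" by (simp add: power_add power2_eq_square)
    then show ?thesis by (rule sums_unique[symmetric])
  qed
  finally show ?thesis by simp
qed

lemma integral_waves_sums:
  assumes x: "x \<in> topspace X" and k: "integrable lborel k"
  shows "(\<lambda>i. of_real ((1 / 2) ^ (i + 3)) * (z i x * (LINT t|lborel. cis (\<omega> i * t) * k t) +
             cnj (z i x) * (LINT t|lborel. cis (- \<omega> i * t) * k t)))
     sums (LINT t|lborel. complex_of_real (waves (\<Phi> t x)) * k t)"
proof -
  have int: "integrable lborel (\<lambda>t. cis (c * t) * k t)" for c
    using integrable_mult_bounded[OF k, of "\<lambda>t. cis (c * t)" 1] by (simp add: mult.commute)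
  define a where "a i = of_real ((1 / 2) ^ (i + 3)) * (z i x * (LINT t|lborel. cis (\<omega> i * t) * k t) +
             cnj (z i x) * (LINT t|lborel. cis (- \<omega> i * t) * k t))" for i
  define g where "g i t = of_real ((1 / 2) ^ (i + 3)) * (z i x * (cis (\<omega> i * t) * k t) +
             cnj (z i x) * (cis (- \<omega> i * t) * k t))" for i t
  have ga: "integrable lborel (g i)" "(LINT t|lborel. g i t) = a i" for i
    unfolding g_def a_def
    by (intro integrable_mult_right Bochner_Integration.integrable_add int)
       (simp only: integral_mult_right_zero Bochner_Integration.integral_add[OF integrable_mult_right[OF int] integrable_mult_right[OF int]])
  have eq: "complex_of_real ((1 / 2) ^ (i + 2) * Re (z i (\<Phi> t x))) * k t = g i t" for i t
  proof -
    have "complex_of_real (Re w) = (w + cnj w) / 2" for w by (simp add: complex_eq_iff)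
    from this[of "cis (\<omega> i * t) * z i x"]
    have R: "complex_of_real (Re (z i (\<Phi> t x))) = (cis (\<omega> i * t) * z i x + cis (- \<omega> i * t) * cnj (z i x)) / 2"
      by (simp only: z_flow[OF x] complex_cnj_mult cis_cnj mult_minus_left)
    define c where "c = complex_of_real ((1 / 2) ^ (i + 2))"
    have c3: "complex_of_real ((1 / 2) ^ (i + 3)) = c / 2"
      by (simp add: c_def power_add power2_eq_square power3_eq_cube)
    show ?thesis unfolding g_def of_real_mult R c3 c_def[symmetric] by (simp add: algebra_simps)
  qed
  have "(LINT t|lborel. complex_of_real (\<Sum>i<n. (1 / 2) ^ (i + 2) * Re (z i (\<Phi> t x))) * k t) = (\<Sum>i<n. a i)" for n
  proof -
    have "(LINT t|lborel. complex_of_real (\<Sum>i<n. (1 / 2) ^ (i + 2) * Re (z i (\<Phi> t x))) * k t) = (LINT t|lborel. (\<Sum>i<n. g i t))"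
      by (simp only: of_real_sum sum_distrib_right eq)
    also have "\<dots> = (\<Sum>i<n. a i)"
      using ga by (simp add: Bochner_Integration.integral_sum)
    finally show ?thesis .
  qed
  with integral_orbit_uniform_limit[OF continuous_partial_sum uniform_limit_waves x k]
  show ?thesis unfolding sums_def a_def[symmetric] by simp
qed

lemma integral_waves_eq_0:
  assumes "x \<in> topspace X" "integrable lborel k"
    and "\<And>i. (LINT t|lborel. cis (\<omega> i * t) * k t) = 0" "\<And>i. (LINT t|lborel. cis (- \<omega> i * t) * k t) = 0"
  shows "(LINT t|lborel. complex_of_real (waves (\<Phi> t x)) * k t) = 0"
  using integral_waves_sums[OF assms(1,2)] assms(3,4) by (simp add: sums_iff)

lemma integral_waves_wave_kernel:
  assumes x: "x \<in> topspace X" and \<delta>: "\<delta> > 0"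
    and iso: "\<And>i. i \<noteq> j \<Longrightarrow> 2 * \<delta> < \<bar>\<omega> j - \<omega> i\<bar>" "\<And>i. 2 * \<delta> < \<bar>\<omega> j + \<omega> i\<bar>"
  shows "(LINT t|lborel. complex_of_real (waves (\<Phi> t x)) * wave_kernel \<delta> (\<omega> j) t) =
     of_real ((1 / 2) ^ (j + 3) * (sinc_energy / \<delta>)) * z j x"
proof -
  have minus: "(LINT t|lborel. cis (- \<omega> i * t) * wave_kernel \<delta> (\<omega> j) t) = 0" for i
    using integral_cis_wave_kernel(2)[OF \<delta>, of "\<omega> j" "- \<omega> i"] iso(2)[of i] by simp
  have plus: "(LINT t|lborel. cis (\<omega> i * t) * wave_kernel \<delta> (\<omega> j) t) =
      (if i = j then complex_of_real (sinc_energy / \<delta>) else 0)" for i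
    using integral_cis_wave_kernel[OF \<delta>] iso(1)[of i] by auto
  have "(\<lambda>i. if i = j then of_real ((1 / 2) ^ (i + 3) * (sinc_energy / \<delta>)) * z i x else 0) sums
      (LINT t|lborel. complex_of_real (waves (\<Phi> t x)) * wave_kernel \<delta> (\<omega> j) t)"
    using integral_waves_sums[OF x integrable_wave_kernel[OF \<delta>, of "\<omega> j"]] unfolding minus plus
    by (rule back_subst[of "\<lambda>s. s sums _"]) (auto simp: fun_eq_iff)
  moreover have "(\<lambda>i. if i = j then of_real ((1 / 2) ^ (i + 3) * (sinc_energy / \<delta>)) * z i x else 0) sums
      (of_real ((1 / 2) ^ (j + 3) * (sinc_energy / \<delta>)) * z j x)"
    using sums_single[of j "\<lambda>i. of_real ((1 / 2) ^ (i + 3) * (sinc_energy / \<delta>)) * z i x"] .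
  ultimately show ?thesis by (rule sums_unique2)
qed

end

section \<open>Frequencies for the solenoid\<close>

lemma positive_rational_between:
  fixes a b :: real
  assumes "0 \<le> a" "a < b"
  obtains p q :: nat where "p > 0" "q > 0" "a < real p / real q" "real p / real q < b"
proof -
  obtain x where x: "x \<in> \<rat>" "a < x" "x < b" using Rats_dense_in_real[OF assms(2)] by blast
  obtain p q :: nat where pq: "q \<noteq> 0" "\<bar>x\<bar> = real p / real q" using Rats_abs_nat_div_natE[OF x(1)] by metis
  have "\<bar>x\<bar> = x" using x assms by simp
  moreover have "p \<noteq> 0" using pq x assms by (intro notI) auto
  ultimately show thesis using that[of p q] pq x by simp
qed

text \<open>
  In a strictly decreasing sequence every term has a gap on both sides, even though the
  sequence accumulates at its limit.
\<close>

lemma isolated_terms: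
  fixes \<omega> :: "nat \<Rightarrow> real"
  assumes dec: "\<And>i. \<omega> (Suc i) < \<omega> i" and b: "0 \<le> b" "\<And>i. b < \<omega> i"
  obtains \<delta> where "\<delta> > 0" "b + 2 * \<delta> < \<omega> j" "\<And>i. i \<noteq> j \<Longrightarrow> 2 * \<delta> < \<bar>\<omega> j - \<omega> i\<bar>"
    "\<And>i. 2 * \<delta> < \<bar>\<omega> j + \<omega> i\<bar>"
proof -
  have anti: "\<omega> k < \<omega> i" if "i < k" for i k
    using that by (induction k) (auto simp: less_Suc_eq intro: dec less_trans[OF dec])
  \<comment> \<open>The first term has no left neighbour; the value \<open>1\<close> stands for the missing gap.\<close>
  define \<delta> where "\<delta> = Min {\<omega> j - b, \<omega> j - \<omega> (Suc j), (if j = 0 then 1 else \<omega> (j - 1) - \<omega> j)} / 4"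
  have pos: "\<delta> > 0" using anti[of "j - 1" j] dec[of j] b(2)[of j] by (auto simp: \<delta>_def)
  have le: "4 * \<delta> \<le> \<omega> j - b" "4 * \<delta> \<le> \<omega> j - \<omega> (Suc j)" "j > 0 \<Longrightarrow> 4 * \<delta> \<le> \<omega> (j - 1) - \<omega> j"
    by (auto simp: \<delta>_def)
  show thesis
  proof (rule that[OF pos])
    show "b + 2 * \<delta> < \<omega> j" using le pos by linarith
    show "2 * \<delta> < \<bar>\<omega> j - \<omega> i\<bar>" if "i \<noteq> j" for i
    proof (cases "i < j")
      case True
      then have "i = j - 1 \<or> i < j - 1" by linarith
      then have "\<omega> (j - 1) \<le> \<omega> i" using anti[of i "j - 1"] by auto
      then show ?thesis using le(3) pos True by auto
    next
      case False
      then have "i = Suc j \<or> Suc j < i" using that by linarith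
      then have "\<omega> i \<le> \<omega> (Suc j)" using anti[of "Suc j" i] by auto
      then show ?thesis using le(2) pos by auto
    qed
    show "2 * \<delta> < \<bar>\<omega> j + \<omega> i\<bar>" for i using le pos b(1) b(2)[of i] b(2)[of j] by auto
  qed
qed

context metric_flow
begin

text \<open>
  Choose a rational \<open>\<rho>\<close> with \<open>2 \<pi> \<rho>\<close> between \<open>b\<close> and \<open>c\<close>, and use in turn the frequencies
  \<open>2 \<pi> (\<rho> + 2 / n!)\<close> and \<open>2 \<pi> (\<rho> + 1 / n!)\<close> for all large \<open>n\<close>.  The quotient of the two
  characters for the same \<open>n\<close> is \<open>\<kappa> n\<close>, which determines all \<open>\<kappa> k\<close> with \<open>k < n\<close>.
\<close>

lemma separating_characters:
  fixes \<kappa> :: "nat \<Rightarrow> 'a \<Rightarrow> complex"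
  assumes \<kappa>: "\<And>n. n \<ge> 1 \<Longrightarrow> continuous_map X euclidean (\<kappa> n)"
      "\<And>n x. n \<ge> 1 \<Longrightarrow> x \<in> topspace X \<Longrightarrow> norm (\<kappa> n x) = 1"
      "\<And>n x t. n \<ge> 1 \<Longrightarrow> x \<in> topspace X \<Longrightarrow> \<kappa> n (\<Phi> t x) = cis (2 * pi * t / fact n) * \<kappa> n x"
      "\<And>n x. n \<ge> 1 \<Longrightarrow> x \<in> topspace X \<Longrightarrow> \<kappa> n x = \<kappa> (Suc n) x ^ Suc n"
    and b: "0 \<le> b" "b < c"
  shows "\<exists>\<omega> z c'. wave_series X d \<Phi> \<omega> z \<and> (\<forall>i. \<omega> (Suc i) < \<omega> i) \<and> (\<forall>i. b < \<omega> i) \<and> (\<forall>i. \<omega> i \<le> c') \<and> c' < c \<and>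
    (\<forall>x\<in>topspace X. \<forall>y\<in>topspace X. (\<forall>i. z i x = z i y) \<longrightarrow> (\<forall>n\<ge>1. \<kappa> n x = \<kappa> n y))"
proof -
  obtain p q :: nat where pq: "p > 0" "q > 0" "b / (2 * pi) < real p / real q" "real p / real q < c / (2 * pi)"
    using positive_rational_between[of "b / (2 * pi)" "c / (2 * pi)"] b by (auto simp: divide_strict_right_mono)
  define \<rho> where "\<rho> = real p / real q"
  have \<rho>: "b < 2 * pi * \<rho>" "2 * pi * \<rho> < c" using pq by (simp_all add: \<rho>_def field_simps)
  define g where "g = c / (2 * pi) - \<rho>"
  have "g > 0" using pq by (simp add: g_def \<rho>_def)
  obtain n1 :: nat where n1: "2 / g < real n1" using reals_Archimedean2 by blast
  define N where "N = max n1 (max q 2)"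
  have "real N \<le> real (fact N)" by (rule of_nat_mono[OF fact_ge_self])
  moreover have "real n1 \<le> real N" by (simp add: N_def)
  ultimately have "2 / g < fact N" using n1 by simp
  then have Ng: "2 / fact N < g" using \<open>g > 0\<close> by (simp add: field_simps)
  have N: "N \<ge> 2" "q \<le> N" by (auto simp: N_def)
  then have "q dvd fact N" using pq(2) by (intro dvd_fact) auto
  then have "fact N = q * (fact N div q)" by simp
  then have "fact N div q \<noteq> 0" "(fact N :: real) = real q * real (fact N div q)"
    by (metis fact_nonzero mult_zero_right, metis of_nat_fact of_nat_mult)
  then have \<rho>N: "\<rho> = real (p * (fact N div q)) / fact N" using pq(2) by (simp add: \<rho>_def field_simps)
  define e where "e i = (if even i then 2 else 1 :: nat)" for i :: nat
  define m where "m i = N + i div 2" for i :: nat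
  have m1: "m i \<ge> 1" for i using N by (simp add: m_def)
  have N1: "N \<ge> 1" using N by simp
  define \<omega> where "\<omega> i = 2 * pi * (\<rho> + real (e i) / fact (m i))" for i
  define z where "z i x = \<kappa> N x ^ (p * (fact N div q)) * \<kappa> (m i) x ^ e i" for i x
  have "wave_series X d \<Phi> \<omega> z"
  proof
    show "continuous_map X euclidean (z i)" for i
    proof -
      have "continuous_map X (prod_topology euclidean euclidean) (\<lambda>x. (\<kappa> N x, \<kappa> (m i) x))"
        unfolding continuous_map_pairwise o_def fst_conv snd_conv
        using \<kappa>(1)[OF N1] \<kappa>(1)[OF m1[of i]] by simp
      moreover have "continuous_map (prod_topology euclidean euclidean) euclidean
          (\<lambda>w::complex \<times> complex. fst w ^ (p * (fact N div q)) * snd w ^ e i)"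
        by (auto simp: continuous_map_iff_continuous2 intro!: continuous_intros)
      ultimately have "continuous_map X euclidean ((\<lambda>w. fst w ^ (p * (fact N div q)) * snd w ^ e i) \<circ> (\<lambda>x. (\<kappa> N x, \<kappa> (m i) x)))"
        by (rule continuous_map_compose)
      then show ?thesis by (simp only: z_def[abs_def] o_def fst_conv snd_conv)
    qed
    show "norm (z i x) = 1" if "x \<in> topspace X" for i x
      using that \<kappa>(2)[OF N1] \<kappa>(2)[OF m1[of i]] by (simp add: z_def norm_mult norm_power)
    show "z i (\<Phi> t x) = cis (\<omega> i * t) * z i x" if x: "x \<in> topspace X" for i x t
    proof -
      have "z i (\<Phi> t x) = (cis (2 * pi * t / fact N) ^ (p * (fact N div q)) * cis (2 * pi * t / fact (m i)) ^ e i) * z i x"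
        unfolding z_def \<kappa>(3)[OF N1 x] \<kappa>(3)[OF m1 x] by (simp add: power_mult_distrib)
      also have "cis (2 * pi * t / fact N) ^ (p * (fact N div q)) * cis (2 * pi * t / fact (m i)) ^ e i =
          cis (real (p * (fact N div q)) * (2 * pi * t / fact N) + real (e i) * (2 * pi * t / fact (m i)))"
        by (simp only: Complex.DeMoivre cis_mult)
      also have "real (p * (fact N div q)) * (2 * pi * t / fact N) + real (e i) * (2 * pi * t / fact (m i)) = \<omega> i * t"
        unfolding \<omega>_def \<rho>N by (simp add: algebra_simps add_divide_distrib)
      finally show ?thesis .
    qed
  qed
  moreover have "\<omega> (Suc i) < \<omega> i" for i
  proof (cases "even i")
    case True
    then have "m (Suc i) = m i" "e (Suc i) = 1" "e i = 2" by (auto simp: m_def e_def)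
    then show ?thesis by (simp add: \<omega>_def divide_strict_right_mono)
  next
    case False
    then have *: "m (Suc i) = Suc (m i)" "e (Suc i) = 2" "e i = 1" by (auto simp: m_def e_def elim!: oddE)
    have "m i \<ge> 2" using N by (simp add: m_def)
    then have "2 / real (Suc (m i)) < 1" by simp
    then have "2 / real (Suc (m i)) / fact (m i) < 1 / fact (m i)" by (rule divide_strict_right_mono) simp
    then show ?thesis by (simp add: \<omega>_def * mult.commute)
  qed
  moreover have "b < \<omega> i" for i
  proof -
    have "0 < real (e i) / fact (m i)" by (simp add: e_def)
    then have "2 * pi * \<rho> < \<omega> i" by (simp add: \<omega>_def)
    with \<rho> show ?thesis by linarith
  qed
  moreover have "\<omega> i \<le> 2 * pi * (\<rho> + 2 / fact N)" for i
  proof -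
    have "real (e i) / fact (m i) \<le> 2 / fact N"
      by (intro frac_le) (auto simp: e_def m_def intro!: fact_mono)
    then show ?thesis by (simp add: \<omega>_def)
  qed
  moreover have "2 * pi * (\<rho> + 2 / fact N) < c"
  proof -
    have "\<rho> + 2 / fact N < c / (2 * pi)" using Ng by (simp add: g_def)
    then have "2 * pi * (\<rho> + 2 / fact N) < 2 * pi * (c / (2 * pi))" by (intro mult_strict_left_mono) auto
    then show ?thesis by simp
  qed
  moreover have "\<kappa> n x = \<kappa> n y"
    if x: "x \<in> topspace X" and y: "y \<in> topspace X" and zz: "\<And>i. z i x = z i y" and n: "n \<ge> 1" for x y n
  proof -
    have big: "\<kappa> (N + l) x = \<kappa> (N + l) y" for l
    proof -
      have nz: "\<kappa> j w \<noteq> 0" if "j \<ge> 1" "w \<in> topspace X" for j w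
        using \<kappa>(2)[OF that] by auto
      have "z (2 * l) w = z (Suc (2 * l)) w * \<kappa> (N + l) w" for w
        by (simp add: z_def e_def m_def power2_eq_square)
      then have "z (Suc (2 * l)) x * \<kappa> (N + l) x = z (Suc (2 * l)) x * \<kappa> (N + l) y"
        using zz by metis
      moreover have "z (Suc (2 * l)) x \<noteq> 0" using nz[OF N1 x] nz[OF m1 x] by (simp add: z_def)
      ultimately show ?thesis by simp
    qed
    have "\<kappa> (N - l) x = \<kappa> (N - l) y" if "l < N" for l
      using that
    proof (induction l)
      case 0
      then show ?case using big[of 0] by simp
    next
      case (Suc l)
      then have 1: "Suc (N - Suc l) = N - l" "N - Suc l \<ge> 1" by auto
      have "\<kappa> (N - l) x = \<kappa> (N - l) y" using Suc by simp
      then show ?case using \<kappa>(4)[OF 1(2) x] \<kappa>(4)[OF 1(2) y] unfolding 1(1) by simp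
    qed
    from this[of "N - n"] big[of "n - N"] n show ?thesis by (cases "n \<le> N") auto
  qed
  ultimately show ?thesis by blast
qed

section \<open>Continuity into the space of band-limited functions\<close>

lemma band_limited_dist_le:
  assumes f: "f \<in> band_limited a" and g: "g \<in> band_limited a"
    and e: "\<And>t. \<bar>t\<bar> \<le> real n \<Longrightarrow> \<bar>f t - g t\<bar> \<le> e"
  shows "band_limited_dist a f g \<le> e + 2 * (1 / 2) ^ n"
proof -
  define s where "s i = (SUP t\<in>{- real (Suc i)..real (Suc i)}. \<bar>f t - g t\<bar>)" for i
  have fg: "\<bar>f t - g t\<bar> \<le> 2" for t
  proof -
    have "\<bar>f t\<bar> \<le> 1" "\<bar>g t\<bar> \<le> 1" using f g by (auto simp: band_limited_def)
    then show ?thesis by linarith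
  qed
  have s2: "s i \<le> 2" for i unfolding s_def using fg by (intro cSUP_least) auto
  have s0: "0 \<le> s i" for i
  proof -
    have "bdd_above ((\<lambda>t. \<bar>f t - g t\<bar>) ` {- real (Suc i)..real (Suc i)})" using fg by (auto intro!: bdd_aboveI2)
    then have "\<bar>f 0 - g 0\<bar> \<le> s i" unfolding s_def by (intro cSUP_upper) auto
    then show ?thesis by linarith
  qed
  have e0: "0 \<le> e" using e[of 0] by simp
  have se: "s i \<le> e" if "i < n" for i unfolding s_def using that by (intro cSUP_least e) auto
  define h where "h i = (1 / 2) ^ Suc i * s i" for i
  have hle: "h i \<le> (1 / 2) ^ Suc i * 2" for i unfolding h_def using s2 by (intro mult_left_mono) auto
  have h0: "0 \<le> h i" for i unfolding h_def using s0 by simp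
  have geo: "(\<lambda>i. (1 / 2 :: real) ^ i) sums 2" using geometric_sums[of "1 / 2 :: real"] by simp
  have sh: "summable h"
    by (rule summable_comparison_test'[OF sums_summable[OF geo], of 0]) (use hle h0 in auto)
  have "band_limited_dist a f g = suminf h"
    using f g unfolding band_limited_dist_def h_def s_def by simp
  also have "\<dots> = (\<Sum>i. h (i + n)) + (\<Sum>i<n. h i)" by (rule suminf_split_initial_segment[OF sh])
  also have "(\<Sum>i. h (i + n)) \<le> (\<Sum>i. (1 / 2) ^ n * (1 / 2 :: real) ^ i)"
  proof (rule suminf_le)
    show "h (i + n) \<le> (1 / 2) ^ n * (1 / 2) ^ i" for i using hle[of "i + n"] by (simp add: power_add mult.commute)
    show "summable (\<lambda>i. h (i + n))" using sh by (rule summable_ignore_initial_segment)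
    show "summable (\<lambda>i. (1 / 2) ^ n * (1 / 2 :: real) ^ i)" using geo by (intro summable_mult sums_summable)
  qed
  also have "\<dots> = (1 / 2) ^ n * 2" using sums_unique[OF sums_mult[OF geo, of "(1 / 2) ^ n"]] by simp
  also have "(\<Sum>i<n. h i) \<le> (\<Sum>i<n. (1 / 2) ^ Suc i * e)"
    unfolding h_def using se by (intro sum_mono mult_left_mono) auto
  also have "\<dots> \<le> e"
  proof -
    have "(\<Sum>i<n. (1 / 2 :: real) ^ i) \<le> 2"
      using sum_le_suminf[OF sums_summable[OF geo], of "{..<n}"] sums_unique[OF geo] by simp
    then have "(\<Sum>i<n. (1 / 2 :: real) ^ i) * (e / 2) \<le> 2 * (e / 2)" using e0 by (intro mult_right_mono) auto
    moreover have "(\<Sum>i<n. (1 / 2) ^ Suc i * e) = (\<Sum>i<n. (1 / 2 :: real) ^ i) * (e / 2)"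
      by (simp add: sum_distrib_right)
    ultimately show ?thesis by simp
  qed
  finally show ?thesis by (simp add: mult.commute)
qed

lemma continuous_orbit_map:
  assumes F: "continuous_map X euclideanreal F"
    and mem: "\<And>x. x \<in> topspace X \<Longrightarrow> (\<lambda>t. F (\<Phi> t x)) \<in> band_limited a"
  shows "continuous_map X (band_limited_topology a) (\<lambda>x t. F (\<Phi> t x))"
proof -
  interpret B: Metric_space "band_limited a" "band_limited_dist a" by (rule Metric_space_band_limited)
  show ?thesis
    unfolding band_limited_topology_def B.continuous_map_to_metric
  proof (intro ballI allI impI)
    fix x and \<epsilon> :: real assume x: "x \<in> topspace X" and \<epsilon>: "\<epsilon> > 0"
    obtain n where n: "(1 / 2) ^ n < \<epsilon> / 4" using real_arch_pow_inv[of "\<epsilon> / 4" "1 / 2"] \<epsilon> by auto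
    define P where "P = prod_topology euclideanreal X"
    define W where "W = {p \<in> topspace P. \<bar>F (\<Phi> (fst p) (snd p)) - F (\<Phi> (fst p) x)\<bar> < \<epsilon> / 2}"
    have c: "continuous_map P euclideanreal fst" "continuous_map P X snd"
      unfolding P_def by (rule continuous_map_fst continuous_map_snd)+
    have cx: "continuous_map P X (\<lambda>p. x)" using x by simp
    have "continuous_map P euclideanreal (\<lambda>p. \<bar>F (\<Phi> (fst p) (snd p)) - F (\<Phi> (fst p) x)\<bar>)"
      using continuous_map_compose[OF continuous_flow_compose[OF c] F]
        continuous_map_compose[OF continuous_flow_compose[OF c(1) cx] F]
      by (intro continuous_map_real_abs continuous_map_diff) (simp_all add: o_def)
    then have "openin P W" unfolding W_def
      by (rule openin_less_of_continuous) simp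
    moreover have "compactin euclideanreal {- real n..real n}" by simp
    moreover have "{- real n..real n} \<times> {x} \<subseteq> W" using x \<epsilon> by (auto simp: W_def P_def)
    ultimately obtain U V where UV: "openin X V" "{- real n..real n} \<subseteq> U" "x \<in> V" "U \<times> V \<subseteq> W"
      using tube_lemma_left[of euclideanreal X W "{- real n..real n}" x] x by (auto simp: P_def)
    show "\<exists>U. openin X U \<and> x \<in> U \<and> (\<forall>y\<in>U. (\<lambda>t. F (\<Phi> t y)) \<in> B.mball (\<lambda>t. F (\<Phi> t x)) \<epsilon>)"
    proof (intro exI[of _ V] conjI ballI UV)
      fix y assume yV: "y \<in> V"
      then have y: "y \<in> topspace X" using UV(1) openin_subset by blast
      have "\<bar>F (\<Phi> t x) - F (\<Phi> t y)\<bar> \<le> \<epsilon> / 2" if "\<bar>t\<bar> \<le> real n" for t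
      proof -
        have "t \<in> U" using UV(2) that by (auto simp: abs_le_iff)
        then have "(t, y) \<in> W" using UV(4) yV by blast
        then show ?thesis by (simp add: W_def abs_minus_commute)
      qed
      then have "band_limited_dist a (\<lambda>t. F (\<Phi> t x)) (\<lambda>t. F (\<Phi> t y)) \<le> \<epsilon> / 2 + 2 * (1 / 2) ^ n"
        by (intro band_limited_dist_le mem x y)
      also have "\<dots> < \<epsilon>" using n by simp
      finally show "(\<lambda>t. F (\<Phi> t y)) \<in> B.mball (\<lambda>t. F (\<Phi> t x)) \<epsilon>"
        using mem x y by simp
    qed
  qed
qed

end

lemma band_limitedI:
  assumes "continuous_on UNIV f" "\<And>t. \<bar>f t\<bar> \<le> 1"
    and "\<And>\<phi>. \<phi> \<in> test_functions_on (- {- (a / 2)..a / 2}) \<Longrightarrow>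
      (LINT t|lborel. complex_of_real (f t) * fourier \<phi> t) = 0"
  shows "f \<in> band_limited a"
proof -
  define U where "U = - {- (a / 2)..a / 2}"
  have "open U" unfolding U_def by (simp add: open_Compl)
  moreover have "\<forall>\<phi>\<in>test_functions_on U. fourier_distribution (distribution_of f) \<phi> = 0"
    using assms(3) by (simp add: U_def fourier_distribution_def distribution_of_def)
  ultimately have "U \<subseteq> \<Union>{U. open U \<and> (\<forall>\<phi>\<in>test_functions_on U. fourier_distribution (distribution_of f) \<phi> = 0)}"
    by blast
  then have "distribution_support (fourier_distribution (distribution_of f)) \<subseteq> {- (a / 2)..a / 2}"
    unfolding distribution_support_def U_def by blast
  then show ?thesis using assms(1,2) by (simp add: band_limited_def)
qed

section \<open>The embedding theorem\<close>

theorem corollary1p3: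
  fixes a :: real
    and X :: "'a topology"
    and d :: "'a \<Rightarrow> 'a \<Rightarrow> real"
    and \<Phi> :: "real \<Rightarrow> 'a \<Rightarrow> 'a"
  assumes "a > 0"
    and "Metric_space (topspace X) d"
    and "Metric_space.mtopology (topspace X) d = X"
    and "topological_flow X \<Phi>"
    and "flow_extension X \<Phi> solenoid solenoid_flow"
    and "mdim X d \<Phi> < ereal (a / 2)"
  shows "\<exists>h. continuous_map X (band_limited_topology a) h \<and>
             inj_on h (topspace X) \<and>
             (\<forall>x\<in>topspace X. \<forall>r. h (\<Phi> r x) = shift r (h x))"
proof -
  interpret metric_flow X d \<Phi> by (rule metric_flow.intro[OF assms(2,3,4)])
  have ne: "topspace X \<noteq> {}" by (rule solenoid_extension_characters(1)[OF assms(5)])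
  obtain \<kappa> where \<kappa>0: "(\<forall>n\<ge>1. continuous_map X euclidean (\<kappa> n)) \<and>
       (\<forall>n\<ge>1. \<forall>x\<in>topspace X. norm (\<kappa> n x) = 1) \<and>
       (\<forall>n\<ge>1. \<forall>x\<in>topspace X. \<forall>t. \<kappa> n (\<Phi> t x) = cis (2 * pi * t / fact n) * \<kappa> n x) \<and>
       (\<forall>n\<ge>1. \<forall>x\<in>topspace X. \<kappa> n x = \<kappa> (Suc n) x ^ Suc n)"
    using solenoid_extension_characters(2)[OF assms(5)] ..
  have \<kappa>: "\<And>n. n \<ge> 1 \<Longrightarrow> continuous_map X euclidean (\<kappa> n)"
      "\<And>n x. n \<ge> 1 \<Longrightarrow> x \<in> topspace X \<Longrightarrow> norm (\<kappa> n x) = 1"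
      "\<And>n x t. n \<ge> 1 \<Longrightarrow> x \<in> topspace X \<Longrightarrow> \<kappa> n (\<Phi> t x) = cis (2 * pi * t / fact n) * \<kappa> n x"
      "\<And>n x. n \<ge> 1 \<Longrightarrow> x \<in> topspace X \<Longrightarrow> \<kappa> n x = \<kappa> (Suc n) x ^ Suc n"
    using \<kappa>0 by blast+
  obtain c where c: "c < a / 2" and dims: "\<And>\<epsilon>. \<epsilon> > 0 \<Longrightarrow>
      \<exists>R0>0. \<forall>R\<ge>R0. \<exists>K f n. small_fibres \<epsilon> R K f \<and> covering_dim_le K (int n) \<and> real n < c * R"
    using mdim_less_imp_linear_Widim[OF ne assms(6)] by metis
  \<comment> \<open>The sampling rate \<open>r\<close> leaves the band between \<open>\<beta>\<close> and \<open>pi * a\<close> to the solenoid.\<close>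
  obtain p q :: nat where pq: "p > 0" "q > 0" "max 0 (2 * c) < real p / real q" "real p / real q < a"
    using positive_rational_between[of "max 0 (2 * c)" a] c assms(1) by auto
  define r where "r = real p / real q"
  have r: "r = real p / real q" "0 < r" "2 * c < r" "r < a" using pq by (simp_all add: r_def)
  define \<delta> where "\<delta> = pi * (a - r) / 4"
  have \<delta>: "\<delta> > 0" using r by (simp add: \<delta>_def)
  define \<beta> where "\<beta> = pi * r + 2 * \<delta>"
  have \<beta>: "0 \<le> \<beta>" "\<beta> < pi * a" using r(2-4) \<delta> by (simp_all add: \<beta>_def \<delta>_def field_simps)
  obtain F where F: "admissible r \<delta> F" "\<forall>x\<in>topspace X. \<bar>F x\<bar> \<le> 1 / 2"
    and Fsep: "\<forall>x\<in>topspace X. \<forall>y\<in>topspace X. (\<forall>n\<ge>1. \<kappa> n x = \<kappa> n y) \<longrightarrow> (\<forall>t. F (\<Phi> t x) = F (\<Phi> t y)) \<longrightarrow> x = y"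
    using separating_limit[of r \<delta> \<kappa>, OF separating_perturbation[OF dims r(1) pq(1,2) r(3) \<delta> \<kappa>(1,2,3)]] by blast
  have "\<exists>\<omega> z c'. wave_series X d \<Phi> \<omega> z \<and> (\<forall>i. \<omega> (Suc i) < \<omega> i) \<and> (\<forall>i. \<beta> < \<omega> i) \<and> (\<forall>i. \<omega> i \<le> c') \<and> c' < pi * a \<and>
    (\<forall>x\<in>topspace X. \<forall>y\<in>topspace X. (\<forall>i. z i x = z i y) \<longrightarrow> (\<forall>n\<ge>1. \<kappa> n x = \<kappa> n y))"
    using \<kappa> \<beta> by (rule separating_characters)
  then obtain \<omega> z c' where chars: "wave_series X d \<Phi> \<omega> z \<and> (\<forall>i. \<omega> (Suc i) < \<omega> i) \<and> (\<forall>i. \<beta> < \<omega> i) \<and> (\<forall>i. \<omega> i \<le> c') \<and> c' < pi * a \<and>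
    (\<forall>x\<in>topspace X. \<forall>y\<in>topspace X. (\<forall>i. z i x = z i y) \<longrightarrow> (\<forall>n\<ge>1. \<kappa> n x = \<kappa> n y))"
    by (elim exE)
  then have ws: "wave_series X d \<Phi> \<omega> z"
    and \<omega>: "\<And>i. \<omega> (Suc i) < \<omega> i" "\<And>i. \<beta> < \<omega> i" "\<And>i. \<omega> i \<le> c'" "c' < pi * a" by simp_all
  have zsep: "\<forall>x\<in>topspace X. \<forall>y\<in>topspace X. (\<forall>i. z i x = z i y) \<longrightarrow> (\<forall>n\<ge>1. \<kappa> n x = \<kappa> n y)"
    using chars by (elim conjE)
  interpret W: wave_series X d \<Phi> \<omega> z by (rule ws)
  have cF: "continuous_map X euclideanreal F" using F(1) by (simp add: admissible_def)
  define H where "H x = F x + W.waves x" for x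
  have cH: "continuous_map X euclideanreal H" unfolding H_def[abs_def] by (intro continuous_map_add cF W.continuous_waves)
  have split: "(LINT t|lborel. complex_of_real (H (\<Phi> t x)) * k t) =
      (LINT t|lborel. complex_of_real (F (\<Phi> t x)) * k t) + (LINT t|lborel. complex_of_real (W.waves (\<Phi> t x)) * k t)"
    if x: "x \<in> topspace X" and k: "integrable lborel k" for x k
  proof -
    have "(LINT t|lborel. complex_of_real (H (\<Phi> t x)) * k t) =
        (LINT t|lborel. complex_of_real (F (\<Phi> t x)) * k t + complex_of_real (W.waves (\<Phi> t x)) * k t)"
      by (simp add: H_def distrib_right)
    also have "\<dots> = (LINT t|lborel. complex_of_real (F (\<Phi> t x)) * k t) + (LINT t|lborel. complex_of_real (W.waves (\<Phi> t x)) * k t)"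
      by (intro Bochner_Integration.integral_add integrable_orbit_mult cF W.continuous_waves x k)
    finally show ?thesis .
  qed
  have null: "(LINT t|lborel. complex_of_real (F (\<Phi> t x)) * k t) = 0" if "x \<in> topspace X" "k \<in> null_kernels r \<delta>" for x k
    using F(1) that by (simp add: admissible_def)
  define h where "h x = (\<lambda>t. H (\<Phi> t x))" for x
  have mem: "h x \<in> band_limited a" if x: "x \<in> topspace X" for x
  proof (rule band_limitedI)
    show "continuous_on UNIV (h x)" unfolding h_def by (rule continuous_orbit[OF cH x])
    show "\<bar>h x t\<bar> \<le> 1" for t
      using F(2) W.abs_waves_le[OF flow_in[OF x, of t]] flow_in[OF x, of t]
      unfolding h_def H_def by (smt (verit) field_sum_of_halves)
    fix \<phi> assume \<phi>: "\<phi> \<in> test_functions_on (- {- (a / 2)..a / 2})"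
    have ik: "integrable lborel (fourier \<phi>)" by (rule integrable_fourier_test_function[OF \<phi>])
    have z0: "\<phi> \<xi> = 0" if "\<bar>\<xi>\<bar> \<le> a / 2" for \<xi>
      by (rule test_function_zero_off[OF \<phi>]) (use that in \<open>auto simp: abs_le_iff\<close>)
    have wave0: "(LINT t|lborel. cis (\<mu> * t) * fourier \<phi> t) = 0" if \<mu>: "\<bar>\<mu>\<bar> \<le> c'" for \<mu>
    proof (rule integral_wave_mult_fourier_eq_0[OF \<phi>])
      show "0 < pi * a - c'" using \<omega> by simp
      fix \<xi> assume "\<bar>2 * pi * \<xi> - \<mu>\<bar> \<le> pi * a - c'"
      then have "\<bar>2 * pi * \<xi>\<bar> \<le> pi * a" using \<mu> by linarith
      then have "\<bar>\<xi>\<bar> * (2 * pi) \<le> (a / 2) * (2 * pi)" by (simp add: abs_mult mult.commute)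
      then show "\<phi> \<xi> = 0" by (intro z0) simp
    qed
    have "\<bar>\<omega> i\<bar> \<le> c'" for i using \<omega>(2,3)[of i] \<beta>(1) by simp
    then have "(LINT t|lborel. complex_of_real (W.waves (\<Phi> t x)) * fourier \<phi> t) = 0"
      by (intro W.integral_waves_eq_0[OF x ik] wave0) auto
    moreover have "fourier \<phi> \<in> null_kernels r \<delta>"
      by (rule fourier_in_null_kernels[OF \<delta> r(2) _ \<phi>]) (use \<beta> in \<open>simp add: \<beta>_def\<close>)
    ultimately show "(LINT t|lborel. complex_of_real (h x t) * fourier \<phi> t) = 0"
      using split[OF x ik] null[OF x] by (simp add: h_def)
  qed
  have "continuous_map X (band_limited_topology a) h"
    unfolding h_def[abs_def] using cH mem by (intro continuous_orbit_map) (simp_all add: h_def)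
  moreover have "inj_on h (topspace X)"
  proof (rule inj_onI)
    fix x y assume x: "x \<in> topspace X" and y: "y \<in> topspace X" and hxy: "h x = h y"
    \<comment> \<open>The \<open>j\<close>-th wave kernel kills the signal of \<open>F\<close> and all waves but the \<open>j\<close>-th.\<close>
    have zz: "z j x = z j y" for j
    proof -
      obtain \<delta>' where \<delta>': "\<delta>' > 0" "\<beta> + 2 * \<delta>' < \<omega> j" "\<And>i. i \<noteq> j \<Longrightarrow> 2 * \<delta>' < \<bar>\<omega> j - \<omega> i\<bar>"
        "\<And>i. 2 * \<delta>' < \<bar>\<omega> j + \<omega> i\<bar>"
        by (rule isolated_terms[of \<omega> \<beta> j, OF \<omega>(1) \<beta>(1) \<omega>(2)]) (rule that; assumption)
      have k: "wave_kernel \<delta>' (\<omega> j) \<in> null_kernels r \<delta>"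
        using \<delta>'(2) by (intro wave_kernel_in_null_kernels[OF \<delta> r(2) \<delta>'(1)]) (simp add: \<beta>_def)
      define C where "C = complex_of_real ((1 / 2) ^ (j + 3) * (sinc_energy / \<delta>'))"
      have "(LINT t|lborel. complex_of_real (h w t) * wave_kernel \<delta>' (\<omega> j) t) = C * z j w" if w: "w \<in> topspace X" for w
        using split[OF w integrable_wave_kernel[OF \<delta>'(1)]] null[OF w k]
          W.integral_waves_wave_kernel[OF w \<delta>'(1,3,4)] by (simp add: h_def C_def)
      from this[OF x] this[OF y] have "C * z j x = C * z j y" unfolding hxy by (rule trans[OF sym])
      moreover have "C \<noteq> 0" using sinc_energy_pos \<delta>'(1) by (simp add: C_def)
      ultimately show ?thesis by simp
    qed
    have "W.waves (\<Phi> t x) = W.waves (\<Phi> t y)" for t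
      by (simp add: W.waves_def W.z_flow[OF x] W.z_flow[OF y] zz)
    moreover have "H (\<Phi> t x) = H (\<Phi> t y)" for t using fun_cong[OF hxy, of t] by (simp add: h_def)
    ultimately have "F (\<Phi> t x) = F (\<Phi> t y)" for t by (simp add: H_def)
    moreover have "\<forall>n\<ge>1. \<kappa> n x = \<kappa> n y" using zsep x y zz by blast
    ultimately show "x = y" using Fsep x y by blast
  qed
  moreover have "\<forall>x\<in>topspace X. \<forall>r. h (\<Phi> r x) = shift r (h x)"
    by (simp add: h_def shift_def flow_add)
  ultimately show ?thesis by blast
qed

end
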